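(* Let $1\le p<\infty$ and let $E$ and $F$ be Banach spaces. Then, for every $m\in\mathbb N$, $(\mathcal P_{K_p}(^mF;E),\|\cdot\|)$ is isometrically isomorphic to $\mathcal L_\epsilon(E'_{cp};(\mathcal P(^mF),\|\cdot\|))$. As a consequence, a Banach space $E$ has the $p$-approximation property if and only if $\mathcal P(^mF)\otimes E$ is $\|\cdot\|$-dense in $\mathcal P_{K_p}(^mF;E)$ for all Banach spaces $F$ and all $m\in\mathbb N$.
   Context: Banach spaces are complex; $B_E$ is the closed unit ball of $E$. $\mathcal P(^mF;E)$ is the space of continuous $m$-homogeneous polynomials from $F$ to $E$ with norm $\|P\|=\sup_{x\in B_F}\|P(x)\|$; $\mathcal P(^mF)$ is the scalar-valued case; $\mathcal P(^mF)\otimes E$ is the set of finite sums $x\mapsto\sum_jP_j(x)e_j$ with $P_j\in\mathcal P(^mF)$, $e_j\in E$. $\ell_p(E)$ is the space of $p$-summable sequences in $E$. A set $K\subset E$ is relatively $p$-compact if it is contained in the closure of $\{\sum_n\alpha_nx_n:(\alpha_n)_n\in B_{\ell_q}\}$ for some $(x_n)_n\in\ell_p(E)$, $\frac1p+\frac1q=1$. $P\in\mathcal P(^mF;E)$ is $p$-compact if $P(B_F)$ is relatively $p$-compact; $\mathcal P_{K_p}(^mF;E)$ is the space of these. $E'_{cp}$ is $E'$ with the topology of uniform convergence on $p$-compact subsets of $E$. For a locally convex space $G$, $\mathcal L_\epsilon(E'_{cp};G)$ is the space of continuous linear operators from $E'_{cp}$ to $G$ with the topology of uniform convergence on equicontinuous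 subsets of $E'$; when $G$ is a normed space this is the topology of the norm $T\mapsto\sup_{y'\in B_{E'}}\|T(y')\|$, with respect to which "isometrically" is understood. $E$ has the $p$-approximation property if for every $p$-compact set $K\subset E$ and every $\varepsilon>0$ there is a finite rank bounded operator $T:E\to E$ with $\sup_{x\in K}\|Tx-x\|<\varepsilon$. *)

theory Defs
  imports "HOL-Analysis.Analysis" "HOL-Library.Function_Algebras"
begin

section \<open>Complex vector spaces and complex Banach spaces\<close>

class complex_vector = ab_group_add +
  fixes scaleC :: "complex \<Rightarrow> 'a \<Rightarrow> 'a"  (infixr "*\<^sub>C" 75)
  assumes scaleC_add_right: "a *\<^sub>C (x + y) = a *\<^sub>C x + a *\<^sub>C y"
    and scaleC_add_left: "(a + b) *\<^sub>C x = a *\<^sub>C x + b *\<^sub>C x"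
    and scaleC_scaleC: "a *\<^sub>C (b *\<^sub>C x) = (a * b) *\<^sub>C x"
    and scaleC_one: "1 *\<^sub>C x = x"

lemma vector_space_scaleC:
  "vector_space (scaleC :: complex \<Rightarrow> 'a \<Rightarrow> 'a::complex_vector)"
  by unfold_locales (auto simp: scaleC_add_right scaleC_add_left scaleC_scaleC scaleC_one)

abbreviation csubspace :: "'a::complex_vector set \<Rightarrow> bool" where
  "csubspace \<equiv> module.subspace scaleC"

abbreviation cspan :: "'a::complex_vector set \<Rightarrow> 'a set" where
  "cspan \<equiv> module.span scaleC"

class complex_banach = complex_vector + banach +
  assumes scaleR_scaleC: "r *\<^sub>R x = complex_of_real r *\<^sub>C x"
    and norm_scaleC: "norm (a *\<^sub>C x) = cmod a * norm x"

instantiation complex :: complex_banach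
begin
definition scaleC_complex :: "complex \<Rightarrow> complex \<Rightarrow> complex" where
  "scaleC_complex a x = a * x"
instance
  by standard (simp_all add: scaleC_complex_def algebra_simps norm_mult scaleR_conv_of_real)
end

instantiation "fun" :: (type, complex_vector) complex_vector
begin
definition scaleC_fun :: "complex \<Rightarrow> ('a \<Rightarrow> 'b) \<Rightarrow> 'a \<Rightarrow> 'b" where
  "scaleC_fun a f = (\<lambda>x. a *\<^sub>C f x)"
instance
  by standard
    (simp_all add: scaleC_fun_def fun_eq_iff scaleC_add_right scaleC_add_left scaleC_scaleC scaleC_one)
end

instantiation prod :: (complex_vector, complex_vector) complex_vector
begin
definition scaleC_prod :: "complex \<Rightarrow> 'a \<times> 'b \<Rightarrow> 'a \<times> 'b" where
  "scaleC_prod a z = (a *\<^sub>C fst z, a *\<^sub>C snd z)"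
instance
  by standard
    (simp_all add: scaleC_prod_def prod_eq_iff scaleC_add_right scaleC_add_left scaleC_scaleC scaleC_one)
end

text \<open>
  A type cannot be quantified inside a formula, so spaces that have to be (the domains of
  the polynomials), as well as spaces of functions, are pairs \<open>(X, N)\<close>: a complex
  linear subspace \<open>X\<close> of an ambient (purely algebraic) vector space type, and a
  norm \<open>N\<close>, of which only the values on \<open>X\<close> matter.
  The metric is set to \<open>0\<close> off \<open>X\<close> because the locale \<open>Metric_space\<close> requires symmetry
  and nonnegativity on the whole type.
\<close>

definition norm_dist :: "'a::ab_group_add set \<Rightarrow> ('a \<Rightarrow> real) \<Rightarrow> 'a \<Rightarrow> 'a \<Rightarrow> real" where
  "norm_dist X N x y = (if x \<in> X \<and> y \<in> X then N (x - y) else 0)"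

definition norm_topology :: "'a::ab_group_add set \<Rightarrow> ('a \<Rightarrow> real) \<Rightarrow> 'a topology" where
  "norm_topology X N = Metric_space.mtopology X (norm_dist X N)"

definition complex_banach_on :: "'a::complex_vector set \<Rightarrow> ('a \<Rightarrow> real) \<Rightarrow> bool" where
  "complex_banach_on X N \<longleftrightarrow>
     csubspace X \<and>
     (\<forall>x\<in>X. 0 \<le> N x \<and> (N x = 0 \<longleftrightarrow> x = 0)) \<and>
     (\<forall>x\<in>X. \<forall>a. N (a *\<^sub>C x) = cmod a * N x) \<and>
     (\<forall>x\<in>X. \<forall>y\<in>X. N (x + y) \<le> N x + N y) \<and>
     Metric_space.mcomplete X (norm_dist X N)"

definition unit_ball_on :: "'a set \<Rightarrow> ('a \<Rightarrow> real) \<Rightarrow> 'a set" where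
  "unit_ball_on X N = {x \<in> X. N x \<le> 1}"

definition clinear_on :: "'a::complex_vector set \<Rightarrow> ('a \<Rightarrow> 'b::complex_vector) \<Rightarrow> bool" where
  "clinear_on X f \<longleftrightarrow>
     (\<forall>x\<in>X. \<forall>y\<in>X. f (x + y) = f x + f y) \<and> (\<forall>a. \<forall>x\<in>X. f (a *\<^sub>C x) = a *\<^sub>C f x)"

definition isometrically_isomorphic ::
    "'a::complex_vector set \<Rightarrow> ('a \<Rightarrow> real) \<Rightarrow> 'b::complex_vector set \<Rightarrow> ('b \<Rightarrow> real) \<Rightarrow> bool" where
  "isometrically_isomorphic X N Y M \<longleftrightarrow>
     (\<exists>\<Phi>. bij_betw \<Phi> X Y \<and> clinear_on X \<Phi> \<and> (\<forall>x\<in>X. M (\<Phi> x) = N x))"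

definition norm_dense_in :: "'a::ab_group_add set \<Rightarrow> 'a set \<Rightarrow> ('a \<Rightarrow> real) \<Rightarrow> bool" where
  "norm_dense_in D X N \<longleftrightarrow> D \<subseteq> X \<and> norm_topology X N closure_of D = X"


section \<open>$p$-compact sets and the $p$-approximation property\<close>

definition ell_p :: "real \<Rightarrow> (nat \<Rightarrow> 'e::complex_banach) set" where
  "ell_p p = {x. summable (\<lambda>n. norm (x n) powr p)}"

definition ell_q_ball :: "ereal \<Rightarrow> (nat \<Rightarrow> complex) set" where
  "ell_q_ball q =
     (if q = \<infinity> then {\<alpha>. \<forall>n. cmod (\<alpha> n) \<le> 1}
      else {\<alpha>. summable (\<lambda>n. cmod (\<alpha> n) powr real_of_ereal q) \<and>
               (\<Sum>n. cmod (\<alpha> n) powr real_of_ereal q) powr (1 / real_of_ereal q) \<le> 1})"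

text \<open>The condition \<open>1 \<le> q\<close> excludes the spurious solution \<open>q = -\<infinity>\<close> for \<open>p = 1\<close>.\<close>

definition relatively_p_compact :: "real \<Rightarrow> 'e::complex_banach set \<Rightarrow> bool" where
  "relatively_p_compact p K \<longleftrightarrow>
     (\<exists>q x. 1 \<le> q \<and> 1 / ereal p + 1 / q = 1 \<and> x \<in> ell_p p \<and>
        K \<subseteq> closure {(\<Sum>n. \<alpha> n *\<^sub>C x n) |\<alpha>. \<alpha> \<in> ell_q_ball q})"

definition p_compact :: "real \<Rightarrow> 'e::complex_banach set \<Rightarrow> bool" where
  "p_compact p K \<longleftrightarrow> closed K \<and> relatively_p_compact p K"

definition bounded_clinear :: "('e::complex_banach \<Rightarrow> 'g::complex_banach) \<Rightarrow> bool" where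
  "bounded_clinear f \<longleftrightarrow> clinear_on UNIV f \<and> bounded_linear f"

text \<open>
  \<open>p_compact p K\<close> makes \<open>K\<close> compact, so (for nonempty \<open>K\<close>) the pointwise strict inequality
  below says that the supremum over \<open>K\<close> is smaller than \<open>\<epsilon>\<close>; likewise in \<open>dual_cp\<close>.
\<close>

definition p_approximation_property :: "real \<Rightarrow> 'e::complex_banach itself \<Rightarrow> bool" where
  "p_approximation_property p _ \<longleftrightarrow>
     (\<forall>K :: 'e set. p_compact p K \<longrightarrow>
        (\<forall>\<epsilon>>0. \<exists>T :: 'e \<Rightarrow> 'e. bounded_clinear T \<and> (\<exists>B. finite B \<and> range T \<subseteq> cspan B) \<and>
           (\<forall>x\<in>K. norm (T x - x) < \<epsilon>)))"


section \<open>The dual space and operators on it\<close>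

definition dual :: "('e::complex_banach \<Rightarrow> complex) set" where
  "dual = {\<phi>. bounded_clinear \<phi>}"

text \<open>The topology on the dual of uniform convergence on $p$-compact sets.\<close>

definition dual_cp :: "real \<Rightarrow> ('e::complex_banach \<Rightarrow> complex) topology" where
  "dual_cp p = topology_generated_by
     {{\<psi> \<in> dual. \<forall>x\<in>K. cmod (\<psi> x - \<phi> x) < \<epsilon>} |\<phi> K \<epsilon>. \<phi> \<in> dual \<and> p_compact p K \<and> 0 < \<epsilon>}"

text \<open>Functions on a carrier are made unique by requiring them to vanish off the carrier.\<close>

definition L_cp ::
    "real \<Rightarrow> 'g::complex_vector set \<Rightarrow> ('g \<Rightarrow> real) \<Rightarrow> (('e::complex_banach \<Rightarrow> complex) \<Rightarrow> 'g) set" where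
  "L_cp p G N = {T. clinear_on dual T \<and> continuous_map (dual_cp p) (norm_topology G N) T \<and>
                    (\<forall>\<phi>. \<phi> \<notin> dual \<longrightarrow> T \<phi> = 0)}"

definition eps_norm :: "('g \<Rightarrow> real) \<Rightarrow> (('e::complex_banach \<Rightarrow> complex) \<Rightarrow> 'g) \<Rightarrow> real" where
  "eps_norm N T = (SUP \<phi>\<in>unit_ball_on dual onorm. N (T \<phi>))"


section \<open>Homogeneous polynomials\<close>

text \<open>Multilinear maps of \<open>m\<close> arguments take lists of length \<open>m\<close>.\<close>

definition multilinear_on ::
    "nat \<Rightarrow> 'f::complex_vector set \<Rightarrow> ('f list \<Rightarrow> 'e::complex_vector) \<Rightarrow> bool" where
  "multilinear_on m X A \<longleftrightarrow>
     (\<forall>xs i. length xs = m \<and> set xs \<subseteq> X \<and> i < m \<longrightarrow> clinear_on X (\<lambda>u. A (xs[i := u])))"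

definition hom_poly ::
    "nat \<Rightarrow> 'f::complex_vector set \<Rightarrow> ('f \<Rightarrow> real) \<Rightarrow> ('f \<Rightarrow> 'e::complex_banach) set" where
  "hom_poly m X N = {P. (\<exists>A. multilinear_on m X A \<and> (\<forall>x\<in>X. P x = A (replicate m x))) \<and>
                        continuous_map (norm_topology X N) euclidean P \<and>
                        (\<forall>x. x \<notin> X \<longrightarrow> P x = 0)}"

definition poly_norm :: "'f set \<Rightarrow> ('f \<Rightarrow> real) \<Rightarrow> ('f \<Rightarrow> 'e::complex_banach) \<Rightarrow> real" where
  "poly_norm X N P = (SUP x\<in>unit_ball_on X N. norm (P x))"

definition p_compact_poly ::
    "real \<Rightarrow> nat \<Rightarrow> 'f::complex_vector set \<Rightarrow> ('f \<Rightarrow> real) \<Rightarrow> ('f \<Rightarrow> 'e::complex_banach) set" where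
  "p_compact_poly p m X N = {P \<in> hom_poly m X N. relatively_p_compact p (P ` unit_ball_on X N)}"

definition poly_tensor ::
    "nat \<Rightarrow> 'f::complex_vector set \<Rightarrow> ('f \<Rightarrow> real) \<Rightarrow> ('f \<Rightarrow> 'e::complex_banach) set" where
  "poly_tensor m X N =
     {(\<lambda>x. \<Sum>j<n. Q j x *\<^sub>C e j) |(n::nat) (Q :: nat \<Rightarrow> 'f \<Rightarrow> complex) (e :: nat \<Rightarrow> 'e).
        \<forall>j<n. Q j \<in> hom_poly m X N}"

text \<open>
  Quantifying over all Banach spaces \<open>F\<close> inside a formula, as a criterion for a property of the
  Banach space type \<open>'e\<close>, is done over all pairs \<open>(X, N)\<close> with \<open>X\<close> a subspace of \<open>'e \<times> 'f\<close>,
  where \<open>'f\<close> is an arbitrary complex vector space type. As \<open>'f\<close> varies this covers, up to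
  isometric isomorphism, every Banach space. The factor \<open>'e\<close> guarantees that the range of
  the quantifier is never too small for the criterion to be sufficient (as it would be for
  a one-element type \<open>'f\<close> alone).
\<close>

end

(*
  The isomorphism sends P to the operator phi |-> phi o P. For surjectivity, continuity of an
  operator T on E'_cp provides a p-summable sequence z such that every functional
  phi |-> (T phi)(u) with u in the unit ball of F is dominated by
  sup {|sum_n a_n phi(z_n)| : a in the unit ball of l_q}. By the Hahn-Banach theorem and the
  duality of l_p and l_q such a functional is evaluation at a point P(u) = sum_n a_n z_n.
  The map P is weakly a homogeneous polynomial, hence one by the polarization formula, and it is
  continuous since its range on the unit ball lies in a compact set, where the weak and norm
  topologies agree.

  If E has the p-approximation property, then T o P with T of finite rank approximates P.
  Conversely, a p-compact set lies in the closed hull K of {sum_n a_n x_n}, and one may write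
  x_n = d_n z_n with z still p-summable and d_n decreasing to 0. The span X of the closed hull of z
  is a Banach space under its gauge, and the inclusion of X into E is a p-compact 1-homogeneous
  polynomial. It is therefore approximated by some sum_j Q_j e_j with Q_j in X', and Hahn-Banach
  together with the same duality shows that each Q_j can be approximated uniformly on K by
  functionals in E'.
*)

theory Submission
  imports Defs
begin

text \<open>Both halves rest on \<open>ell_q_ball_representation\<close>: a functional dominated by
  the support function of the unit ball of l_q, read along a linear map into l_p, is given by a
  point of that ball. The extension happens in l_p and not in a bidual, so the representing point
  sum_n a_n z_n lies in E itself and no weak-star compactness enters. As l_q is the dual of l_p for
  every finite p, the case p = 1 is covered by the same argument.

  The factors d_n in the converse half answer an obstacle at p = 1. A functional Q_j on the span of
  the hull of z is bounded for the gauge only, and the tails of sum_n a_n z_n need not tend to 0 in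
  the gauge when a is merely bounded; so Q_j need not commute with the sum. For x_n = d_n z_n the
  tail from N on lies in d_N times the hull of z, where Q_j is of size d_N, and the interchange is
  justified.

  The polarization formula is used because it depends on the values of P alone: multilinear maps
  chosen for each phi o P separately need not come from one map into E.\<close>

interpretation complex_vector: vector_space "scaleC :: complex \<Rightarrow> 'a \<Rightarrow> 'a::complex_vector"
  by (rule vector_space_scaleC)

section \<open>The Hahn--Banach theorem\<close>

text \<open>Real scalars appear as complex ones because a \<open>complex_vector\<close> has no
  \<open>scaleR\<close>. Homogeneity is asked for as an inequality only, which infima inherit
  directly; applying it to \<open>1 / r\<close> gives equality.\<close>

definition real_sublinear :: "('a::complex_vector \<Rightarrow> real) \<Rightarrow> bool" where
  "real_sublinear q \<longleftrightarrow>
     (\<forall>x y. q (x + y) \<le> q x + q y) \<and> (\<forall>r>0. \<forall>x. q (complex_of_real r *\<^sub>C x) \<le> r * q x)"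

lemma real_sublinear_add: "real_sublinear q \<Longrightarrow> q (x + y) \<le> q x + q y"
  and real_sublinear_scale_le: "real_sublinear q \<Longrightarrow> 0 < r \<Longrightarrow> q (complex_of_real r *\<^sub>C x) \<le> r * q x"
  by (auto simp: real_sublinear_def)

lemma real_sublinear_scale:
  assumes "real_sublinear q" "0 < r"
  shows "q (complex_of_real r *\<^sub>C x) = r * q x"
proof (rule antisym)
  have "q (complex_of_real (1 / r) *\<^sub>C complex_of_real r *\<^sub>C x) \<le> 1 / r * q (complex_of_real r *\<^sub>C x)"
    using assms by (intro real_sublinear_scale_le) auto
  moreover have "complex_of_real (1 / r) *\<^sub>C complex_of_real r *\<^sub>C x = x"
    using assms by (simp add: scaleC_scaleC scaleC_one)
  ultimately show "r * q x \<le> q (complex_of_real r *\<^sub>C x)"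
    using assms by (simp add: field_simps)
qed (rule real_sublinear_scale_le[OF assms])

lemma real_sublinear_zero:
  assumes "real_sublinear q"
  shows "q 0 = 0"
  using real_sublinear_scale[OF assms, of 2 0] by simp

lemma real_sublinear_minus:
  assumes "real_sublinear q"
  shows "- q (- x) \<le> q x"
  using real_sublinear_add[OF assms, of x "- x"] real_sublinear_zero[OF assms] by simp

text \<open>For subadditivity of pointwise infima: the two values on the right may come from
  different functionals, and it is enough that some value on the left lies below their sum.\<close>

lemma cInf_add_le:
  fixes A B C :: "real set"
  assumes "A \<noteq> {}" "B \<noteq> {}" "bdd_below C"
    and "\<And>a b. a \<in> A \<Longrightarrow> b \<in> B \<Longrightarrow> \<exists>c\<in>C. c \<le> a + b"
  shows "Inf C \<le> Inf A + Inf B"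
proof -
  have "Inf C \<le> a + b" if "a \<in> A" "b \<in> B" for a b
    using assms(4)[OF that] cInf_lower[OF _ assms(3)] by (meson order_trans)
  then have "Inf C - a \<le> Inf B" if "a \<in> A" for a
    using that by (intro cInf_greatest[OF assms(2)]) (force simp: algebra_simps)
  then have "Inf C - Inf B \<le> Inf A"
    by (intro cInf_greatest[OF assms(1)]) (force simp: algebra_simps)
  then show ?thesis by simp
qed

lemma cInf_scale_le:
  fixes A C :: "real set"
  assumes "A \<noteq> {}" "bdd_below C" "0 < r"
    and "\<And>a. a \<in> A \<Longrightarrow> \<exists>c\<in>C. c \<le> r * a"
  shows "Inf C \<le> r * Inf A"
proof -
  have "Inf C / r \<le> a" if "a \<in> A" for a
    using assms(4)[OF that] cInf_lower[OF _ assms(2)] assms(3)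
    by (metis mult.commute order_trans pos_divide_le_eq)
  then have "Inf C / r \<le> Inf A"
    by (intro cInf_greatest[OF assms(1)])
  then show ?thesis using assms(3) by (simp add: field_simps)
qed

text \<open>
  Lowering \<open>q\<close> so that functionals dominated by the result are at least \<open>c\<close> at \<open>m\<close> for all
  \<open>(m, c) \<in> G\<close>. Taking for \<open>G\<close> a ray shows that minimal sublinear functionals are
  linear; taking the graph of a functional forces an extension of that functional.
\<close>

lemma real_sublinear_lower:
  fixes q :: "'a::complex_vector \<Rightarrow> real"
  assumes q: "real_sublinear q"
    and G0: "(0, 0) \<in> G"
    and Gadd: "\<And>m c n d. (m, c) \<in> G \<Longrightarrow> (n, d) \<in> G \<Longrightarrow> (m + n, c + d) \<in> G"
    and Gscale: "\<And>m c r. (m, c) \<in> G \<Longrightarrow> 0 < r \<Longrightarrow> (complex_of_real r *\<^sub>C m, r * c) \<in> G"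
    and Gle: "\<And>m c. (m, c) \<in> G \<Longrightarrow> c \<le> q m"
  shows "\<exists>q'. real_sublinear q' \<and> q' \<le> q \<and> (\<forall>(m, c)\<in>G. \<forall>x. q' x \<le> q (x + m) - c)"
proof -
  define S where "S x = (\<lambda>(m, c). q (x + m) - c) ` G" for x
  have bdd: "bdd_below (S x)" for x
  proof
    fix v assume "v \<in> S x"
    then obtain m c where v: "v = q (x + m) - c" "(m, c) \<in> G"
      by (auto simp: S_def)
    have "q m \<le> q (x + m) + q (- x)"
      using real_sublinear_add[OF q, of "x + m" "- x"] by simp
    then show "- q (- x) \<le> v"
      using Gle[OF v(2)] v(1) by simp
  qed
  have ne: "S x \<noteq> {}" for x
    using G0 by (auto simp: S_def)
  have "real_sublinear (\<lambda>x. Inf (S x))"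
    unfolding real_sublinear_def
  proof (intro conjI allI impI)
    fix x y
    show "Inf (S (x + y)) \<le> Inf (S x) + Inf (S y)"
    proof (rule cInf_add_le[OF ne ne bdd])
      fix a b assume "a \<in> S x" "b \<in> S y"
      then obtain m c n d where *: "a = q (x + m) - c" "b = q (y + n) - d" "(m, c) \<in> G" "(n, d) \<in> G"
        by (auto simp: S_def)
      have "q (x + y + (m + n)) \<le> q (x + m) + q (y + n)"
        using real_sublinear_add[OF q, of "x + m" "y + n"] by (simp add: algebra_simps)
      moreover have "q (x + y + (m + n)) - (c + d) \<in> S (x + y)"
        using Gadd[OF *(3,4)] by (force simp: S_def)
      ultimately show "\<exists>c\<in>S (x + y). c \<le> a + b"
        using * by (intro bexI[of _ "q (x + y + (m + n)) - (c + d)"]) auto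
    qed
  next
    fix r :: real and x :: 'a assume r: "0 < r"
    show "Inf (S (complex_of_real r *\<^sub>C x)) \<le> r * Inf (S x)"
    proof (rule cInf_scale_le[OF ne bdd r])
      fix a assume "a \<in> S x"
      then obtain m c where *: "a = q (x + m) - c" "(m, c) \<in> G"
        by (auto simp: S_def)
      have "q (complex_of_real r *\<^sub>C x + complex_of_real r *\<^sub>C m) = r * q (x + m)"
        using real_sublinear_scale[OF q r] by (simp flip: scaleC_add_right)
      moreover have "q (complex_of_real r *\<^sub>C x + complex_of_real r *\<^sub>C m) - r * c \<in> S (complex_of_real r *\<^sub>C x)"
        using Gscale[OF *(2) r] by (force simp: S_def)
      ultimately show "\<exists>c\<in>S (complex_of_real r *\<^sub>C x). c \<le> r * a"
        using * by (force simp: algebra_simps)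
    qed
  qed
  moreover have le: "Inf (S x) \<le> q (x + m) - c" if "(m, c) \<in> G" for x m c
    by (rule cInf_lower[OF _ bdd]) (use that in \<open>force simp: S_def\<close>)
  moreover have "(\<lambda>x. Inf (S x)) \<le> q"
    using le[OF G0] by (auto simp: le_fun_def)
  ultimately show ?thesis by blast
qed

text \<open>Zorn's lemma for the reversed order. A chain is bounded below by its pointwise infimum,
  which is finite because \<open>- s (- x) \<le> - q (- x) \<le> q x\<close>; for subadditivity, two
  members of the chain are replaced by the smaller one.\<close>

lemma minimal_real_sublinear_exists:
  fixes s :: "'a::complex_vector \<Rightarrow> real"
  assumes s: "real_sublinear s"
  shows "\<exists>q. real_sublinear q \<and> q \<le> s \<and> (\<forall>q'. real_sublinear q' \<longrightarrow> q' \<le> q \<longrightarrow> q' = q)"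
proof -
  define A where "A = {q. real_sublinear q \<and> q \<le> s}"
  have "\<exists>m\<in>A. \<forall>a\<in>A. a \<le> m \<longrightarrow> a = m"
  proof (rule predicate_Zorn)
    show "partial_order_on A (relation_of (\<lambda>x y. y \<le> x) A)"
      by (rule partial_order_on_relation_ofI) auto
    fix C assume "C \<in> Chains (relation_of (\<lambda>x y. y \<le> x) A)"
    then have CA: "C \<subseteq> A" and chain: "\<And>a b. a \<in> C \<Longrightarrow> b \<in> C \<Longrightarrow> a \<le> b \<or> b \<le> a"
      by (auto simp: Chains_def relation_of_def)
    show "\<exists>u\<in>A. \<forall>a\<in>C. u \<le> a"
    proof (cases "C = {}")
      case True
      then show ?thesis using s by (auto simp: A_def)
    next
      case False
      define S where "S x = (\<lambda>q. q x) ` C" for x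
      have ne: "S x \<noteq> {}" for x using False by (auto simp: S_def)
      have bdd: "bdd_below (S x)" for x
      proof
        fix v assume "v \<in> S x"
        then obtain q where "q \<in> C" "v = q x" by (auto simp: S_def)
        with CA have "real_sublinear q" "q (- x) \<le> s (- x)" by (auto simp: A_def le_fun_def)
        with real_sublinear_minus[of q x] \<open>v = q x\<close> show "- s (- x) \<le> v" by simp
      qed
      have le: "Inf (S x) \<le> q x" if "q \<in> C" for x q
        by (rule cInf_lower[OF _ bdd]) (use that in \<open>auto simp: S_def\<close>)
      have sub: "real_sublinear (\<lambda>x. Inf (S x))"
        unfolding real_sublinear_def
      proof (intro conjI allI impI)
        fix x y
        show "Inf (S (x + y)) \<le> Inf (S x) + Inf (S y)"
        proof (rule cInf_add_le[OF ne ne bdd])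
          fix a b assume "a \<in> S x" "b \<in> S y"
          then obtain q1 q2 where q: "q1 \<in> C" "q2 \<in> C" "a = q1 x" "b = q2 y"
            by (auto simp: S_def)
          then obtain q3 where q3: "q3 \<in> C" "q3 \<le> q1" "q3 \<le> q2"
            using chain by blast
          then have "q3 (x + y) \<le> q3 x + q3 y" "q3 x \<le> a" "q3 y \<le> b"
            using CA q by (auto simp: A_def real_sublinear_def le_fun_def)
          with q3 show "\<exists>c\<in>S (x + y). c \<le> a + b"
            by (auto simp: S_def intro!: bexI[of _ q3])
        qed
      next
        fix r :: real and x :: 'a assume r: "0 < r"
        show "Inf (S (complex_of_real r *\<^sub>C x)) \<le> r * Inf (S x)"
        proof (rule cInf_scale_le[OF ne bdd r])
          fix a assume "a \<in> S x"
          then show "\<exists>c\<in>S (complex_of_real r *\<^sub>C x). c \<le> r * a"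
            using CA r by (auto simp: S_def A_def real_sublinear_def)
        qed
      qed
      obtain q where "q \<in> C" using False by blast
      have "Inf (S x) \<le> s x" for x
        using le[OF \<open>q \<in> C\<close>, of x] CA \<open>q \<in> C\<close> by (auto simp: A_def le_fun_def intro: order_trans)
      with sub have "(\<lambda>x. Inf (S x)) \<in> A"
        by (auto simp: A_def le_fun_def)
      then show ?thesis
        by (rule bexI[rotated]) (use le in \<open>auto simp: le_fun_def\<close>)
    qed
  qed
  then show ?thesis
    by (auto simp: A_def intro: order_trans)
qed

text \<open>A minimal q is linear. Lowering it along the ray through y yields a sublinear
  \<open>q' \<le> q\<close> with \<open>q' x \<le> q (x + y) - q y\<close>; minimality makes
  \<open>q' = q\<close>, which is the superadditivity that was missing.\<close>

lemma real_sublinear_dominates_linear: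
  fixes s :: "'a::complex_vector \<Rightarrow> real"
  assumes s: "real_sublinear s"
  shows "\<exists>g. (\<forall>x y. g (x + y) = g x + g y) \<and> (\<forall>r x. g (complex_of_real r *\<^sub>C x) = r * g x) \<and> g \<le> s"
proof -
  obtain q where q: "real_sublinear q" "q \<le> s" 
      and min: "\<And>q'. real_sublinear q' \<Longrightarrow> q' \<le> q \<Longrightarrow> q' = q"
    using minimal_real_sublinear_exists[OF s] by blast
  have add: "q (x + y) = q x + q y" for x y
  proof (rule antisym[OF real_sublinear_add[OF q(1)]])
    define G where "G = (\<lambda>t. (complex_of_real t *\<^sub>C y, t * q y)) ` {0..}"
    have "\<exists>q'. real_sublinear q' \<and> q' \<le> q \<and> (\<forall>(m, c)\<in>G. \<forall>x. q' x \<le> q (x + m) - c)"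
    proof (rule real_sublinear_lower[OF q(1)])
      show "(0, 0) \<in> G" by (auto simp: G_def intro!: image_eqI[of _ _ 0])
    next
      fix m c n d assume "(m, c) \<in> G" "(n, d) \<in> G"
      then obtain t u where "t \<ge> 0" "u \<ge> 0" "(m, c) = (complex_of_real t *\<^sub>C y, t * q y)"
        "(n, d) = (complex_of_real u *\<^sub>C y, u * q y)" by (auto simp: G_def)
      then show "(m + n, c + d) \<in> G"
        by (auto simp: G_def scaleC_add_left algebra_simps intro!: image_eqI[of _ _ "t + u"])
    next
      fix m c and r :: real assume "(m, c) \<in> G" "0 < r"
      then obtain t where "t \<ge> 0" "(m, c) = (complex_of_real t *\<^sub>C y, t * q y)"
        by (auto simp: G_def)
      then show "(complex_of_real r *\<^sub>C m, r * c) \<in> G" using \<open>0 < r\<close>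
        by (auto simp: G_def scaleC_scaleC intro!: image_eqI[of _ _ "r * t"])
    next
      fix m c assume "(m, c) \<in> G"
      then obtain t where "t \<ge> 0" "(m, c) = (complex_of_real t *\<^sub>C y, t * q y)"
        by (auto simp: G_def)
      then show "c \<le> q m"
        using real_sublinear_scale[OF q(1), of t y] real_sublinear_zero[OF q(1)]
        by (cases "t = 0") auto
    qed
    then obtain q' where q': "real_sublinear q'" "q' \<le> q" 
      "\<And>m c x. (m, c) \<in> G \<Longrightarrow> q' x \<le> q (x + m) - c" by blast
    have "(y, q y) \<in> G" by (auto simp: G_def scaleC_one intro!: image_eqI[of _ _ 1])
    then have "q' x \<le> q (x + y) - q y" by (rule q'(3))
    then show "q x + q y \<le> q (x + y)" using min[OF q'(1,2)] by simp
  qed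
  have neg: "q (- x) = - q x" for x
    using add[of x "- x"] real_sublinear_zero[OF q(1)] by simp
  have "q (complex_of_real r *\<^sub>C x) = r * q x" for r x
  proof (cases r "0 :: real" rule: linorder_cases)
    case less
    then have "q (complex_of_real (- r) *\<^sub>C x) = - r * q x"
      by (intro real_sublinear_scale[OF q(1)]) auto
    then show ?thesis using neg[of "complex_of_real r *\<^sub>C x"] by simp
  qed (use real_sublinear_scale[OF q(1)] real_sublinear_zero[OF q(1)] in auto)
  with add q show ?thesis by blast
qed

lemma csubspaceD:
  assumes "csubspace X"
  shows "0 \<in> X" "x \<in> X \<Longrightarrow> y \<in> X \<Longrightarrow> x + y \<in> X" "x \<in> X \<Longrightarrow> a *\<^sub>C x \<in> X"
    "x \<in> X \<Longrightarrow> y \<in> X \<Longrightarrow> x - y \<in> X" "x \<in> X \<Longrightarrow> - x \<in> X"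
  using assms
  by (simp_all add: complex_vector.subspace_0 complex_vector.subspace_add
        complex_vector.subspace_scale complex_vector.subspace_diff complex_vector.subspace_neg)

lemma csubspace_sum:
  "csubspace X \<Longrightarrow> (\<And>i. i \<in> I \<Longrightarrow> f i \<in> X) \<Longrightarrow> sum f I \<in> X"
  by (rule complex_vector.subspace_sum)

text \<open>Lowering s along the graph of f replaces the usual one-dimensional extensions: it gives
  a sublinear q with \<open>q (- m) \<le> - f m\<close>, so every linear \<open>g \<le> q\<close>
  satisfies \<open>f m \<le> g m\<close> on M, and the same at \<open>- m\<close> gives
  equality.\<close>

lemma hahn_banach_real:
  fixes s f :: "'a::complex_vector \<Rightarrow> real"
  assumes s: "real_sublinear s" and M: "csubspace M"
    and add: "\<And>x y. x \<in> M \<Longrightarrow> y \<in> M \<Longrightarrow> f (x + y) = f x + f y"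
    and scale: "\<And>r x. x \<in> M \<Longrightarrow> f (complex_of_real r *\<^sub>C x) = r * f x"
    and le: "\<And>x. x \<in> M \<Longrightarrow> f x \<le> s x"
  shows "\<exists>g. (\<forall>x y. g (x + y) = g x + g y) \<and> (\<forall>r x. g (complex_of_real r *\<^sub>C x) = r * g x) \<and>
             g \<le> s \<and> (\<forall>x\<in>M. g x = f x)"
proof -
  note M = csubspaceD[OF M]
  have "\<exists>q'. real_sublinear q' \<and> q' \<le> s \<and> (\<forall>(m, c)\<in>(\<lambda>m. (m, f m)) ` M. \<forall>x. q' x \<le> s (x + m) - c)"
  proof (rule real_sublinear_lower[OF s])
    show "(0, 0) \<in> (\<lambda>m. (m, f m)) ` M"
      using M(1) scale[OF M(1), of 0] by auto
  qed (use M add scale le in auto)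
  then obtain q where q: "real_sublinear q" "q \<le> s" "\<And>m x. m \<in> M \<Longrightarrow> q x \<le> s (x + m) - f m"
    by blast
  obtain g where g: "\<And>x y. g (x + y) = g x + g y" "\<And>r x. g (complex_of_real r *\<^sub>C x) = r * g x" "g \<le> q"
    using real_sublinear_dominates_linear[OF q(1)] by blast
  have ge: "f m \<le> g m" if "m \<in> M" for m
  proof -
    have "g (- m) \<le> q (- m)" using g(3) by (auto simp: le_fun_def)
    also have "\<dots> \<le> - f m" using q(3)[OF that, of "- m"] real_sublinear_zero[OF s] by simp
    finally show ?thesis using g(2)[of "-1" m] by (simp add: scaleC_one)
  qed
  have "g m = f m" if "m \<in> M" for m
    using ge[OF that] ge[OF M(5)[OF that]] g(2)[of "-1" m] scale[OF that, of "-1"]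
    by (simp add: scaleC_one)
  with g q(2) show ?thesis by (intro exI[of _ g]) (auto intro: order_trans)
qed

lemma clinear_on_add: "clinear_on X f \<Longrightarrow> x \<in> X \<Longrightarrow> y \<in> X \<Longrightarrow> f (x + y) = f x + f y"
  and clinear_on_scaleC: "clinear_on X f \<Longrightarrow> x \<in> X \<Longrightarrow> f (a *\<^sub>C x) = a *\<^sub>C f x"
  by (auto simp: clinear_on_def)

lemma clinear_on_diff:
  assumes "clinear_on X f" "csubspace X" "x \<in> X" "y \<in> X"
  shows "f (x - y) = f x - f y"
proof -
  have "f (x + (-1) *\<^sub>C y) = f x + (-1) *\<^sub>C f y"
    using assms by (simp add: clinear_on_add clinear_on_scaleC csubspaceD del: complex_vector.scale_minus_left)
  then show ?thesis by (simp add: scaleC_one)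
qed

lemma clinear_on_zero:
  assumes "clinear_on X f" "csubspace X"
  shows "f 0 = 0"
  using clinear_on_diff[OF assms, of 0 0] csubspaceD(1)[OF assms(2)] by simp

lemma clinear_on_sum:
  assumes "clinear_on X f" "csubspace X" "\<And>i. i \<in> I \<Longrightarrow> g i \<in> X"
  shows "f (sum g I) = (\<Sum>i\<in>I. f (g i))"
  using assms(3)
proof (induction I rule: infinite_finite_induct)
  case (insert i I)
  then show ?case
    using assms(1,2) by (simp add: clinear_on_add csubspace_sum)
qed (use assms clinear_on_zero in auto)

lemma unimodular_rotation: "\<exists>a. cmod a = 1 \<and> a * z = complex_of_real (cmod z)"
proof (cases "z = 0")
  case False
  have "z * cnj z = complex_of_real (cmod z) * complex_of_real (cmod z)"
    using complex_norm_square[of z] by (simp add: power2_eq_square)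
  with False show ?thesis
    by (intro exI[of _ "cnj z / complex_of_real (cmod z)"]) (simp add: norm_divide field_simps)
qed (auto intro: exI[of _ 1])

text \<open>The real version is applied to the real part of f. The bound on the modulus follows by
  rotating the value to the nonnegative real axis, where it agrees with the value of the real
  functional.\<close>

theorem hahn_banach:
  fixes s :: "'a::complex_vector \<Rightarrow> real" and f :: "'a \<Rightarrow> complex"
  assumes s_add: "\<And>x y. s (x + y) \<le> s x + s y" and s_scale: "\<And>a x. s (a *\<^sub>C x) \<le> cmod a * s x"
    and M: "csubspace M" and f: "clinear_on M f" and le: "\<And>x. x \<in> M \<Longrightarrow> cmod (f x) \<le> s x"
  shows "\<exists>g. clinear_on UNIV g \<and> (\<forall>x. cmod (g x) \<le> s x) \<and> (\<forall>x\<in>M. g x = f x)"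
proof -
  have s: "real_sublinear s"
    unfolding real_sublinear_def
  proof (intro conjI allI impI)
    show "s (complex_of_real r *\<^sub>C x) \<le> r * s x" if "0 < r" for r x
      using s_scale[of "complex_of_real r" x] that by simp
  qed (rule s_add)
  have "\<exists>u. (\<forall>x y. u (x + y) = u x + u y) \<and> (\<forall>r x. u (complex_of_real r *\<^sub>C x) = r * u x) \<and>
             u \<le> s \<and> (\<forall>x\<in>M. u x = Re (f x))"
    by (rule hahn_banach_real[OF s M])
       (use f le in \<open>auto simp: clinear_on_def scaleC_complex_def intro: order_trans[OF complex_Re_le_cmod]\<close>)
  then obtain u where u: "\<And>x y. u (x + y) = u x + u y" "\<And>r x. u (complex_of_real r *\<^sub>C x) = r * u x"
    "\<And>x. u x \<le> s x" "\<And>x. x \<in> M \<Longrightarrow> u x = Re (f x)" unfolding le_fun_def by blast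
  \<comment> \<open>A complex-linear functional is determined by its real part u, namely as u x - i
    u (i x).\<close>
  define g where "g x = Complex (u x) (- u (\<i> *\<^sub>C x))" for x
  have um: "u (- x) = - u x" for x
    using u(2)[of "-1" x] by (simp add: scaleC_one)
  have u_split: "u (a *\<^sub>C x) = Re a * u x + Im a * u (\<i> *\<^sub>C x)" for a x
  proof -
    have "a *\<^sub>C x = complex_of_real (Re a) *\<^sub>C x + complex_of_real (Im a) *\<^sub>C \<i> *\<^sub>C x"
      by (subst complex_eq[of a]) (simp add: scaleC_add_left scaleC_scaleC mult.commute)
    then have "u (a *\<^sub>C x) = u (complex_of_real (Re a) *\<^sub>C x + complex_of_real (Im a) *\<^sub>C \<i> *\<^sub>C x)"
      by (rule arg_cong)
    then show ?thesis by (simp only: u)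
  qed
  have "clinear_on UNIV g"
    unfolding clinear_on_def
  proof (intro conjI ballI allI)
    fix x y show "g (x + y) = g x + g y"
      by (simp add: g_def u scaleC_add_right complex_eq_iff)
  next
    fix a x
    have "u (\<i> *\<^sub>C a *\<^sub>C x) = - Im a * u x + Re a * u (\<i> *\<^sub>C x)"
      using u_split[of "\<i> * a" x] by (simp add: scaleC_scaleC)
    then show "g (a *\<^sub>C x) = a *\<^sub>C g x"
      by (simp add: g_def complex_eq_iff u_split[of a] scaleC_complex_def)
  qed
  moreover have "cmod (g x) \<le> s x" for x
  proof (cases "g x = 0")
    case True
    have "0 \<le> s x"
      using s_add[of x "- x"] s_scale[of "-1" x] real_sublinear_zero[OF s] by (simp add: scaleC_one)
    then show ?thesis using True by simp
  next
    case False
    obtain a where a: "cmod a = 1" "a * g x = complex_of_real (cmod (g x))"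
      using unimodular_rotation by blast
    have "g (a *\<^sub>C x) = a * g x"
      using \<open>clinear_on UNIV g\<close> by (simp add: clinear_on_def scaleC_complex_def)
    also note a(2)
    finally have "cmod (g x) = u (a *\<^sub>C x)" by (simp add: g_def complex_eq_iff)
    also have "\<dots> \<le> s (a *\<^sub>C x)" by (rule u)
    finally show ?thesis using a s_scale[of a x] by simp
  qed
  moreover have "g x = f x" if "x \<in> M" for x
  proof -
    have "u (\<i> *\<^sub>C x) = - Im (f x)"
      using u(4)[of "\<i> *\<^sub>C x"] M that f by (simp add: csubspaceD clinear_on_def scaleC_complex_def)
    then show ?thesis using u(4)[OF that] by (simp add: g_def)
  qed
  ultimately show ?thesis by blast
qed

section \<open>Conjugate exponents and the unit ball of $\ell_q$\<close>

definition conjugate_exponents :: "real \<Rightarrow> ereal \<Rightarrow> bool" where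
  "conjugate_exponents p q \<longleftrightarrow> 1 \<le> p \<and> 1 \<le> q \<and> 1 / ereal p + 1 / q = 1"

lemma conjugate_exponents_cases:
  assumes "conjugate_exponents p q"
  obtains "p = 1" "q = \<infinity>"
  | r where "1 < p" "1 < r" "q = ereal r" "1 / p + 1 / r = 1"
proof (cases q)
  case (real r)
  with assms have *: "1 \<le> p" "1 \<le> r" "1 / p + 1 / r = 1"
    by (auto simp: conjugate_exponents_def one_ereal_def)
  then have "p \<noteq> 1" "r \<noteq> 1" by auto
  with * real show ?thesis by (intro that(2)[of r]) auto
next
  case PInf
  with assms have "p = 1" by (auto simp: conjugate_exponents_def one_ereal_def)
  with PInf that show ?thesis by blast
next
  case MInf
  with assms show ?thesis by (auto simp: conjugate_exponents_def)
qed

lemma conjugate_exponents_mult: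
  fixes p r :: real
  assumes "1 < p" "1 < r" "1 / p + 1 / r = 1"
  shows "(r - 1) * p = r" "(p - 1) * r = p"
proof -
  have "p + r = p * r" using assms by (simp add: field_simps)
  then show "(r - 1) * p = r" "(p - 1) * r = p" by (simp_all add: algebra_simps)
qed

lemma conjugate_exponents_exists:
  assumes "1 \<le> p"
  shows "\<exists>q. conjugate_exponents p q"
proof (cases "p = 1")
  case True
  then show ?thesis
    by (intro exI[of _ \<infinity>]) (auto simp: conjugate_exponents_def one_ereal_def)
next
  case False
  with assms have "1 < p" by simp
  then show ?thesis
    by (intro exI[of _ "ereal (p / (p - 1))"])
       (auto simp: conjugate_exponents_def one_ereal_def field_simps)
qed

text \<open>Stated through partial sums, without the series and without the outer root, so that
  later estimates only involve finite sums.\<close>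

lemma ell_q_ball_real_iff:
  assumes "1 < r"
  shows "\<alpha> \<in> ell_q_ball (ereal r) \<longleftrightarrow> (\<forall>N. (\<Sum>n<N. cmod (\<alpha> n) powr r) \<le> 1)"
proof -
  have *: "s powr (1 / r) \<le> 1 \<longleftrightarrow> s \<le> 1" if "0 \<le> s" for s :: real
    using powr_le_cancel_iff powr_mono2[of "1 / r" s 1] assms that
      powr_mono2[of r "s powr (1 / r)" 1] by (auto simp: powr_powr)
  have nonneg: "0 \<le> cmod (\<alpha> n) powr r" for n by simp
  show ?thesis
  proof
    assume "\<alpha> \<in> ell_q_ball (ereal r)"
    then have sm: "summable (\<lambda>n. cmod (\<alpha> n) powr r)" and "(\<Sum>n. cmod (\<alpha> n) powr r) \<le> 1"
      using *[OF suminf_nonneg[of "\<lambda>n. cmod (\<alpha> n) powr r"]] by (auto simp: ell_q_ball_def)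
    then show "\<forall>N. (\<Sum>n<N. cmod (\<alpha> n) powr r) \<le> 1"
      using sum_le_suminf[OF sm] by (meson finite_lessThan nonneg order_trans)
  next
    assume le: "\<forall>N. (\<Sum>n<N. cmod (\<alpha> n) powr r) \<le> 1"
    then have sm: "summable (\<lambda>n. cmod (\<alpha> n) powr r)"
      by (intro summableI_nonneg_bounded[of _ 1]) auto
    moreover have "(\<Sum>n. cmod (\<alpha> n) powr r) \<le> 1"
      using le suminf_le_const[OF sm] by auto
    ultimately show "\<alpha> \<in> ell_q_ball (ereal r)"
      using * suminf_nonneg[OF sm] by (auto simp: ell_q_ball_def)
  qed
qed

lemma ell_q_ball_infinity_iff: "\<alpha> \<in> ell_q_ball \<infinity> \<longleftrightarrow> (\<forall>n. cmod (\<alpha> n) \<le> 1)"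
  by (simp add: ell_q_ball_def)

lemma powr_le_1_imp_le_1: "0 \<le> x \<Longrightarrow> 0 < r \<Longrightarrow> x powr r \<le> 1 \<Longrightarrow> x \<le> 1" for x r :: real
  by (metis gr_one_powr linorder_not_less)

lemma mult_powr_minus_1: "0 \<le> x \<Longrightarrow> x * x powr (r - 1) = x powr r" for x r :: real
  by (cases "x = 0") (auto simp: powr_diff)

lemma ell_q_ball_solid:
  assumes "conjugate_exponents p q" "\<alpha> \<in> ell_q_ball q" "\<And>n. cmod (\<beta> n) \<le> cmod (\<alpha> n)"
  shows "\<beta> \<in> ell_q_ball q"
  using assms(1)
proof (cases rule: conjugate_exponents_cases)
  case 1
  with assms show ?thesis by (meson ell_q_ball_infinity_iff order_trans)
next
  case (2 r)
  have "(\<Sum>n<N. cmod (\<beta> n) powr r) \<le> (\<Sum>n<N. cmod (\<alpha> n) powr r)" for N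
    using 2 assms(3) by (intro sum_mono powr_mono2) auto
  with 2 assms show ?thesis by (auto simp: ell_q_ball_real_iff intro: order_trans)
qed

lemma ell_q_ball_cmod_le_1:
  assumes "conjugate_exponents p q" "\<alpha> \<in> ell_q_ball q"
  shows "cmod (\<alpha> n) \<le> 1"
  using assms(1)
proof (cases rule: conjugate_exponents_cases)
  case (2 r)
  then have "(\<Sum>n<Suc n. cmod (\<alpha> n) powr r) \<le> 1"
    using assms(2) ell_q_ball_real_iff by blast
  moreover have "cmod (\<alpha> n) powr r \<le> (\<Sum>n<Suc n. cmod (\<alpha> n) powr r)"
    by (simp add: sum_nonneg)
  ultimately have "cmod (\<alpha> n) powr r \<le> 1" by linarith
  then show ?thesis
    using \<open>1 < r\<close> powr_le_1_imp_le_1[of "cmod (\<alpha> n)" r] by simp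
next
  case 1
  with assms show ?thesis by (simp add: ell_q_ball_infinity_iff)
qed

lemma ell_q_ball_unit:
  assumes "conjugate_exponents p q" "cmod a \<le> 1"
  shows "(\<lambda>n. if n = k then a else 0) \<in> ell_q_ball q"
  using assms(1)
proof (cases rule: conjugate_exponents_cases)
  case (2 r)
  have "(\<Sum>n<N. cmod (if n = k then a else 0) powr r) = (\<Sum>n<N. if n = k then cmod a powr r else 0)" for N
    by (intro sum.cong) auto
  then have "(\<Sum>n<N. cmod (if n = k then a else 0) powr r) \<le> 1" for N
    using assms(2) 2 by (simp add: powr_le1)
  with 2 show ?thesis by (simp only: ell_q_ball_real_iff simp_thms)
qed (use assms in \<open>auto simp: ell_q_ball_infinity_iff\<close>)

lemma ell_q_ball_zero: "conjugate_exponents p q \<Longrightarrow> (\<lambda>n. 0) \<in> ell_q_ball q"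
  using ell_q_ball_unit[of p q 0 0] by simp

text \<open>Convexity of \<open>t powr r\<close>, obtained by applying Young's inequality to \<open>w * w powr (r - 1)\<close>.\<close>

lemma powr_convex_comb_le:
  fixes s t u v :: real
  assumes "conjugate_exponents p (ereal r)" "1 < r" and st: "0 \<le> s" "0 \<le> t" "s + t \<le> 1" and uv: "0 \<le> u" "0 \<le> v"
  shows "(s * u + t * v) powr r \<le> s * u powr r + t * v powr r"
proof -
  have pr: "1 < p" "1 / p + 1 / r = 1"
    using assms(1) by (auto elim: conjugate_exponents_cases)
  note mult = conjugate_exponents_mult(1)[OF pr(1) \<open>1 < r\<close> pr(2)]
  define w where "w = s * u + t * v"
  have w: "0 \<le> w" using st uv by (simp add: w_def)
  have young: "x * w powr (r - 1) \<le> x powr r / r + w powr r / p" if "0 \<le> x" for x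
    using Youngs_inequality[of r p x "w powr (r - 1)"] pr \<open>1 < r\<close> that by (simp add: powr_powr mult)
  have "w powr r = w * w powr (r - 1)"
    using w by (simp add: mult_powr_minus_1)
  also have "\<dots> = s * (u * w powr (r - 1)) + t * (v * w powr (r - 1))"
    by (simp add: w_def algebra_simps)
  also have "\<dots> \<le> s * (u powr r / r + w powr r / p) + t * (v powr r / r + w powr r / p)"
    using st uv by (intro add_mono mult_left_mono young) auto
  also have "\<dots> = (s * u powr r + t * v powr r) / r + (s + t) * (w powr r / p)"
    by (simp add: algebra_simps add_divide_distrib)
  also have "(s + t) * (w powr r / p) \<le> 1 * (w powr r / p)"
    using st pr by (intro mult_right_mono) auto
  \<comment> \<open>The multiple of \<open>w powr r\<close> on the right is absorbed on the left;
    what remains there is \<open>w powr r / r\<close>, with the same denominator as on the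
    right.\<close>
  finally have "w powr r * (1 - 1 / p) \<le> (s * u powr r + t * v powr r) / r"
    by (simp add: algebra_simps)
  moreover have "1 - 1 / p = 1 / r" using pr by simp
  ultimately have "w powr r / r \<le> (s * u powr r + t * v powr r) / r" by simp
  then show ?thesis using \<open>1 < r\<close> by (simp add: w_def divide_le_cancel)
qed

text \<open>Termwise convexity of the r-th power takes the place of Minkowski's inequality; it
  covers absolutely convex combinations, which is what a disc asks for.\<close>

lemma ell_q_ball_abs_convex:
  assumes q: "conjugate_exponents p q" and "\<alpha> \<in> ell_q_ball q" "\<beta> \<in> ell_q_ball q" and ab: "cmod a + cmod b \<le> 1"
  shows "(\<lambda>n. a * \<alpha> n + b * \<beta> n) \<in> ell_q_ball q"
  using q
proof (cases rule: conjugate_exponents_cases)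
  case 1
  have "cmod (a * \<alpha> n + b * \<beta> n) \<le> cmod a * 1 + cmod b * 1" for n
    using assms ell_q_ball_cmod_le_1[OF q]
    by (intro order_trans[OF norm_triangle_ineq] add_mono) (auto simp: norm_mult mult_left_le)
  with 1 ab show ?thesis by (fastforce simp: ell_q_ball_infinity_iff intro: order_trans)
next
  case (2 r)
  have "(\<Sum>n<N. cmod (a * \<alpha> n + b * \<beta> n) powr r) \<le> 1" for N
  proof -
    have "(\<Sum>n<N. cmod (a * \<alpha> n + b * \<beta> n) powr r)
        \<le> (\<Sum>n<N. cmod a * cmod (\<alpha> n) powr r + cmod b * cmod (\<beta> n) powr r)"
    proof (intro sum_mono)
      fix n
      have "cmod (a * \<alpha> n + b * \<beta> n) powr r \<le> (cmod a * cmod (\<alpha> n) + cmod b * cmod (\<beta> n)) powr r"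
        using 2 norm_triangle_ineq[of "a * \<alpha> n" "b * \<beta> n"] by (intro powr_mono2) (auto simp: norm_mult)
      also have "\<dots> \<le> cmod a * cmod (\<alpha> n) powr r + cmod b * cmod (\<beta> n) powr r"
        using q 2 ab by (intro powr_convex_comb_le) auto
      finally show "cmod (a * \<alpha> n + b * \<beta> n) powr r \<le> \<dots>" .
    qed
    also have "\<dots> = cmod a * (\<Sum>n<N. cmod (\<alpha> n) powr r) + cmod b * (\<Sum>n<N. cmod (\<beta> n) powr r)"
      by (simp add: sum.distrib sum_distrib_left)
    also have "\<dots> \<le> cmod a * 1 + cmod b * 1"
      using assms 2 by (intro add_mono mult_left_mono) (auto simp: ell_q_ball_real_iff)
    finally show ?thesis using ab by simp
  qed
  with 2 show ?thesis by (simp add: ell_q_ball_real_iff)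
qed

text \<open>N depends on e but not on the multiplier. This uniformity gives the compactness of hulls
  and, in \<open>ell_q_ball_representation\<close>, the convergence of truncations in the support
  function of the ball.\<close>

lemma ell_q_ball_uniform_tails:
  fixes y :: "nat \<Rightarrow> real"
  assumes q: "conjugate_exponents p q" and y: "\<And>n. 0 \<le> y n" "summable (\<lambda>n. y n powr p)" and e: "0 < e"
  shows "\<exists>N. \<forall>\<alpha>\<in>ell_q_ball q. \<forall>m\<ge>N. \<forall>n. (\<Sum>k=m..<n. cmod (\<alpha> k) * y k) \<le> e"
  using q
proof (cases rule: conjugate_exponents_cases)
  case 1
  with y have "summable y" by (simp add: powr_one)
  then obtain N where N: "\<And>m n. m \<ge> N \<Longrightarrow> norm (sum y {m..<n}) < e"
    using e by (meson summable_Cauchy)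
  have "(\<Sum>k=m..<n. cmod (\<alpha> k) * y k) \<le> e" if "\<alpha> \<in> ell_q_ball q" "m \<ge> N" for \<alpha> m n
  proof -
    have "(\<Sum>k=m..<n. cmod (\<alpha> k) * y k) \<le> (\<Sum>k=m..<n. 1 * y k)"
      using y ell_q_ball_cmod_le_1[OF q that(1)] by (intro sum_mono mult_right_mono) auto
    also have "\<dots> \<le> e" using N[OF that(2), of n] by simp
    finally show ?thesis .
  qed
  then show ?thesis by blast
next
  case (2 r)
  \<comment> \<open>The weight in Young's inequality for
    \<open>(d * cmod (\<alpha> k)) * (y k / d)\<close>: with \<open>d powr r = e / 2\<close> the
    part of \<alpha> costs at most e / 2, and the divisor \<open>d powr p\<close> under y is
    compensated by the choice of N.\<close>
  define d where "d = (e / 2) powr (1 / r)"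
  have d: "0 < d" "d powr r = e / 2"
    using 2 e by (auto simp: d_def powr_powr)
  obtain N where N: "\<And>m n. m \<ge> N \<Longrightarrow> norm (\<Sum>k=m..<n. y k powr p) < e / 2 * d powr p"
    using y(2)[unfolded summable_Cauchy, rule_format, of "e / 2 * d powr p"] e d by auto
  have "(\<Sum>k=m..<n. cmod (\<alpha> k) * y k) \<le> e" if \<alpha>: "\<alpha> \<in> ell_q_ball q" "m \<ge> N" for \<alpha> m n
  proof -
    have "(\<Sum>k=m..<n. cmod (\<alpha> k) * y k) \<le> (\<Sum>k=m..<n. d powr r * cmod (\<alpha> k) powr r + y k powr p / d powr p)"
    proof (intro sum_mono)
      fix k
      have "cmod (\<alpha> k) * y k = (d * cmod (\<alpha> k)) * (y k / d)" using d by simp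
      also have "\<dots> \<le> (d * cmod (\<alpha> k)) powr r / r + (y k / d) powr p / p"
        using 2 d y by (intro Youngs_inequality) auto
      also have "\<dots> \<le> (d * cmod (\<alpha> k)) powr r / 1 + (y k / d) powr p / 1"
        using 2 by (intro add_mono divide_left_mono) auto
      also have "\<dots> = d powr r * cmod (\<alpha> k) powr r + y k powr p / d powr p"
        using d y by (simp add: powr_mult powr_divide)
      finally show "cmod (\<alpha> k) * y k \<le> \<dots>" .
    qed
    also have "\<dots> = e / 2 * (\<Sum>k=m..<n. cmod (\<alpha> k) powr r) + (\<Sum>k=m..<n. y k powr p) / d powr p"
      by (simp add: sum.distrib sum_distrib_left sum_divide_distrib d)
    also have "(\<Sum>k=m..<n. cmod (\<alpha> k) powr r) \<le> (\<Sum>k<n. cmod (\<alpha> k) powr r)"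
      by (intro sum_mono2) auto
    also have "\<dots> \<le> 1" using 2 \<alpha> by (auto simp: ell_q_ball_real_iff)
    also have "(\<Sum>k=m..<n. y k powr p) / d powr p \<le> e / 2"
      using N[OF \<alpha>(2), of n] d by (simp add: field_simps)
    finally show ?thesis using e by simp
  qed
  then show ?thesis by blast
qed

section \<open>The space l_p\<close>

lemma ell_p_scaleC:
  fixes x :: "nat \<Rightarrow> 'e::complex_banach"
  assumes "1 \<le> p" "x \<in> ell_p p"
  shows "(\<lambda>n. a *\<^sub>C x n) \<in> ell_p p"
  using assms by (simp add: ell_p_def norm_scaleC powr_mult summable_mult)

lemma ell_p_mono:
  fixes x :: "nat \<Rightarrow> 'e::complex_banach" and y :: "nat \<Rightarrow> 'g::complex_banach"
  assumes "1 \<le> p" "x \<in> ell_p p" "\<And>n. norm (y n) \<le> C * norm (x n)" "0 \<le> C"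
  shows "y \<in> ell_p p"
  unfolding ell_p_def mem_Collect_eq
proof (rule summable_comparison_test')
  show "summable (\<lambda>n. C powr p * norm (x n) powr p)"
    using assms by (simp add: ell_p_def summable_mult)
  show "norm (norm (y n) powr p) \<le> C powr p * norm (x n) powr p" for n
    using assms powr_mono2[of p "norm (y n)" "C * norm (x n)"] by (simp add: powr_mult)
qed

lemma ell_p_add:
  fixes x y :: "nat \<Rightarrow> 'e::complex_banach"
  assumes p: "1 \<le> p" and "x \<in> ell_p p" "y \<in> ell_p p"
  shows "(\<lambda>n. x n + y n) \<in> ell_p p"
  unfolding ell_p_def mem_Collect_eq
proof (rule summable_comparison_test')
  show "summable (\<lambda>n. 2 powr p * norm (x n) powr p + 2 powr p * norm (y n) powr p)"
    using assms by (intro summable_add summable_mult) (auto simp: ell_p_def)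
  fix n
  \<comment> \<open>Comparison with the larger of the two norms gives the constant
    \<open>2 powr p\<close> and avoids Minkowski's inequality.\<close>
  define m where "m = max (norm (x n)) (norm (y n))"
  have "norm (x n + y n) \<le> 2 * m"
    using norm_triangle_ineq[of "x n" "y n"] by (simp add: m_def)
  then have "norm (x n + y n) powr p \<le> 2 powr p * m powr p"
    using p powr_mono2[of p "norm (x n + y n)" "2 * m"] by (simp add: powr_mult m_def)
  also have "m powr p \<le> norm (x n) powr p + norm (y n) powr p"
    by (simp add: m_def max_def)
  finally show "norm (norm (x n + y n) powr p) \<le> 2 powr p * norm (x n) powr p + 2 powr p * norm (y n) powr p"
    by (simp add: algebra_simps)
qed

lemma csubspace_ell_p:
  assumes "1 \<le> p"
  shows "csubspace (ell_p p :: (nat \<Rightarrow> complex) set)"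
proof (rule complex_vector.subspaceI)
  show "0 \<in> (ell_p p :: (nat \<Rightarrow> complex) set)" by (simp add: ell_p_def)
  show "x + y \<in> ell_p p" if "x \<in> ell_p p" "y \<in> ell_p p" for x y :: "nat \<Rightarrow> complex"
    using ell_p_add[OF assms that] by (simp add: plus_fun_def)
  show "a *\<^sub>C x \<in> ell_p p" if "x \<in> ell_p p" for a and x :: "nat \<Rightarrow> complex"
    using ell_p_scaleC[OF assms that] by (simp add: scaleC_fun_def)
qed

section \<open>Series with multipliers in the unit ball of l_q\<close>

lemma ell_q_ball_uniform_suminf:
  fixes x :: "nat \<Rightarrow> 'e::complex_banach"
  assumes q: "conjugate_exponents p q" and x: "x \<in> ell_p p" and e: "0 < e"
  shows "\<exists>N. \<forall>\<alpha>\<in>ell_q_ball q. \<forall>m\<ge>N. \<forall>n. norm (\<Sum>k=m..<n. \<alpha> k *\<^sub>C x k) \<le> e"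
proof -
  have "\<exists>N. \<forall>\<alpha>\<in>ell_q_ball q. \<forall>m\<ge>N. \<forall>n. (\<Sum>k=m..<n. cmod (\<alpha> k) * norm (x k)) \<le> e"
    using x by (intro ell_q_ball_uniform_tails[OF q _ _ e]) (auto simp: ell_p_def)
  moreover have "norm (\<Sum>k=m..<n. \<alpha> k *\<^sub>C x k) \<le> (\<Sum>k=m..<n. cmod (\<alpha> k) * norm (x k))" for \<alpha> m n
    by (rule order_trans[OF norm_sum]) (simp add: norm_scaleC)
  ultimately show ?thesis by (meson order_trans)
qed

lemma ell_q_ball_summable:
  fixes x :: "nat \<Rightarrow> 'e::complex_banach"
  assumes q: "conjugate_exponents p q" and x: "x \<in> ell_p p" and \<alpha>: "\<alpha> \<in> ell_q_ball q"
  shows "summable (\<lambda>n. \<alpha> n *\<^sub>C x n)"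
  unfolding summable_Cauchy
proof (intro allI impI)
  fix e :: real assume "0 < e"
  then obtain N where N: "\<And>m n. m \<ge> N \<Longrightarrow> norm (\<Sum>k=m..<n. \<alpha> k *\<^sub>C x k) \<le> e / 2"
    using ell_q_ball_uniform_suminf[OF q x, of "e / 2"] \<alpha> by (meson half_gt_zero)
  then show "\<exists>N. \<forall>m\<ge>N. \<forall>n. norm (\<Sum>k=m..<n. \<alpha> k *\<^sub>C x k) < e"
    using \<open>0 < e\<close> by (intro exI[of _ N] allI impI order_le_less_trans[OF N]) auto
qed

lemma ell_q_ball_suminf_approx:
  fixes x :: "nat \<Rightarrow> 'e::complex_banach"
  assumes q: "conjugate_exponents p q" and x: "x \<in> ell_p p" and e: "0 < e"
  shows "\<exists>N. \<forall>\<alpha>\<in>ell_q_ball q. \<forall>m\<ge>N. norm ((\<Sum>n. \<alpha> n *\<^sub>C x n) - (\<Sum>n<m. \<alpha> n *\<^sub>C x n)) \<le> e"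
proof -
  obtain N where N: "\<And>\<alpha> m n. \<alpha> \<in> ell_q_ball q \<Longrightarrow> m \<ge> N \<Longrightarrow> norm (\<Sum>k=m..<n. \<alpha> k *\<^sub>C x k) \<le> e"
    using ell_q_ball_uniform_suminf[OF q x e] by blast
  have "norm ((\<Sum>n. \<alpha> n *\<^sub>C x n) - (\<Sum>n<m. \<alpha> n *\<^sub>C x n)) \<le> e" if \<alpha>: "\<alpha> \<in> ell_q_ball q" "m \<ge> N" for \<alpha> m
  proof (rule Lim_bounded)
    show "(\<lambda>n. norm ((\<Sum>k<n. \<alpha> k *\<^sub>C x k) - (\<Sum>n<m. \<alpha> n *\<^sub>C x n)))
        \<longlonglongrightarrow> norm ((\<Sum>n. \<alpha> n *\<^sub>C x n) - (\<Sum>n<m. \<alpha> n *\<^sub>C x n))"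
      using ell_q_ball_summable[OF q x \<alpha>(1)] by (intro tendsto_intros summable_LIMSEQ)
    show "\<forall>n\<ge>m. norm ((\<Sum>k<n. \<alpha> k *\<^sub>C x k) - (\<Sum>n<m. \<alpha> n *\<^sub>C x n)) \<le> e"
    proof (intro allI impI)
      fix n assume "m \<le> n"
      then have "(\<Sum>k<n. \<alpha> k *\<^sub>C x k) - (\<Sum>n<m. \<alpha> n *\<^sub>C x n) = (\<Sum>k=m..<n. \<alpha> k *\<^sub>C x k)"
        using sum_diff_nat_ivl[of 0 m n "\<lambda>k. \<alpha> k *\<^sub>C x k"] by (simp add: atLeast0LessThan)
      with N[OF \<alpha>, of n] show "norm ((\<Sum>k<n. \<alpha> k *\<^sub>C x k) - (\<Sum>n<m. \<alpha> n *\<^sub>C x n)) \<le> e" by simp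
    qed
  qed
  then show ?thesis by blast
qed

lemma ell_q_ball_suminf_bounded:
  fixes x :: "nat \<Rightarrow> 'e::complex_banach"
  assumes q: "conjugate_exponents p q" and x: "x \<in> ell_p p"
  shows "\<exists>C>0. \<forall>\<alpha>\<in>ell_q_ball q. norm (\<Sum>n. \<alpha> n *\<^sub>C x n) \<le> C"
proof -
  obtain N where N: "\<And>\<alpha>. \<alpha> \<in> ell_q_ball q \<Longrightarrow> norm ((\<Sum>n. \<alpha> n *\<^sub>C x n) - (\<Sum>n<N. \<alpha> n *\<^sub>C x n)) \<le> 1"
    using ell_q_ball_suminf_approx[OF q x, of 1] by auto
  have "norm (\<Sum>n. \<alpha> n *\<^sub>C x n) \<le> 1 + (\<Sum>n<N. norm (x n))" if \<alpha>: "\<alpha> \<in> ell_q_ball q" for \<alpha>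
  proof -
    have "norm (\<Sum>n<N. \<alpha> n *\<^sub>C x n) \<le> (\<Sum>n<N. norm (x n))"
      using ell_q_ball_cmod_le_1[OF q \<alpha>]
      by (intro order_trans[OF norm_sum] sum_mono) (simp add: norm_scaleC mult_left_le_one_le)
    then show ?thesis
      using N[OF \<alpha>] norm_triangle_sub[of "\<Sum>n. \<alpha> n *\<^sub>C x n" "\<Sum>n<N. \<alpha> n *\<^sub>C x n"] by simp
  qed
  moreover have "0 < 1 + (\<Sum>n<N. norm (x n))" by (simp add: add_pos_nonneg sum_nonneg)
  ultimately show ?thesis by blast
qed

text \<open>A converse Hoelder inequality: the bipolar of the ball, tested on finitely many
  coordinates, is the ball. The hypothesis speaks of every bound K instead of a supremum. For q =
  \<infinity> the unit vectors suffice as tests.\<close>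

lemma ell_q_ball_dual:
  assumes q: "conjugate_exponents p q"
    and le: "\<And>N y K. (\<And>\<beta>. \<beta> \<in> ell_q_ball q \<Longrightarrow> cmod (\<Sum>n<N. \<beta> n * y n) \<le> K) \<Longrightarrow> cmod (\<Sum>n<N. \<alpha> n * y n) \<le> K"
  shows "\<alpha> \<in> ell_q_ball q"
  using q
proof (cases rule: conjugate_exponents_cases)
  case 1
  have *: "(\<Sum>n<Suc k. \<beta> n * (if n = k then 1 else 0)) = \<beta> k" for \<beta> :: "nat \<Rightarrow> complex" and k
    by (simp add: if_distrib[of "\<lambda>x. _ * x"] cong: if_cong)
  have "cmod (\<alpha> k) \<le> 1" for k
    using le[where N = "Suc k" and y = "\<lambda>n. if n = k then 1 else 0" and K = 1] ell_q_ball_cmod_le_1[OF q] unfolding * by blast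
  with 1 show ?thesis by (simp add: ell_q_ball_infinity_iff)
next
  case (2 r)
  have "(\<Sum>n<N. cmod (\<alpha> n) powr r) \<le> 1" for N
  proof -
    define A where "A = (\<Sum>n<N. cmod (\<alpha> n) powr r)"
    obtain u where u: "\<And>n. cmod (u n) = 1" "\<And>n. u n * \<alpha> n = complex_of_real (cmod (\<alpha> n))"
      using unimodular_rotation[of "\<alpha> _"] by metis
    \<comment> \<open>The extremal case of Young's inequality:
      \<open>cmod (y n) powr p = cmod (\<alpha> n) powr r\<close>, so pairings with the ball are at
      most 1 / r + A / p, whereas \<alpha> itself gives A. Hence
      \<open>A * (1 - 1 / p) \<le> 1 / r\<close>, which says that A is at most 1.\<close>
    define y where "y n = u n * complex_of_real (cmod (\<alpha> n) powr (r - 1))" for n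
    have y: "cmod (y n) powr p = cmod (\<alpha> n) powr r" for n
      using u conjugate_exponents_mult(1)[of p r] 2 by (simp add: y_def norm_mult powr_powr)
    have "cmod (\<Sum>n<N. \<alpha> n * y n) \<le> 1 / r + A / p"
    proof (rule le)
      fix \<beta> assume \<beta>: "\<beta> \<in> ell_q_ball q"
      have "cmod (\<Sum>n<N. \<beta> n * y n) \<le> (\<Sum>n<N. cmod (\<beta> n) powr r / r + cmod (y n) powr p / p)"
        using 2 Youngs_inequality[of r p]
        by (intro order_trans[OF norm_sum] sum_mono) (simp add: norm_mult add.commute)
      also have "\<dots> = (\<Sum>n<N. cmod (\<beta> n) powr r) / r + A / p"
        by (simp add: sum.distrib sum_divide_distrib y A_def)
      also have "\<dots> \<le> 1 / r + A / p"
        using 2 \<beta> by (intro add_mono divide_right_mono) (auto simp: ell_q_ball_real_iff)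
      finally show "cmod (\<Sum>n<N. \<beta> n * y n) \<le> 1 / r + A / p" .
    qed
    moreover have "\<alpha> n * y n = complex_of_real (cmod (\<alpha> n) powr r)" for n
    proof -
      have "\<alpha> n * y n = complex_of_real (cmod (\<alpha> n)) * complex_of_real (cmod (\<alpha> n) powr (r - 1))"
        using u(2)[of n] by (simp add: y_def mult_ac)
      also have "\<dots> = complex_of_real (cmod (\<alpha> n) powr r)"
        using mult_powr_minus_1[of "cmod (\<alpha> n)" r] by (metis norm_ge_zero of_real_mult)
      finally show ?thesis .
    qed
    then have "(\<Sum>n<N. \<alpha> n * y n) = complex_of_real A" by (simp add: A_def)
    moreover have "0 \<le> A" by (simp add: A_def sum_nonneg)
    ultimately have "A * (1 - 1 / p) \<le> 1 / r" by (simp add: algebra_simps)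
    moreover have "1 - 1 / p = 1 / r" using 2 by simp
    ultimately show ?thesis using 2 by (simp add: A_def field_simps)
  qed
  with 2 show ?thesis by (simp add: ell_q_ball_real_iff)
qed

text \<open>The other converse Hoelder inequality: bounded pairings with the ball force
  p-summability. It will put the values of a gauge-bounded functional along z into l_p.\<close>

lemma ell_p_dual:
  fixes \<beta> :: "nat \<Rightarrow> complex"
  assumes q: "conjugate_exponents p q"
    and le: "\<And>N \<alpha>. \<alpha> \<in> ell_q_ball q \<Longrightarrow> cmod (\<Sum>n<N. \<alpha> n * \<beta> n) \<le> C"
  shows "\<beta> \<in> ell_p p"
proof -
  obtain u where u: "\<And>n. cmod (u n) = 1" "\<And>n. u n * \<beta> n = complex_of_real (cmod (\<beta> n))"
    using unimodular_rotation[of "\<beta> _"] by metis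
  have C: "0 \<le> C" using le[OF ell_q_ball_zero[OF q], of 0] by simp
  show ?thesis
    using q
  proof (cases rule: conjugate_exponents_cases)
    case 1
    have "(\<Sum>n<N. cmod (\<beta> n)) \<le> C" for N
    proof -
      have "(\<Sum>n<N. u n * \<beta> n) = complex_of_real (\<Sum>n<N. cmod (\<beta> n))" by (simp add: u)
      moreover have "cmod (\<Sum>n<N. u n * \<beta> n) \<le> C"
        using 1 u by (intro le) (simp add: ell_q_ball_infinity_iff)
      ultimately have "cmod (complex_of_real (\<Sum>n<N. cmod (\<beta> n))) \<le> C" by (simp only:)
      then show ?thesis unfolding norm_of_real by linarith
    qed
    then have "summable (\<lambda>n. cmod (\<beta> n))" by (intro summableI_nonneg_bounded) auto
    with 1 show ?thesis by (simp add: ell_p_def)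
  next
    case (2 r)
    have "(\<Sum>n<N. cmod (\<beta> n) powr p) \<le> C powr p" for N
    proof (cases "(\<Sum>n<N. cmod (\<beta> n) powr p) = 0")
      case False
      define A where "A = (\<Sum>n<N. cmod (\<beta> n) powr p)"
      have A: "0 < A" using False by (simp add: A_def less_le sum_nonneg)
      \<comment> \<open>The extremal multiplier for the first N terms, normalized so that its r-th
        powers sum to 1; the pairing is then
        \<open>A / A powr (1 / r) = A powr (1 / p)\<close>.\<close>
      define \<alpha> where "\<alpha> n = (if n < N then u n * complex_of_real (cmod (\<beta> n) powr (p - 1) / A powr (1 / r)) else 0)" for n
      have "cmod (\<alpha> n) powr r = (if n < N then cmod (\<beta> n) powr p / A else 0)" for n
        using u conjugate_exponents_mult(2)[of p r] 2 A by (simp add: \<alpha>_def norm_mult norm_divide powr_powr powr_divide)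
      then have eq: "(\<Sum>n<M. cmod (\<alpha> n) powr r) = (\<Sum>n<M. if n < N then cmod (\<beta> n) powr p else 0) / A" for M
        by (simp add: sum_divide_distrib if_distrib[of "\<lambda>x. x / A"] cong: if_cong)
      have "(\<Sum>n<M. if n < N then cmod (\<beta> n) powr p else 0) \<le> A" for M
      proof -
        have "(\<Sum>n<M. if n < N then cmod (\<beta> n) powr p else 0) = (\<Sum>n\<in>{..<M}\<inter>{..<N}. cmod (\<beta> n) powr p)"
          by (simp add: sum.inter_restrict)
        also have "\<dots> \<le> A" unfolding A_def by (intro sum_mono2) auto
        finally show ?thesis .
      qed
      then have "\<alpha> \<in> ell_q_ball q" using 2 A by (simp add: ell_q_ball_real_iff eq)
      then have "cmod (\<Sum>n<N. \<alpha> n * \<beta> n) \<le> C" by (rule le)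
      moreover have "\<alpha> n * \<beta> n = complex_of_real (cmod (\<beta> n) powr p / A powr (1 / r))" if "n < N" for n
      proof -
        have "\<alpha> n * \<beta> n = complex_of_real (cmod (\<beta> n)) * complex_of_real (cmod (\<beta> n) powr (p - 1) / A powr (1 / r))"
          using u(2)[of n] that by (simp add: \<alpha>_def mult_ac)
        also have "\<dots> = complex_of_real (cmod (\<beta> n) powr p / A powr (1 / r))"
          using mult_powr_minus_1[of "cmod (\<beta> n)" p] by (metis norm_ge_zero of_real_mult times_divide_eq_right)
        finally show ?thesis .
      qed
      then have "(\<Sum>n<N. \<alpha> n * \<beta> n) = complex_of_real (A / A powr (1 / r))"
        by (simp add: A_def sum_divide_distrib)
      moreover have "A / A powr (1 / r) = A powr (1 / p)"
      proof -
        have "1 / p = 1 - 1 / r" using 2 by simp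
        then show ?thesis using A by (simp add: powr_diff)
      qed
      ultimately have "A powr (1 / p) \<le> C" by simp
      then have "(A powr (1 / p)) powr p \<le> C powr p" using 2 by (intro powr_mono2) auto
      then show ?thesis using A 2 by (simp add: powr_powr A_def)
    qed simp
    then show ?thesis
      unfolding ell_p_def mem_Collect_eq by (intro summableI_nonneg_bounded) auto
  qed
qed

lemma conjugate_exponents_unique:
  assumes "conjugate_exponents p q" "conjugate_exponents p q'"
  shows "q = q'"
  using assms(1)
proof (cases rule: conjugate_exponents_cases)
  case 1
  with assms(2) show ?thesis by (auto elim: conjugate_exponents_cases)
next
  case (2 r)
  then obtain r' where r': "q' = ereal r'" "1 / p + 1 / r' = 1"
    using assms(2) by (auto elim: conjugate_exponents_cases)
  with 2 have "1 / r = 1 / r'" by linarith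
  then have "r = r'" by simp
  with 2 r' show ?thesis by simp
qed

section \<open>Functionals dominated by the support function of the ball\<close>

lemma sum_fun_apply: "(\<Sum>i\<in>I. F i) x = (\<Sum>i\<in>I. F i x)"
  by (induction I rule: infinite_finite_induct) auto

text \<open>A merely algebraic projection. Composed with it, the support function of the ball, which
  is sublinear on l_p only, becomes a seminorm on all sequences, as \<open>hahn_banach\<close> on a
  whole type requires.\<close>

lemma csubspace_projection_exists:
  fixes X :: "'a::complex_vector set"
  assumes "csubspace X"
  shows "\<exists>\<pi>. clinear_on UNIV \<pi> \<and> range \<pi> \<subseteq> X \<and> (\<forall>x\<in>X. \<pi> x = x)"
proof -
  interpret vector_space_pair "scaleC :: complex \<Rightarrow> 'a \<Rightarrow> 'a" "scaleC :: complex \<Rightarrow> 'a \<Rightarrow> 'a" ..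
  obtain \<pi> where \<pi>: "range \<pi> \<subseteq> X" "Vector_Spaces.linear scaleC scaleC \<pi>" "\<forall>v\<in>X. \<pi> (id v) = v"
    using linear_exists_left_inverse_on[OF complex_vector.linear_id assms inj_on_id] by blast
  then have "clinear_on UNIV \<pi>"
    by (simp add: clinear_on_def linear_add linear_scale)
  with \<pi> show ?thesis by auto
qed

lemma clinear_on_subspace_image:
  assumes "clinear_on W R" "csubspace W"
  shows "csubspace (R ` W)"
proof (rule complex_vector.subspaceI)
  show "0 \<in> R ` W"
    using clinear_on_zero[OF assms] csubspaceD(1)[OF assms(2)] by (metis image_eqI)
  show "x + y \<in> R ` W" if "x \<in> R ` W" "y \<in> R ` W" for x y
    using that assms by (auto simp: csubspaceD simp flip: clinear_on_add)
  show "a *\<^sub>C x \<in> R ` W" if "x \<in> R ` W" for a x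
    using that assms by (auto simp: csubspaceD simp flip: clinear_on_scaleC)
qed

text \<open>
  The functional extends to $\ell_p$ by Hahn--Banach, where it is given by an $\ell_q$ sequence.
  Pairs \<open>(W, R)\<close> are used rather than subspaces of $\ell_p$ because \<open>R\<close> need not be injective.
\<close>

theorem ell_q_ball_representation:
  fixes W :: "'w::complex_vector set" and R :: "'w \<Rightarrow> nat \<Rightarrow> complex" and f :: "'w \<Rightarrow> complex"
  assumes q: "conjugate_exponents p q"
    and W: "csubspace W" and R: "clinear_on W R" "\<And>w. w \<in> W \<Longrightarrow> R w \<in> ell_p p"
    and f: "clinear_on W f"
    and le: "\<And>w K. w \<in> W \<Longrightarrow> (\<And>\<alpha>. \<alpha> \<in> ell_q_ball q \<Longrightarrow> cmod (\<Sum>n. \<alpha> n * R w n) \<le> K) \<Longrightarrow> cmod (f w) \<le> K"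
  shows "\<exists>\<alpha>\<in>ell_q_ball q. \<forall>w\<in>W. f w = (\<Sum>n. \<alpha> n * R w n)"
proof -
  have p: "1 \<le> p" using q by (simp add: conjugate_exponents_def)
  define L where "L = (ell_p p :: (nat \<Rightarrow> complex) set)"
  have L: "csubspace L" unfolding L_def by (rule csubspace_ell_p[OF p])
  define s where "s y = (SUP \<alpha>\<in>ell_q_ball q. cmod (\<Sum>n. \<alpha> n * y n))" for y
  have ne: "ell_q_ball q \<noteq> {}" using ell_q_ball_zero[OF q] by blast
  have summ: "summable (\<lambda>n. \<alpha> n * y n)" if "y \<in> L" "\<alpha> \<in> ell_q_ball q" for y \<alpha>
    using ell_q_ball_summable[OF q _ that(2), of y] that(1) by (simp add: L_def scaleC_complex_def)
  have s_ge: "cmod (\<Sum>n. \<alpha> n * y n) \<le> s y" if "y \<in> L" "\<alpha> \<in> ell_q_ball q" for y \<alpha>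
    unfolding s_def
  proof (rule cSUP_upper[OF that(2)])
    show "bdd_above ((\<lambda>\<alpha>. cmod (\<Sum>n. \<alpha> n * y n)) ` ell_q_ball q)"
      using ell_q_ball_suminf_bounded[OF q, of y] that(1)
      by (auto simp: L_def scaleC_complex_def bdd_above_def)
  qed
  have s_le: "s y \<le> K" if "\<And>\<alpha>. \<alpha> \<in> ell_q_ball q \<Longrightarrow> cmod (\<Sum>n. \<alpha> n * y n) \<le> K" for y K
    unfolding s_def by (rule cSUP_least[OF ne that])
  have s_add: "s (y + z) \<le> s y + s z" if "y \<in> L" "z \<in> L" for y z
  proof (rule s_le)
    fix \<alpha> assume \<alpha>: "\<alpha> \<in> ell_q_ball q"
    have "(\<Sum>n. \<alpha> n * (y + z) n) = (\<Sum>n. \<alpha> n * y n) + (\<Sum>n. \<alpha> n * z n)"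
      using summ[OF that(1) \<alpha>] summ[OF that(2) \<alpha>] by (simp add: suminf_add distrib_left)
    then show "cmod (\<Sum>n. \<alpha> n * (y + z) n) \<le> s y + s z"
      using s_ge[OF that(1) \<alpha>] s_ge[OF that(2) \<alpha>] norm_triangle_mono by metis
  qed
  have s_scale: "s (a *\<^sub>C y) \<le> cmod a * s y" if "y \<in> L" for a y
  proof (rule s_le)
    fix \<alpha> assume \<alpha>: "\<alpha> \<in> ell_q_ball q"
    have "(\<Sum>n. \<alpha> n * (a *\<^sub>C y) n) = a * (\<Sum>n. \<alpha> n * y n)"
      using summ[OF that \<alpha>] by (simp add: scaleC_fun_def scaleC_complex_def mult.left_commute suminf_mult)
    then show "cmod (\<Sum>n. \<alpha> n * (a *\<^sub>C y) n) \<le> cmod a * s y"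
      using s_ge[OF that \<alpha>] by (simp add: norm_mult mult_left_mono)
  qed
  obtain \<pi> :: "(nat \<Rightarrow> complex) \<Rightarrow> nat \<Rightarrow> complex"
    where \<pi>: "clinear_on UNIV \<pi>" "\<And>y. \<pi> y \<in> L" "\<And>y. y \<in> L \<Longrightarrow> \<pi> y = y"
    using csubspace_projection_exists[OF L] by blast
  \<comment> \<open>f factors through R: for equal images under R the hypothesis \<open>le\<close>
    applies to the difference with K = 0, so the choice of the preimage does not matter.\<close>
  define f' where "f' y = f (SOME w. w \<in> W \<and> R w = y)" for y
  have f': "f' (R w) = f w" if w: "w \<in> W" for w
  proof -
    define w' where "w' = (SOME v. v \<in> W \<and> R v = R w)"
    have w': "w' \<in> W" "R w' = R w"
      using someI[of "\<lambda>v. v \<in> W \<and> R v = R w" w] w by (auto simp: w'_def)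
    then have "R (w' - w) = 0" using clinear_on_diff[OF R(1) W] w by simp
    then have "cmod (f (w' - w)) \<le> 0" using w w' W by (intro le) (auto simp: csubspaceD)
    then have "f w' = f w" using clinear_on_diff[OF f W w'(1) w] by simp
    then show ?thesis by (simp add: f'_def w'_def)
  qed
  have "\<exists>g. clinear_on UNIV g \<and> (\<forall>y. cmod (g y) \<le> s (\<pi> y)) \<and> (\<forall>y\<in>R ` W. g y = f' y)"
  proof (rule hahn_banach)
    show "s (\<pi> (x + y)) \<le> s (\<pi> x) + s (\<pi> y)" for x y
      using s_add \<pi> by (simp add: clinear_on_add[OF \<pi>(1)])
    show "s (\<pi> (a *\<^sub>C x)) \<le> cmod a * s (\<pi> x)" for a x
      using s_scale \<pi> by (simp add: clinear_on_scaleC[OF \<pi>(1)])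
    show "csubspace (R ` W)" by (rule clinear_on_subspace_image[OF R(1) W])
    show "clinear_on (R ` W) f'"
      unfolding clinear_on_def
    proof (intro conjI ballI allI)
      show "f' (x + y) = f' x + f' y" if xy: "x \<in> R ` W" "y \<in> R ` W" for x y
      proof -
        obtain v w where vw: "v \<in> W" "w \<in> W" "x = R v" "y = R w" using xy by blast
        then have "f' (x + y) = f' (R (v + w))" by (simp add: clinear_on_add[OF R(1)])
        also have "\<dots> = f' x + f' y" using vw W by (simp add: f' csubspaceD clinear_on_add[OF f])
        finally show ?thesis .
      qed
      show "f' (a *\<^sub>C x) = a *\<^sub>C f' x" if x: "x \<in> R ` W" for a x
      proof -
        obtain v where v: "v \<in> W" "x = R v" using x by blast
        then have "f' (a *\<^sub>C x) = f' (R (a *\<^sub>C v))" by (simp add: clinear_on_scaleC[OF R(1)])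
        also have "\<dots> = a *\<^sub>C f' x" using v W by (simp add: f' csubspaceD clinear_on_scaleC[OF f])
        finally show ?thesis .
      qed
    qed
    show "cmod (f' y) \<le> s (\<pi> y)" if y: "y \<in> R ` W" for y
    proof -
      obtain w where w: "w \<in> W" "y = R w" using y by blast
      then have "R w \<in> L" using R by (simp add: L_def)
      then show ?thesis using w f' \<pi>(3) le[OF w(1) s_ge] by simp
    qed
  qed
  then obtain g where g: "clinear_on UNIV g" "\<And>y. cmod (g y) \<le> s (\<pi> y)" "\<And>y. y \<in> R ` W \<Longrightarrow> g y = f' y"
    by blast
  define unit where "unit k = (\<lambda>n. if n = k then 1 else 0 :: complex)" for k :: nat
  define trunc where "trunc N y = (\<lambda>n. if n < N then y n else 0 :: complex)" for N :: nat and y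
  have truncL: "trunc N y \<in> L" for N y
    unfolding L_def ell_p_def trunc_def mem_Collect_eq by (rule summable_finite[of "{..<N}"]) auto
  have trunc_sum: "(\<Sum>n. \<alpha> n * trunc N y n) = (\<Sum>n<N. \<alpha> n * y n)" for \<alpha> N y
    by (subst suminf_finite[of "{..<N}"]) (auto simp: trunc_def)
  define \<alpha> where "\<alpha> n = g (unit n)" for n
  have g_trunc: "g (trunc N y) = (\<Sum>n<N. \<alpha> n * y n)" for N y
  proof -
    have "trunc N y = (\<Sum>n<N. y n *\<^sub>C unit n)"
      by (rule ext) (simp add: sum_fun_apply scaleC_fun_def scaleC_complex_def unit_def trunc_def
          if_distrib[of "\<lambda>x. _ * x"] cong: if_cong)
    then have "g (trunc N y) = (\<Sum>n<N. g (y n *\<^sub>C unit n))"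
      using clinear_on_sum[OF g(1), of "{..<N}" "\<lambda>n. y n *\<^sub>C unit n"] by simp
    also have "\<dots> = (\<Sum>n<N. \<alpha> n * y n)"
      by (simp add: clinear_on_scaleC[OF g(1)] \<alpha>_def scaleC_complex_def mult.commute)
    finally show ?thesis .
  qed
  have \<alpha>: "\<alpha> \<in> ell_q_ball q"
  proof (rule ell_q_ball_dual[OF q])
    fix N y K assume K: "\<And>\<beta>. \<beta> \<in> ell_q_ball q \<Longrightarrow> cmod (\<Sum>n<N. \<beta> n * y n) \<le> K"
    have "cmod (g (trunc N y)) \<le> s (trunc N y)" using g(2)[of "trunc N y"] \<pi>(3)[OF truncL] by simp
    also have "\<dots> \<le> K" by (rule s_le) (simp add: trunc_sum K)
    finally show "cmod (\<Sum>n<N. \<alpha> n * y n) \<le> K" by (simp add: g_trunc)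
  qed
  \<comment> \<open>g is bounded by s, and truncations of y converge to y in s because tails are
    small uniformly over the ball; so g is determined by its values on the unit vectors.\<close>
  have g_rep: "g y = (\<Sum>n. \<alpha> n * y n)" if y: "y \<in> L" for y
  proof -
    have "(\<lambda>N. \<Sum>n<N. \<alpha> n * y n) \<longlonglongrightarrow> g y"
      unfolding LIMSEQ_def
    proof (intro allI impI)
      fix e :: real assume e: "0 < e"
      then obtain N where N: "\<And>\<beta> m. \<beta> \<in> ell_q_ball q \<Longrightarrow> m \<ge> N \<Longrightarrow>
          norm ((\<Sum>n. \<beta> n * y n) - (\<Sum>n<m. \<beta> n * y n)) \<le> e / 2"
        using ell_q_ball_suminf_approx[OF q, of y "e / 2"] y by (auto simp: L_def scaleC_complex_def)
      have "dist (\<Sum>n<m. \<alpha> n * y n) (g y) < e" if "m \<ge> N" for m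
      proof -
        have D: "y - trunc m y \<in> L" using y truncL L by (simp add: csubspaceD)
        have "g y - (\<Sum>n<m. \<alpha> n * y n) = g (y - trunc m y)"
          by (simp add: g_trunc clinear_on_diff[OF g(1)])
        also have "cmod \<dots> \<le> s (y - trunc m y)"
          using g(2)[of "y - trunc m y"] \<pi>(3)[OF D] by simp
        also have "\<dots> \<le> e / 2"
        proof (rule s_le)
          fix \<beta> assume \<beta>: "\<beta> \<in> ell_q_ball q"
          have "(\<Sum>n. \<beta> n * (y - trunc m y) n) = (\<Sum>n. \<beta> n * y n) - (\<Sum>n. \<beta> n * trunc m y n)"
            using suminf_diff[OF summ[OF y \<beta>] summ[OF truncL \<beta>, of m y]]
            by (simp add: right_diff_distrib)
          with N[OF \<beta> that] show "cmod (\<Sum>n. \<beta> n * (y - trunc m y) n) \<le> e / 2"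
            by (simp add: trunc_sum)
        qed
        finally show ?thesis using e by (simp add: dist_norm norm_minus_commute)
      qed
      then show "\<exists>N. \<forall>m\<ge>N. dist (\<Sum>n<m. \<alpha> n * y n) (g y) < e" by blast
    qed
    with summable_LIMSEQ[OF summ[OF y \<alpha>]] show ?thesis using LIMSEQ_unique by blast
  qed
  have "f w = (\<Sum>n. \<alpha> n * R w n)" if "w \<in> W" for w
    using g(3)[of "R w"] g_rep[of "R w"] R(2)[OF that] f'[OF that] that by (simp add: L_def)
  with \<alpha> show ?thesis by blast
qed

section \<open>Hulls of $p$-summable sequences\<close>

definition ell_q_hull :: "ereal \<Rightarrow> (nat \<Rightarrow> 'e::complex_banach) \<Rightarrow> 'e set" where
  "ell_q_hull q x = {(\<Sum>n. \<alpha> n *\<^sub>C x n) |\<alpha>. \<alpha> \<in> ell_q_ball q}"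

text \<open>The exponent q is determined by p, so one q fixed in advance serves for all
  sets.\<close>

lemma relatively_p_compact_iff:
  assumes "conjugate_exponents p q"
  shows "relatively_p_compact p K \<longleftrightarrow> (\<exists>x\<in>ell_p p. K \<subseteq> closure (ell_q_hull q x))"
proof
  assume "relatively_p_compact p K"
  then obtain q' x where "1 \<le> q'" "1 / ereal p + 1 / q' = 1" "x \<in> ell_p p" "K \<subseteq> closure (ell_q_hull q' x)"
    by (auto simp: relatively_p_compact_def ell_q_hull_def)
  moreover from this have "q' = q"
    using assms conjugate_exponents_unique by (auto simp: conjugate_exponents_def)
  ultimately show "\<exists>x\<in>ell_p p. K \<subseteq> closure (ell_q_hull q x)" by blast
next
  assume "\<exists>x\<in>ell_p p. K \<subseteq> closure (ell_q_hull q x)"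
  with assms show "relatively_p_compact p K"
    by (auto simp: relatively_p_compact_def ell_q_hull_def conjugate_exponents_def)
qed

lemma bounded_linear_scaleC_left: "bounded_linear (\<lambda>c. c *\<^sub>C (v :: 'e::complex_banach))"
  by (rule bounded_linear_intro[of _ "norm v"])
     (auto simp: scaleC_add_left scaleR_scaleC norm_scaleC scaleC_scaleC scaleC_complex_def)

lemma bounded_linear_scaleC_right: "bounded_linear (\<lambda>v :: 'e::complex_banach. c *\<^sub>C v)"
  by (rule bounded_linear_intro[of _ "cmod c"])
     (auto simp: scaleC_add_right scaleR_scaleC norm_scaleC scaleC_scaleC mult.commute)

text \<open>Cutting all series at one N moves the points by at most e / 4, and the cut sums stay in
  a compact set, a finite sum of discs.\<close>

lemma compact_closure_ell_q_hull:
  fixes x :: "nat \<Rightarrow> 'e::complex_banach"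
  assumes q: "conjugate_exponents p q" and x: "x \<in> ell_p p"
  shows "compact (closure (ell_q_hull q x))"
  unfolding compact_eq_totally_bounded
proof (intro conjI allI impI)
  show "complete (closure (ell_q_hull q x))" by (simp add: complete_eq_closed)
  fix e :: real assume e: "0 < e"
  obtain N where N: "\<And>\<alpha>. \<alpha> \<in> ell_q_ball q \<Longrightarrow> norm ((\<Sum>n. \<alpha> n *\<^sub>C x n) - (\<Sum>n<N. \<alpha> n *\<^sub>C x n)) \<le> e / 4"
    using ell_q_ball_suminf_approx[OF q x, of "e / 4"] e by auto
  have "\<exists>C. compact C \<and> (\<forall>\<alpha>. (\<forall>n. cmod (\<alpha> n) \<le> 1) \<longrightarrow> (\<Sum>n<M. \<alpha> n *\<^sub>C x n) \<in> C)" for M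
  proof (induction M)
    case (Suc M)
    then obtain C where C: "compact C" "\<And>\<alpha>. (\<forall>n. cmod (\<alpha> n) \<le> 1) \<Longrightarrow> (\<Sum>n<M. \<alpha> n *\<^sub>C x n) \<in> C"
      by blast
    have "compact {a + b |a b. a \<in> C \<and> b \<in> (\<lambda>c. c *\<^sub>C x M) ` cball 0 1}"
      by (intro compact_sums C compact_continuous_image linear_continuous_on bounded_linear_scaleC_left) auto
    moreover have "(\<Sum>n<Suc M. \<alpha> n *\<^sub>C x n) \<in> {a + b |a b. a \<in> C \<and> b \<in> (\<lambda>c. c *\<^sub>C x M) ` cball 0 1}"
      if "\<forall>n. cmod (\<alpha> n) \<le> 1" for \<alpha>
    proof -
      have "\<alpha> M *\<^sub>C x M \<in> (\<lambda>c. c *\<^sub>C x M) ` cball 0 1" using that by auto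
      with C(2)[OF that] show ?thesis by auto
    qed
    ultimately show ?case by blast
  qed (auto intro: exI[of _ "{0}"])
  then obtain C where C: "compact C" "\<And>\<alpha>. (\<forall>n. cmod (\<alpha> n) \<le> 1) \<Longrightarrow> (\<Sum>n<N. \<alpha> n *\<^sub>C x n) \<in> C"
    by blast
  then obtain k where k: "finite k" "C \<subseteq> (\<Union>v\<in>k. ball v (e / 4))"
    using e unfolding compact_eq_totally_bounded by (meson divide_pos_pos zero_less_numeral)
  \<comment> \<open>Closed balls, so that the finite union is closed and covers the closure of the
    hull as well.\<close>
  have "ell_q_hull q x \<subseteq> (\<Union>v\<in>k. cball v (e / 2))"
  proof
    fix u assume "u \<in> ell_q_hull q x"
    then obtain \<alpha> where \<alpha>: "\<alpha> \<in> ell_q_ball q" "u = (\<Sum>n. \<alpha> n *\<^sub>C x n)"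
      by (auto simp: ell_q_hull_def)
    then have "(\<Sum>n<N. \<alpha> n *\<^sub>C x n) \<in> C" using C(2) ell_q_ball_cmod_le_1[OF q] by blast
    then obtain v where v: "v \<in> k" "dist v (\<Sum>n<N. \<alpha> n *\<^sub>C x n) < e / 4" using k by auto
    moreover have "dist (\<Sum>n<N. \<alpha> n *\<^sub>C x n) u \<le> e / 4"
      using N[OF \<alpha>(1)] \<alpha>(2) by (simp add: dist_norm norm_minus_commute)
    ultimately have "dist v u \<le> e / 2" using dist_triangle[of v u "\<Sum>n<N. \<alpha> n *\<^sub>C x n"] by linarith
    with v show "u \<in> (\<Union>v\<in>k. cball v (e / 2))" by auto
  qed
  moreover have "closed (\<Union>v\<in>k. cball v (e / 2))" using k(1) by (intro closed_UN) auto
  ultimately have "closure (ell_q_hull q x) \<subseteq> (\<Union>v\<in>k. cball v (e / 2))" by (rule closure_minimal)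
  also have "\<dots> \<subseteq> (\<Union>v\<in>k. ball v e)" using e by (intro UN_mono) auto
  finally show "\<exists>k. finite k \<and> closure (ell_q_hull q x) \<subseteq> (\<Union>v\<in>k. ball v e)" using k(1) by blast
qed

lemma p_compact_imp_compact:
  assumes "1 \<le> p" "p_compact p K"
  shows "compact K"
proof -
  obtain q where q: "conjugate_exponents p q" using conjugate_exponents_exists[OF assms(1)] by blast
  then obtain x where "x \<in> ell_p p" "K \<subseteq> closure (ell_q_hull q x)"
    using assms(2) by (auto simp: p_compact_def relatively_p_compact_iff[OF q])
  then show ?thesis
    using compact_closure_ell_q_hull[OF q] assms(2) compact_Int_closed[of _ K]
    by (metis inf.absorb_iff2 p_compact_def)
qed

lemma p_compact_closure:
  assumes "relatively_p_compact p K"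
  shows "p_compact p (closure K)"
  using assms unfolding p_compact_def relatively_p_compact_def by (meson closed_closure closure_minimal)

lemma ell_q_hull_abs_convex:
  fixes x :: "nat \<Rightarrow> 'e::complex_banach"
  assumes q: "conjugate_exponents p q" and x: "x \<in> ell_p p"
    and "u \<in> ell_q_hull q x" "v \<in> ell_q_hull q x" "cmod a + cmod b \<le> 1"
  shows "a *\<^sub>C u + b *\<^sub>C v \<in> ell_q_hull q x"
proof -
  obtain \<alpha> \<beta> where ab: "\<alpha> \<in> ell_q_ball q" "\<beta> \<in> ell_q_ball q" "u = (\<Sum>n. \<alpha> n *\<^sub>C x n)" "v = (\<Sum>n. \<beta> n *\<^sub>C x n)"
    using assms by (auto simp: ell_q_hull_def)
  have s: "summable (\<lambda>n. \<alpha> n *\<^sub>C x n)" "summable (\<lambda>n. \<beta> n *\<^sub>C x n)"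
    using ell_q_ball_summable[OF q x] ab by auto
  have "a *\<^sub>C u + b *\<^sub>C v = (\<Sum>n. a *\<^sub>C \<alpha> n *\<^sub>C x n) + (\<Sum>n. b *\<^sub>C \<beta> n *\<^sub>C x n)"
    unfolding ab(3,4) by (simp add: s bounded_linear.suminf[OF bounded_linear_scaleC_right])
  also have "\<dots> = (\<Sum>n. a *\<^sub>C \<alpha> n *\<^sub>C x n + b *\<^sub>C \<beta> n *\<^sub>C x n)"
    by (intro suminf_add bounded_linear.summable[OF bounded_linear_scaleC_right] s)
  also have "\<dots> = (\<Sum>n. (a * \<alpha> n + b * \<beta> n) *\<^sub>C x n)" by (simp add: scaleC_scaleC scaleC_add_left)
  finally show ?thesis
    using ell_q_ball_abs_convex[OF q ab(1,2) assms(5)] by (auto simp: ell_q_hull_def)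
qed

lemma closure_ell_q_hull_abs_convex:
  fixes x :: "nat \<Rightarrow> 'e::complex_banach"
  assumes q: "conjugate_exponents p q" and x: "x \<in> ell_p p"
    and "u \<in> closure (ell_q_hull q x)" "v \<in> closure (ell_q_hull q x)" "cmod a + cmod b \<le> 1"
  shows "a *\<^sub>C u + b *\<^sub>C v \<in> closure (ell_q_hull q x)"
proof -
  obtain s t where st: "\<And>n. s n \<in> ell_q_hull q x" "s \<longlonglongrightarrow> u" "\<And>n. t n \<in> ell_q_hull q x" "t \<longlonglongrightarrow> v"
    using assms by (auto simp: closure_sequential)
  have "(\<lambda>n. a *\<^sub>C s n + b *\<^sub>C t n) \<longlonglongrightarrow> a *\<^sub>C u + b *\<^sub>C v"
    by (intro tendsto_add bounded_linear.tendsto[OF bounded_linear_scaleC_right] st)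
  moreover have "a *\<^sub>C s n + b *\<^sub>C t n \<in> ell_q_hull q x" for n
    by (rule ell_q_hull_abs_convex[OF q x st(1) st(3) assms(5)])
  ultimately show ?thesis
    unfolding closure_sequential by (intro exI[of _ "\<lambda>n. a *\<^sub>C s n + b *\<^sub>C t n"]) simp
qed

text \<open>x is placed on the even and y on the odd positions, and multipliers are padded by zeros.
  Hence finite unions of relatively p-compact sets are relatively p-compact, which turns the
  subbasis of \<open>dual_cp\<close> into neighbourhood bases.\<close>

lemma ell_q_hull_interleave:
  fixes x y :: "nat \<Rightarrow> 'e::complex_banach"
  assumes q: "conjugate_exponents p q" and x: "x \<in> ell_p p" and y: "y \<in> ell_p p"
  shows "\<exists>z\<in>ell_p p. ell_q_hull q x \<union> ell_q_hull q y \<subseteq> ell_q_hull q z"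
proof -
  define z where "z n = (if even n then x (n div 2) else y ((n - 1) div 2))" for n
  have "(\<lambda>n. if even n then norm (x (n div 2)) powr p else norm (y ((n - 1) div 2)) powr p) sums
      ((\<Sum>n. norm (y n) powr p) + (\<Sum>n. norm (x n) powr p))"
    using x y by (intro sums_if) (auto simp: ell_p_def summable_sums)
  moreover have "(\<lambda>n. norm (z n) powr p) = (\<lambda>n. if even n then norm (x (n div 2)) powr p else norm (y ((n - 1) div 2)) powr p)"
    by (auto simp: z_def)
  ultimately have z: "z \<in> ell_p p" by (simp add: ell_p_def sums_iff)
  \<comment> \<open>Transport of a multiplier along a subsequence h. Positions below N in the range
    of h come from indices below N since \<open>n \<le> h n\<close>, so partial sums of the new
    multiplier are bounded by those of the old one.\<close>
  have sub: "ell_q_hull q w \<subseteq> ell_q_hull q z" if h: "strict_mono h" "\<And>n. z (h n) = w n" for w h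
  proof
    fix u assume "u \<in> ell_q_hull q w"
    then obtain \<alpha> where \<alpha>: "\<alpha> \<in> ell_q_ball q" "u = (\<Sum>n. \<alpha> n *\<^sub>C w n)" by (auto simp: ell_q_hull_def)
    have inj: "inj h" using h(1) strict_mono_imp_inj_on by blast
    define \<beta> where "\<beta> n = (if n \<in> range h then \<alpha> (inv h n) else 0)" for n
    have \<beta>h: "\<beta> (h n) = \<alpha> n" for n using inj by (simp add: \<beta>_def)
    have "\<beta> \<in> ell_q_ball q"
      using q
    proof (cases rule: conjugate_exponents_cases)
      case 1
      then show ?thesis using \<alpha>(1) by (simp add: ell_q_ball_infinity_iff \<beta>_def)
    next
      case (2 r)
      have "(\<Sum>n<N. cmod (\<beta> n) powr r) \<le> 1" for N
      proof -
        have "(\<Sum>n<N. cmod (\<beta> n) powr r) = (\<Sum>n\<in>h ` {n. h n < N}. cmod (\<beta> n) powr r)"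
          by (rule sum.mono_neutral_right) (auto simp: \<beta>_def)
        also have "\<dots> = (\<Sum>n | h n < N. cmod (\<alpha> n) powr r)"
          using inj by (simp add: sum.reindex inj_on_def \<beta>h)
        also have "\<dots> \<le> (\<Sum>n<N. cmod (\<alpha> n) powr r)"
          using strict_mono_imp_increasing[OF h(1)] by (intro sum_mono2) (auto intro: le_less_trans)
        also have "\<dots> \<le> 1" using 2 \<alpha>(1) by (auto simp: ell_q_ball_real_iff)
        finally show ?thesis .
      qed
      with 2 show ?thesis by (simp add: ell_q_ball_real_iff)
    qed
    moreover have "(\<Sum>n. \<beta> (h n) *\<^sub>C z (h n)) = (\<Sum>n. \<beta> n *\<^sub>C z n)"
      by (rule suminf_mono_reindex[OF h(1)]) (simp add: \<beta>_def)
    ultimately show "u \<in> ell_q_hull q z" using \<alpha>(2) by (auto simp: ell_q_hull_def \<beta>h h(2))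
  qed
  have "ell_q_hull q x \<subseteq> ell_q_hull q z"
    by (rule sub[of "\<lambda>n. 2 * n"]) (auto simp: strict_mono_def z_def)
  moreover have "ell_q_hull q y \<subseteq> ell_q_hull q z"
    by (rule sub[of "\<lambda>n. 2 * n + 1"]) (auto simp: strict_mono_def z_def)
  ultimately show ?thesis using z by blast
qed

lemma relatively_p_compact_Un:
  fixes K L :: "'e::complex_banach set"
  assumes p: "1 \<le> p" and "relatively_p_compact p K" "relatively_p_compact p L"
  shows "relatively_p_compact p (K \<union> L)"
proof -
  obtain q where q: "conjugate_exponents p q" using conjugate_exponents_exists[OF p] by blast
  obtain x y where "x \<in> ell_p p" "K \<subseteq> closure (ell_q_hull q x)" "y \<in> ell_p p" "L \<subseteq> closure (ell_q_hull q y)"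
    using assms by (auto simp: relatively_p_compact_iff[OF q])
  moreover from this obtain z where "z \<in> ell_p p" "ell_q_hull q x \<union> ell_q_hull q y \<subseteq> ell_q_hull q z"
    using ell_q_hull_interleave[OF q] by metis
  ultimately show ?thesis
    unfolding relatively_p_compact_iff[OF q] using closure_mono by (metis Un_subset_iff order_trans)
qed

section \<open>Dual spaces\<close>

lemma bounded_clinearI:
  assumes "clinear_on UNIV f" "\<And>x. norm (f x) \<le> norm x * K"
  shows "bounded_clinear f"
  using assms by (auto simp: bounded_clinear_def clinear_on_def scaleR_scaleC intro!: bounded_linear_intro[of f K])

lemma dualD:
  assumes "\<phi> \<in> dual"
  shows "clinear_on UNIV \<phi>" "bounded_linear \<phi>" "\<phi> (x + y) = \<phi> x + \<phi> y" "\<phi> (a *\<^sub>C x) = a * \<phi> x" "\<phi> 0 = 0"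
    "\<phi> (x - y) = \<phi> x - \<phi> y" "cmod (\<phi> x) \<le> onorm \<phi> * norm x" "\<phi> (sum h I) = (\<Sum>i\<in>I. \<phi> (h i))"
proof -
  show 1: "clinear_on UNIV \<phi>" "bounded_linear \<phi>"
    using assms by (auto simp: dual_def bounded_clinear_def)
  interpret bounded_linear \<phi> by fact
  show "\<phi> (x + y) = \<phi> x + \<phi> y" "\<phi> 0 = 0" "\<phi> (x - y) = \<phi> x - \<phi> y" "\<phi> (sum h I) = (\<Sum>i\<in>I. \<phi> (h i))"
    by (simp_all add: add zero diff sum)
  show "\<phi> (a *\<^sub>C x) = a * \<phi> x" using 1(1) by (simp add: clinear_on_def scaleC_complex_def)
  show "cmod (\<phi> x) \<le> onorm \<phi> * norm x" by (rule onorm[OF 1(2)])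
qed

lemma dualI:
  fixes \<phi> :: "'e::complex_banach \<Rightarrow> complex"
  assumes "\<And>x y. \<phi> (x + y) = \<phi> x + \<phi> y" "\<And>a x. \<phi> (a *\<^sub>C x) = a * \<phi> x" "\<And>x. cmod (\<phi> x) \<le> norm x * K"
  shows "\<phi> \<in> dual"
  unfolding dual_def mem_Collect_eq
  by (rule bounded_clinearI) (use assms in \<open>auto simp: clinear_on_def scaleC_complex_def\<close>)

lemma csubspace_dual: "csubspace (dual :: ('e::complex_banach \<Rightarrow> complex) set)"
proof (rule complex_vector.subspaceI)
  show "0 \<in> (dual :: ('e \<Rightarrow> complex) set)" by (rule dualI[of _ 0]) auto
  show "\<phi> + \<psi> \<in> dual" if "\<phi> \<in> dual" "\<psi> \<in> dual" for \<phi> \<psi> :: "'e \<Rightarrow> complex"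
  proof (rule dualI)
    show "cmod ((\<phi> + \<psi>) x) \<le> norm x * (onorm \<phi> + onorm \<psi>)" for x
      using norm_triangle_mono[OF dualD(7)[OF that(1), of x] dualD(7)[OF that(2), of x]]
      by (simp add: algebra_simps)
  qed (use dualD[OF that(1)] dualD[OF that(2)] in \<open>auto simp: algebra_simps\<close>)
  show "a *\<^sub>C \<phi> \<in> dual" if "\<phi> \<in> dual" for a and \<phi> :: "'e \<Rightarrow> complex"
  proof (rule dualI)
    show "cmod ((a *\<^sub>C \<phi>) x) \<le> norm x * (cmod a * onorm \<phi>)" for x
      using mult_left_mono[OF dualD(7)[OF that, of x], of "cmod a"]
      by (simp add: scaleC_fun_def scaleC_complex_def norm_mult algebra_simps)
  qed (use dualD[OF that] in \<open>auto simp: scaleC_fun_def scaleC_complex_def algebra_simps\<close>)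
qed

lemma norming_functional:
  fixes x :: "'e::complex_banach"
  shows "\<exists>\<phi>\<in>dual. onorm \<phi> \<le> 1 \<and> \<phi> x = complex_of_real (norm x)"
proof -
  \<comment> \<open>The coefficient c is ambiguous for x = 0, but then the factor
    \<open>norm x\<close> makes f vanish.\<close>
  define f where "f y = complex_of_real (norm x) * (SOME c. y = c *\<^sub>C x)" for y
  have f: "f (c *\<^sub>C x) = complex_of_real (norm x) * c" for c
  proof (cases "x = 0")
    case False
    have "c *\<^sub>C x = d *\<^sub>C x \<longleftrightarrow> c = d" for d using False by auto
    then show ?thesis by (simp add: f_def)
  qed (simp add: f_def)
  have "\<exists>\<phi>. clinear_on UNIV \<phi> \<and> (\<forall>y. cmod (\<phi> y) \<le> norm y) \<and> (\<forall>y\<in>range (\<lambda>c. c *\<^sub>C x). \<phi> y = f y)"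
  proof (rule hahn_banach)
    show "csubspace (range (\<lambda>c. c *\<^sub>C x))"
      by (rule clinear_on_subspace_image)
         (auto simp: clinear_on_def scaleC_complex_def scaleC_add_left scaleC_scaleC)
    have "f (c *\<^sub>C x + d *\<^sub>C x) = f (c *\<^sub>C x) + f (d *\<^sub>C x)" for c d
      unfolding scaleC_add_left[symmetric] f by (simp add: algebra_simps)
    moreover have "f (a *\<^sub>C c *\<^sub>C x) = a *\<^sub>C f (c *\<^sub>C x)" for a c
      unfolding scaleC_scaleC f by (simp add: scaleC_complex_def)
    ultimately show "clinear_on (range (\<lambda>c. c *\<^sub>C x)) f" by (auto simp: clinear_on_def)
    show "cmod (f y) \<le> norm y" if "y \<in> range (\<lambda>c. c *\<^sub>C x)" for y
      using that by (auto simp: f norm_mult norm_scaleC)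
  qed (auto simp: norm_triangle_ineq norm_scaleC)
  then obtain \<phi> where \<phi>: "clinear_on UNIV \<phi>" "\<And>y. cmod (\<phi> y) \<le> norm y" "\<And>c. \<phi> (c *\<^sub>C x) = f (c *\<^sub>C x)"
    by blast
  have "\<phi> \<in> dual" unfolding dual_def mem_Collect_eq by (rule bounded_clinearI[of _ 1]) (use \<phi> in auto)
  moreover have "onorm \<phi> \<le> 1" by (rule onorm_bound) (use \<phi> in auto)
  moreover have "\<phi> x = complex_of_real (norm x)" using \<phi>(3)[of 1] f[of 1] by (simp add: scaleC_one)
  ultimately show ?thesis by blast
qed

lemma dual_separates:
  fixes x y :: "'e::complex_banach"
  assumes "\<And>\<phi>. \<phi> \<in> dual \<Longrightarrow> \<phi> x = \<phi> y"
  shows "x = y"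
proof -
  obtain \<phi> where "\<phi> \<in> dual" "\<phi> (x - y) = complex_of_real (norm (x - y))"
    using norming_functional by blast
  with assms[of \<phi>] dualD(6)[of \<phi> x y] have "complex_of_real (norm (x - y)) = 0" by simp
  then show ?thesis by simp
qed

lemma dual_ell_p:
  fixes x :: "nat \<Rightarrow> 'e::complex_banach"
  assumes "1 \<le> p" "x \<in> ell_p p" "\<phi> \<in> dual"
  shows "(\<lambda>n. \<phi> (x n)) \<in> ell_p p"
  using dualD(7)[OF assms(3)] onorm_pos_le[OF dualD(2)[OF assms(3)]]
  by (intro ell_p_mono[OF assms(1,2)])

lemma dual_suminf:
  fixes x :: "nat \<Rightarrow> 'e::complex_banach"
  assumes "conjugate_exponents p q" "x \<in> ell_p p" "\<alpha> \<in> ell_q_ball q" "\<phi> \<in> dual"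
  shows "\<phi> (\<Sum>n. \<alpha> n *\<^sub>C x n) = (\<Sum>n. \<alpha> n * \<phi> (x n))"
  using bounded_linear.suminf[OF dualD(2)[OF assms(4)] ell_q_ball_summable[OF assms(1-3)]]
  by (simp add: dualD(4)[OF assms(4)])

section \<open>The topology of uniform convergence on p-compact sets\<close>

lemma relatively_p_compact_empty: "1 \<le> p \<Longrightarrow> relatively_p_compact p ({} :: 'e::complex_banach set)"
proof -
  assume "1 \<le> p"
  then obtain q where q: "conjugate_exponents p q" using conjugate_exponents_exists by blast
  have "(\<lambda>n. 0 :: 'e) \<in> ell_p p" by (simp add: ell_p_def)
  with relatively_p_compact_iff[OF q] show ?thesis by blast
qed

lemma topspace_dual_cp:
  assumes "1 \<le> p"
  shows "topspace (dual_cp p) = (dual :: ('e::complex_banach \<Rightarrow> complex) set)"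
proof -
  \<comment> \<open>The condition over K = {} is void, so the whole dual is itself a generating
    set.\<close>
  have "p_compact p ({} :: 'e set)"
    using relatively_p_compact_empty[OF assms] by (simp add: p_compact_def)
  then have "dual \<in> {{\<psi> \<in> dual. \<forall>x\<in>K. cmod (\<psi> x - \<phi> x) < \<epsilon>} |\<phi> (K :: 'e set) \<epsilon>. \<phi> \<in> dual \<and> p_compact p K \<and> 0 < \<epsilon>}"
    using csubspaceD(1)[OF csubspace_dual]
    by (intro CollectI exI[of _ 0] exI[of _ "{}"] exI[of _ "1 :: real"]) auto
  then show ?thesis
    unfolding dual_cp_def topology_generated_by_topspace by blast
qed

text \<open>The definition of the topology gives a subbasis only. By induction on the generation of
  U, intersections are handled by unions of relatively p-compact sets, and a generating set with
  another centre \<psi> is recentred at \<phi>.\<close>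

lemma dual_cp_neighbourhood:
  fixes U :: "('e::complex_banach \<Rightarrow> complex) set"
  assumes p: "1 \<le> p" and "openin (dual_cp p) U" "\<phi> \<in> U"
  shows "\<exists>K e. relatively_p_compact p K \<and> 0 < e \<and> {\<psi> \<in> dual. \<forall>x\<in>K. cmod (\<psi> x - \<phi> x) < e} \<subseteq> U"
proof -
  have "generate_topology_on
     {{\<psi> \<in> dual. \<forall>x\<in>K. cmod (\<psi> x - \<phi> x) < \<epsilon>} |\<phi> K \<epsilon>. \<phi> \<in> dual \<and> p_compact p K \<and> 0 < \<epsilon>} U"
    using assms(2) by (simp add: dual_cp_def openin_topology_generated_by_iff)
  then show ?thesis
    using assms(3)
  proof (induction arbitrary: \<phi>)
    case (Int a b)
    obtain K e where K: "relatively_p_compact p K" "0 < e" "{\<psi> \<in> dual. \<forall>x\<in>K. cmod (\<psi> x - \<phi> x) < e} \<subseteq> a"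
      using Int.IH(1)[of \<phi>] Int.prems by blast
    obtain L d where L: "relatively_p_compact p L" "0 < d" "{\<psi> \<in> dual. \<forall>x\<in>L. cmod (\<psi> x - \<phi> x) < d} \<subseteq> b"
      using Int.IH(2)[of \<phi>] Int.prems by blast
    have "{\<psi> \<in> dual. \<forall>x\<in>K \<union> L. cmod (\<psi> x - \<phi> x) < min e d} \<subseteq> a \<inter> b"
      using K(3) L(3) by fastforce
    with relatively_p_compact_Un[OF p K(1) L(1)] K(2) L(2) show ?case
      by (intro exI[of _ "K \<union> L"] exI[of _ "min e d"]) simp
  next
    case (UN C)
    then obtain k where k: "k \<in> C" "\<phi> \<in> k" by blast
    show ?case using UN.IH[OF k] k(1) by (meson Union_upper order_trans)
  next
    case (Basis s)
    then obtain \<psi> K e where s: "s = {\<omega> \<in> dual. \<forall>x\<in>K. cmod (\<omega> x - \<psi> x) < e}"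
      and \<psi>: "\<psi> \<in> dual" and K: "p_compact p K" and e: "0 < e" by auto
    have \<phi>: "\<phi> \<in> dual" "\<And>x. x \<in> K \<Longrightarrow> cmod (\<phi> x - \<psi> x) < e" using Basis.prems s by auto
    show ?case
    proof (cases "K = {}")
      case True
      then show ?thesis using s e K p_compact_def by (intro exI[of _ K] exI[of _ e]) auto
    next
      case False
      have "continuous_on K (\<lambda>x. cmod (\<phi> x - \<psi> x))"
        using \<phi>(1) \<psi> by (intro continuous_intros linear_continuous_on dualD)
      then obtain x0 where x0: "x0 \<in> K" "\<And>x. x \<in> K \<Longrightarrow> cmod (\<phi> x - \<psi> x) \<le> cmod (\<phi> x0 - \<psi> x0)"
        using continuous_attains_sup[OF p_compact_imp_compact[OF p K] False] by blast
      \<comment> \<open>The margin is positive because the deviation of \<phi> from \<psi> attains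
        its maximum on the compact set K.\<close>
      define d where "d = e - cmod (\<phi> x0 - \<psi> x0)"
      have "0 < d" using \<phi>(2)[OF x0(1)] by (simp add: d_def)
      moreover have "{\<omega> \<in> dual. \<forall>x\<in>K. cmod (\<omega> x - \<phi> x) < d} \<subseteq> s"
      proof
        fix \<omega> assume \<omega>: "\<omega> \<in> {\<omega> \<in> dual. \<forall>x\<in>K. cmod (\<omega> x - \<phi> x) < d}"
        have "cmod (\<omega> x - \<psi> x) < e" if "x \<in> K" for x
        proof -
          have "cmod (\<omega> x - \<psi> x) \<le> cmod (\<omega> x - \<phi> x) + cmod (\<phi> x - \<psi> x)"
            using norm_triangle_ineq[of "\<omega> x - \<phi> x" "\<phi> x - \<psi> x"] by simp
          also have "\<dots> < d + cmod (\<phi> x0 - \<psi> x0)" using \<omega> x0(2) that by (intro add_less_le_mono) auto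
          finally show ?thesis by (simp add: d_def)
        qed
        with \<omega> s show "\<omega> \<in> s" by simp
      qed
      ultimately show ?thesis using K p_compact_def by blast
    qed
  qed simp
qed

lemma openin_dual_cpI:
  fixes U :: "('e::complex_banach \<Rightarrow> complex) set"
  assumes "\<And>\<phi>. \<phi> \<in> U \<Longrightarrow> \<phi> \<in> dual \<and> (\<exists>K e. p_compact p K \<and> 0 < e \<and> {\<psi> \<in> dual. \<forall>x\<in>K. cmod (\<psi> x - \<phi> x) < e} \<subseteq> U)"
  shows "openin (dual_cp p) U"
proof (subst openin_subopen, intro ballI)
  fix \<phi> assume "\<phi> \<in> U"
  then obtain K e where K: "\<phi> \<in> dual" "p_compact p K" "0 < e" "{\<psi> \<in> dual. \<forall>x\<in>K. cmod (\<psi> x - \<phi> x) < e} \<subseteq> U"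
    using assms by blast
  have "openin (dual_cp p) {\<psi> \<in> dual. \<forall>x\<in>K. cmod (\<psi> x - \<phi> x) < e}"
    unfolding dual_cp_def by (rule topology_generated_by_Basis) (use K in blast)
  with K show "\<exists>T. openin (dual_cp p) T \<and> \<phi> \<in> T \<and> T \<subseteq> U"
    by (intro exI[of _ "{\<psi> \<in> dual. \<forall>x\<in>K. cmod (\<psi> x - \<phi> x) < e}"]) auto
qed

section \<open>Norms on carriers\<close>

text \<open>The conditions concern N on differences only, so that the carrier may be a subset not
  known to be closed under subtraction.\<close>

lemma Metric_space_norm_dist:
  assumes "\<And>x y. x \<in> X \<Longrightarrow> y \<in> X \<Longrightarrow> 0 \<le> N (x - y)"
    and "\<And>x y. x \<in> X \<Longrightarrow> y \<in> X \<Longrightarrow> N (x - y) = N (y - x)"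
    and "\<And>x y. x \<in> X \<Longrightarrow> y \<in> X \<Longrightarrow> N (x - y) = 0 \<longleftrightarrow> x = y"
    and "\<And>x y z. x \<in> X \<Longrightarrow> y \<in> X \<Longrightarrow> z \<in> X \<Longrightarrow> N (x - z) \<le> N (x - y) + N (y - z)"
  shows "Metric_space X (norm_dist X N)"
  by standard (use assms in \<open>auto simp: norm_dist_def\<close>)

lemma topspace_norm_topology:
  "Metric_space X (norm_dist X N) \<Longrightarrow> topspace (norm_topology X N) = X"
  unfolding norm_topology_def by (rule Metric_space.topspace_mtopology)

lemma openin_norm_topology:
  assumes "Metric_space X (norm_dist X N)"
  shows "openin (norm_topology X N) U \<longleftrightarrow> U \<subseteq> X \<and> (\<forall>x\<in>U. \<exists>r>0. \<forall>y\<in>X. N (x - y) < r \<longrightarrow> y \<in> U)"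
proof -
  interpret Metric_space X "norm_dist X N" by fact
  have "mball x r \<subseteq> U \<longleftrightarrow> (\<forall>y\<in>X. N (x - y) < r \<longrightarrow> y \<in> U)" if "x \<in> X" for x r
    using that by (auto simp: mball_def norm_dist_def)
  then show ?thesis
    unfolding norm_topology_def openin_mtopology by (metis subsetD)
qed

lemma closure_of_norm_topology:
  assumes "Metric_space X (norm_dist X N)"
  shows "norm_topology X N closure_of D = {x \<in> X. \<forall>r>0. \<exists>y\<in>D \<inter> X. N (x - y) < r}"
proof -
  interpret Metric_space X "norm_dist X N" by fact
  show ?thesis
    unfolding norm_topology_def metric_closure_of by (auto simp: mball_def norm_dist_def; blast)
qed

lemma continuous_map_norm_topology_euclidean:
  fixes f :: "'a::ab_group_add \<Rightarrow> 'b::metric_space"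
  assumes "Metric_space X (norm_dist X N)"
  shows "continuous_map (norm_topology X N) euclidean f \<longleftrightarrow>
    (\<forall>x\<in>X. \<forall>e>0. \<exists>d>0. \<forall>y\<in>X. N (x - y) < d \<longrightarrow> dist (f x) (f y) < e)"
proof -
  have eq: "(\<forall>y. y \<in> X \<and> norm_dist X N x y < d \<longrightarrow> Q y) \<longleftrightarrow> (\<forall>y\<in>X. N (x - y) < d \<longrightarrow> Q y)" if "x \<in> X" for x d Q
    using that by (auto simp: norm_dist_def)
  have "continuous_map (norm_topology X N) euclidean f \<longleftrightarrow>
    (\<forall>x\<in>X. \<forall>e>0. \<exists>d>0. \<forall>y. y \<in> X \<and> norm_dist X N x y < d \<longrightarrow> dist (f x) (f y) < e)"
    using Metric_space.metric_continuous_map[OF assms Met_TC.Metric_space_axioms, of f]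
    by (simp add: norm_topology_def)
  then show ?thesis using eq by simp
qed

lemma complex_banach_onD:
  assumes "complex_banach_on X N"
  shows "csubspace X" "x \<in> X \<Longrightarrow> 0 \<le> N x" "x \<in> X \<Longrightarrow> N x = 0 \<longleftrightarrow> x = 0"
    "x \<in> X \<Longrightarrow> N (a *\<^sub>C x) = cmod a * N x" "x \<in> X \<Longrightarrow> y \<in> X \<Longrightarrow> N (x + y) \<le> N x + N y"
    "Metric_space.mcomplete X (norm_dist X N)"
  using assms by (auto simp: complex_banach_on_def)

lemma Metric_space_of_norm:
  assumes "csubspace X" "\<And>x. x \<in> X \<Longrightarrow> 0 \<le> N x" "\<And>x. x \<in> X \<Longrightarrow> N x = 0 \<longleftrightarrow> x = 0"
    "\<And>x a. x \<in> X \<Longrightarrow> N (a *\<^sub>C x) = cmod a * N x" "\<And>x y. x \<in> X \<Longrightarrow> y \<in> X \<Longrightarrow> N (x + y) \<le> N x + N y"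
  shows "Metric_space X (norm_dist X N)"
proof (rule Metric_space_norm_dist)
  note X = csubspaceD[OF assms(1)]
  show "0 \<le> N (x - y)" "N (x - y) = 0 \<longleftrightarrow> x = y" if "x \<in> X" "y \<in> X" for x y
    using assms(2,3)[OF X(4)[OF that]] by auto
  show "N (x - y) = N (y - x)" if "x \<in> X" "y \<in> X" for x y
    using assms(4)[OF X(4)[OF that], of "-1"] by (simp add: scaleC_one)
  show "N (x - z) \<le> N (x - y) + N (y - z)" if "x \<in> X" "y \<in> X" "z \<in> X" for x y z
    using assms(5)[OF X(4)[OF that(1,2)] X(4)[OF that(2,3)]] by simp
qed

lemma complex_banach_on_Metric_space:
  assumes "complex_banach_on X N"
  shows "Metric_space X (norm_dist X N)"
  by (rule Metric_space_of_norm) (use complex_banach_onD[OF assms] in auto)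

lemma unit_ball_on_zero:
  assumes "complex_banach_on X N"
  shows "0 \<in> unit_ball_on X N"
  using csubspaceD(1)[OF complex_banach_onD(1)[OF assms]] complex_banach_onD(3)[OF assms, of 0]
  by (auto simp: unit_ball_on_def)

lemma unit_ball_on_rescale:
  assumes B: "complex_banach_on X N" and "x \<in> X" "N x \<le> r" "0 < r"
  shows "complex_of_real (1 / r) *\<^sub>C x \<in> unit_ball_on X N" "x = complex_of_real r *\<^sub>C complex_of_real (1 / r) *\<^sub>C x"
proof -
  have "N (complex_of_real (1 / r) *\<^sub>C x) = N x / r"
    using complex_banach_onD(4)[OF B assms(2), of "complex_of_real (1 / r)"] assms(4)
    by (simp add: norm_divide)
  then show "complex_of_real (1 / r) *\<^sub>C x \<in> unit_ball_on X N"
    using csubspaceD(3)[OF complex_banach_onD(1)[OF B] assms(2)] assms by (simp add: unit_ball_on_def)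
  show "x = complex_of_real r *\<^sub>C complex_of_real (1 / r) *\<^sub>C x"
    using assms(4) by (simp add: scaleC_scaleC scaleC_one)
qed

section \<open>Homogeneous polynomials\<close>

lemma multilinear_onD:
  assumes "multilinear_on m X A" "length pre + Suc (length post) = m" "set pre \<subseteq> X" "set post \<subseteq> X" "csubspace X"
  shows "clinear_on X (\<lambda>u. A (pre @ u # post))"
proof -
  have "clinear_on X (\<lambda>u. A ((pre @ 0 # post)[length pre := u]))"
    using assms(1)[unfolded multilinear_on_def, rule_format, of "pre @ 0 # post" "length pre"] assms
    by (auto simp: csubspaceD)
  then show ?thesis by simp
qed

text \<open>The prefix \<open>pre\<close> collects the arguments already treated, which lets the
  induction run over k while the lists keep the length m.\<close>

lemma multilinear_on_replicate_scale:
  assumes A: "multilinear_on m X A" and X: "csubspace X" and x: "x \<in> X"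
  shows "length pre + k = m \<Longrightarrow> set pre \<subseteq> X \<Longrightarrow>
    A (pre @ replicate k (a *\<^sub>C x)) = a ^ k *\<^sub>C A (pre @ replicate k x)"
proof (induction k arbitrary: pre)
  case 0
  then show ?case by (simp add: scaleC_one)
next
  case (Suc k)
  have "clinear_on X (\<lambda>u. A (pre @ u # replicate k (a *\<^sub>C x)))"
    using Suc.prems X x by (intro multilinear_onD[OF A]) (auto simp: csubspaceD)
  then have "A (pre @ a *\<^sub>C x # replicate k (a *\<^sub>C x)) = a *\<^sub>C A (pre @ x # replicate k (a *\<^sub>C x))"
    using x by (rule clinear_on_scaleC)
  also have "A (pre @ x # replicate k (a *\<^sub>C x)) = a ^ k *\<^sub>C A (pre @ x # replicate k x)"
    using Suc.IH[of "pre @ [x]"] Suc.prems x by simp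
  finally show ?case by (simp add: scaleC_scaleC)
qed

lemma hom_poly_zero: "P \<in> hom_poly m X N \<Longrightarrow> x \<notin> X \<Longrightarrow> P x = 0"
  by (auto simp: hom_poly_def)

lemma hom_poly_scale:
  assumes X: "csubspace X" and P: "P \<in> hom_poly m X N" and x: "x \<in> X"
  shows "P (a *\<^sub>C x) = a ^ m *\<^sub>C P x"
proof -
  obtain A where "multilinear_on m X A" "\<And>x. x \<in> X \<Longrightarrow> P x = A (replicate m x)"
    using P by (auto simp: hom_poly_def)
  then show ?thesis
    using multilinear_on_replicate_scale[OF _ X x, of m A "[]" m a] X x by (simp add: csubspaceD)
qed

text \<open>Continuity at 0 bounds P on a small ball and homogeneity rescales. The bound contains
  \<open>norm (P 0)\<close> because P 0 need not vanish for m = 0.\<close>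

lemma hom_poly_bounded:
  assumes B: "complex_banach_on X N" and P: "P \<in> hom_poly m X N"
  shows "\<exists>C. \<forall>x\<in>unit_ball_on X N. norm (P x) \<le> C"
proof -
  note X = complex_banach_onD(1)[OF B]
  have "\<forall>x\<in>X. \<forall>e>0. \<exists>d>0. \<forall>y\<in>X. N (x - y) < d \<longrightarrow> dist (P x) (P y) < e"
    using P continuous_map_norm_topology_euclidean[OF complex_banach_on_Metric_space[OF B], of P]
    by (simp add: hom_poly_def)
  then obtain d where d: "d > 0" "\<And>y. y \<in> X \<Longrightarrow> N (0 - y) < d \<Longrightarrow> dist (P 0) (P y) < 1"
    using csubspaceD(1)[OF X] by (metis zero_less_one)
  have "norm (P x) \<le> (2 / d) ^ m * (norm (P 0) + 1)" if x: "x \<in> unit_ball_on X N" for x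
  proof -
    have xX: "x \<in> X" and Nx: "N x \<le> 1" using x by (auto simp: unit_ball_on_def)
    define y where "y = complex_of_real (d / 2) *\<^sub>C x"
    have y: "y \<in> X" using X xX by (simp add: y_def csubspaceD)
    have "N (0 - y) = d / 2 * N x"
      using complex_banach_onD(4)[OF B xX, of "- complex_of_real (d / 2)"] d by (simp add: y_def norm_divide)
    also have "\<dots> \<le> d / 2 * 1" using Nx d by (intro mult_left_mono) auto
    also have "\<dots> < d" using d by simp
    finally have "dist (P 0) (P y) < 1" using d(2)[OF y] by simp
    then have "norm (P y) \<le> norm (P 0) + 1"
      using norm_triangle_sub[of "P y" "P 0"] by (simp add: dist_norm norm_minus_commute)
    moreover have "x = complex_of_real (2 / d) *\<^sub>C y"
      using d by (simp add: y_def scaleC_scaleC scaleC_one)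
    then have "norm (P x) = (2 / d) ^ m * norm (P y)"
      using hom_poly_scale[OF X P y] d by (simp add: norm_scaleC norm_power norm_divide)
    ultimately show ?thesis using d by (simp add: mult_left_mono)
  qed
  then show ?thesis by blast
qed

lemma poly_norm_upper:
  assumes "complex_banach_on X N" "P \<in> hom_poly m X N" "x \<in> unit_ball_on X N"
  shows "norm (P x) \<le> poly_norm X N P"
  unfolding poly_norm_def
  by (rule cSUP_upper[OF assms(3)]) (use hom_poly_bounded[OF assms(1,2)] in \<open>auto simp: bdd_above_def\<close>)

lemma poly_norm_least:
  assumes "complex_banach_on X N" "\<And>x. x \<in> unit_ball_on X N \<Longrightarrow> norm (P x) \<le> K"
  shows "poly_norm X N P \<le> K"
  unfolding poly_norm_def by (rule cSUP_least) (use assms unit_ball_on_zero in auto)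

lemma hom_poly_compose:
  assumes T: "bounded_clinear T" and P: "P \<in> hom_poly m X N"
  shows "(\<lambda>x. T (P x)) \<in> hom_poly m X N"
proof -
  have lin: "clinear_on UNIV T" and bl: "bounded_linear T" using T by (auto simp: bounded_clinear_def)
  obtain A where A: "multilinear_on m X A" "\<And>x. x \<in> X \<Longrightarrow> P x = A (replicate m x)"
    and cont: "continuous_map (norm_topology X N) euclidean P" and zero: "\<And>x. x \<notin> X \<Longrightarrow> P x = 0"
    using P by (auto simp: hom_poly_def)
  have "multilinear_on m X (\<lambda>xs. T (A xs))"
    using A(1) lin unfolding multilinear_on_def clinear_on_def by auto
  moreover have "continuous_map (norm_topology X N) euclidean (T \<circ> P)"
    using cont linear_continuous_on[OF bl, of UNIV] by (intro continuous_map_compose) auto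
  ultimately show ?thesis
    using A(2) zero linear_0[OF bounded_linear.linear[OF bl]] by (auto simp: hom_poly_def comp_def)
qed

lemma csubspace_hom_poly: "csubspace (hom_poly m X N :: ('f::complex_vector \<Rightarrow> 'e::complex_banach) set)"
proof (rule complex_vector.subspaceI)
  show "0 \<in> (hom_poly m X N :: ('f \<Rightarrow> 'e) set)"
    by (auto simp: hom_poly_def multilinear_on_def clinear_on_def zero_fun_def intro!: exI[of _ "\<lambda>_. 0"])
  show "P + Q \<in> hom_poly m X N" if "P \<in> hom_poly m X N" "Q \<in> hom_poly m X N" for P Q :: "'f \<Rightarrow> 'e"
  proof -
    obtain A where A: "multilinear_on m X A" "\<And>x. x \<in> X \<Longrightarrow> P x = A (replicate m x)"
      using \<open>P \<in> _\<close> by (auto simp: hom_poly_def)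
    obtain A' where A': "multilinear_on m X A'" "\<And>x. x \<in> X \<Longrightarrow> Q x = A' (replicate m x)"
      using \<open>Q \<in> _\<close> by (auto simp: hom_poly_def)
    have "multilinear_on m X (\<lambda>xs. A xs + A' xs)"
      using A(1) A'(1) unfolding multilinear_on_def clinear_on_def by (auto simp: algebra_simps scaleC_add_right)
    with A A' that show ?thesis
      by (auto simp: hom_poly_def plus_fun_def continuous_map_add intro!: exI[of _ "\<lambda>xs. A xs + A' xs"])
  qed
  show "a *\<^sub>C P \<in> hom_poly m X N" if "P \<in> hom_poly m X N" for a and P :: "'f \<Rightarrow> 'e"
  proof -
    have "bounded_clinear (\<lambda>v::'e. a *\<^sub>C v)"
      using bounded_linear_scaleC_right
      by (auto simp: bounded_clinear_def clinear_on_def scaleC_add_right scaleC_scaleC mult.commute)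
    from hom_poly_compose[OF this that] show ?thesis by (simp add: scaleC_fun_def)
  qed
qed

lemma hom_poly_eq_0:
  assumes B: "complex_banach_on X N" and P: "P \<in> hom_poly m X N" and "\<And>x. x \<in> unit_ball_on X N \<Longrightarrow> P x = 0"
  shows "P = 0"
proof (rule ext)
  fix x
  show "P x = 0 x"
  proof (cases "x \<in> X")
    case True
    then have r: "N x \<le> N x + 1" "0 < N x + 1" using complex_banach_onD(2)[OF B True] by auto
    note u = unit_ball_on_rescale[OF B True r]
    then have "P (complex_of_real (1 / (N x + 1)) *\<^sub>C x) = 0" using assms(3) by blast
    then show ?thesis
      using hom_poly_scale[OF complex_banach_onD(1)[OF B] P, of "complex_of_real (1 / (N x + 1)) *\<^sub>C x" "complex_of_real (N x + 1)"]
        u by (simp add: unit_ball_on_def)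
  qed (use hom_poly_zero[OF P] in simp)
qed

text \<open>For any subset Y, as it serves both for all scalar polynomials and for the p-compact
  ones; differences are formed in \<open>hom_poly\<close>.\<close>

lemma Metric_space_poly_norm:
  fixes Y :: "('f::complex_vector \<Rightarrow> 'e::complex_banach) set"
  assumes B: "complex_banach_on X N" and Y: "Y \<subseteq> hom_poly m X N"
  shows "Metric_space Y (norm_dist Y (poly_norm X N))"
proof (rule Metric_space_norm_dist)
  have D: "P - Q \<in> hom_poly m X N" if "P \<in> Y" "Q \<in> Y" for P Q
    using Y that csubspaceD(4)[OF csubspace_hom_poly] by blast
  show nn: "0 \<le> poly_norm X N (P - Q)" if "P \<in> Y" "Q \<in> Y" for P Q
    using poly_norm_upper[OF B D[OF that] unit_ball_on_zero[OF B]] order_trans norm_ge_zero by blast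
  show "poly_norm X N (P - Q) = poly_norm X N (Q - P)" for P Q :: "'f \<Rightarrow> 'e"
    by (simp add: poly_norm_def norm_minus_commute)
  show "poly_norm X N (P - Q) = 0 \<longleftrightarrow> P = Q" if "P \<in> Y" "Q \<in> Y" for P Q
  proof
    assume "poly_norm X N (P - Q) = 0"
    then have "(P - Q) x = 0" if "x \<in> unit_ball_on X N" for x
      using poly_norm_upper[OF B D[OF \<open>P \<in> Y\<close> \<open>Q \<in> Y\<close>] that] by simp
    then have "P - Q = 0" by (rule hom_poly_eq_0[OF B D[OF that]])
    then show "P = Q" by simp
  next
    assume "P = Q"
    then have "poly_norm X N (P - Q) \<le> 0" by (intro poly_norm_least[OF B]) simp
    with nn[OF that] show "poly_norm X N (P - Q) = 0" by simp
  qed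
  show "poly_norm X N (P - R) \<le> poly_norm X N (P - Q) + poly_norm X N (Q - R)"
    if "P \<in> Y" "Q \<in> Y" "R \<in> Y" for P Q R
  proof (rule poly_norm_least[OF B])
    fix x assume x: "x \<in> unit_ball_on X N"
    have "norm ((P - R) x) \<le> norm ((P - Q) x) + norm ((Q - R) x)"
      using norm_triangle_ineq[of "(P - Q) x" "(Q - R) x"] by simp
    also have "\<dots> \<le> poly_norm X N (P - Q) + poly_norm X N (Q - R)"
      using that x D by (intro add_mono poly_norm_upper[OF B])
    finally show "norm ((P - R) x) \<le> \<dots>" .
  qed
qed

section \<open>Polarization\<close>

lemma multilinear_on_replicate_sum:
  assumes A: "multilinear_on m X A" and X: "csubspace X" and x: "\<And>i. i \<in> S \<Longrightarrow> x i \<in> X"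
  shows "length pre + k = m \<Longrightarrow> set pre \<subseteq> X \<Longrightarrow>
    A (pre @ replicate k (\<Sum>i\<in>S. x i)) = (\<Sum>fs | set fs \<subseteq> S \<and> length fs = k. A (pre @ map x fs))"
proof (induction k arbitrary: pre)
  case 0
  have "{fs. set fs \<subseteq> S \<and> length fs = 0} = {[]}" by auto
  then show ?case by simp
next
  case (Suc k)
  define s where "s = (\<Sum>i\<in>S. x i)"
  have s: "s \<in> X" unfolding s_def using x by (rule csubspace_sum[OF X])
  have "clinear_on X (\<lambda>u. A (pre @ u # replicate k s))"
    using Suc.prems X s by (intro multilinear_onD[OF A]) auto
  then have "A (pre @ s # replicate k s) = (\<Sum>i\<in>S. A (pre @ x i # replicate k s))"
    unfolding s_def by (rule clinear_on_sum[OF _ X x])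
  also have "\<dots> = (\<Sum>i\<in>S. \<Sum>fs | set fs \<subseteq> S \<and> length fs = k. A (pre @ x i # map x fs))"
  proof (rule sum.cong[OF refl])
    fix i assume i: "i \<in> S"
    show "A (pre @ x i # replicate k s) = (\<Sum>fs | set fs \<subseteq> S \<and> length fs = k. A (pre @ x i # map x fs))"
      using Suc.IH[of "pre @ [x i]"] Suc.prems x[OF i] by (simp add: s_def)
  qed
  also have "\<dots> = (\<Sum>(fs, i)\<in>{fs. set fs \<subseteq> S \<and> length fs = k} \<times> S. A (pre @ x i # map x fs))"
    by (subst sum.swap) (simp add: sum.cartesian_product)
  also have "\<dots> = (\<Sum>fs\<in>(\<lambda>(fs, i). i # fs) ` ({fs. set fs \<subseteq> S \<and> length fs = k} \<times> S). A (pre @ map x fs))"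
    by (subst sum.reindex) (auto simp: inj_on_def intro!: sum.cong)
  finally show ?case by (simp add: lists_length_Suc_eq s_def)
qed

text \<open>Inclusion-exclusion: a proper subset U of I has as many supersets of even as of odd
  cardinality within I. In the polarization sum this cancels all words whose set of letters U is not
  everything.\<close>

lemma sum_alternating_supersets:
  fixes I U :: "'i set"
  assumes I: "finite I" and U: "U \<subseteq> I"
  shows "(\<Sum>S\<in>Pow I. if U \<subseteq> S then (-1) ^ (card I + card S) else 0) = (if U = I then 1 else 0 :: complex)"
proof -
  have "(\<Sum>S\<in>Pow I. if U \<subseteq> S then (-1) ^ (card I + card S) else 0)
      = (\<Sum>S | S \<subseteq> I \<and> U \<subseteq> S. (-1) ^ (card I + card S) :: complex)"
    using I by (subst sum.inter_filter[symmetric]) (auto intro!: sum.cong)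
  also have "\<dots> = (-1) ^ card I * (\<Sum>S | S \<subseteq> I \<and> U \<subseteq> S. (-1) ^ card S)"
    by (simp add: sum_distrib_left power_add)
  also have "\<dots> = (if U = I then 1 else 0)"
  proof (cases "U = I")
    case True
    then have "{S. S \<subseteq> I \<and> U \<subseteq> S} = {I}" by auto
    then show ?thesis using True by (simp flip: power_add)
  next
    case False
    with U have "U \<subset> I" by auto
    then have "(\<Sum>S | S \<subseteq> I \<and> U \<subseteq> S. (-1) ^ card S :: complex) = 0"
      using card_subsupersets_even_odd[OF I, of U] I
      by (intro sum_alternating_cancels) (auto simp: conj_ac)
    then show ?thesis using False by simp
  qed
  finally show ?thesis .
qed

text \<open>The lists \<open>fs\<close> enumerate the permutations of \<open>{..<m}\<close>.\<close>

definition polarization :: "nat \<Rightarrow> ('f::complex_vector \<Rightarrow> 'e::complex_vector) \<Rightarrow> 'f list \<Rightarrow> 'e" where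
  "polarization m P xs =
     (1 / of_nat (card {fs. length fs = m \<and> set fs = {..<m}})) *\<^sub>C
     (\<Sum>S\<in>Pow {..<m}. (-1) ^ (m + card S) *\<^sub>C P (\<Sum>i\<in>S. xs ! i))"

text \<open>After expanding P on the partial sums into words over S and exchanging the sums, the
  signs cancel every word that misses an index; a word of length m with all m letters is a
  permutation.\<close>

lemma polarization_eq_symmetrization:
  fixes A :: "'f::complex_vector list \<Rightarrow> complex"
  assumes A: "multilinear_on m X A" "\<And>x. x \<in> X \<Longrightarrow> P x = A (replicate m x)" and X: "csubspace X"
    and xs: "length xs = m" "set xs \<subseteq> X"
  shows "polarization m P xs = 1 / of_nat (card {fs. length fs = m \<and> set fs = {..<m}}) *
    (\<Sum>fs | length fs = m \<and> set fs = {..<m}. A (map ((!) xs) fs))"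
proof -
  define L where "L S = {fs. set fs \<subseteq> S \<and> length fs = m}" for S :: "nat set"
  have finL: "finite (L {..<m})" unfolding L_def by (rule finite_lists_length_eq) simp
  have nth: "xs ! i \<in> X" if "i < m" for i using that xs by auto
  have "(\<Sum>S\<in>Pow {..<m}. (-1) ^ (m + card S) *\<^sub>C P (\<Sum>i\<in>S. xs ! i))
      = (\<Sum>S\<in>Pow {..<m}. \<Sum>fs\<in>L {..<m}. if set fs \<subseteq> S then (-1) ^ (m + card S) * A (map ((!) xs) fs) else 0)"
  proof (rule sum.cong[OF refl])
    fix S assume S: "S \<in> Pow {..<m}"
    have SX: "xs ! i \<in> X" if "i \<in> S" for i using nth that S by blast
    have "P (\<Sum>i\<in>S. xs ! i) = A ([] @ replicate m (\<Sum>i\<in>S. xs ! i))"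
      using A(2)[of "\<Sum>i\<in>S. xs ! i"] csubspace_sum[of X S "(!) xs", OF X SX] by simp
    also have "\<dots> = (\<Sum>fs\<in>L S. A ([] @ map ((!) xs) fs))"
      unfolding L_def by (rule multilinear_on_replicate_sum[OF A(1) X SX]) auto
    also have "L S = {fs \<in> L {..<m}. set fs \<subseteq> S}" using S by (auto simp: L_def)
    finally show "(-1) ^ (m + card S) *\<^sub>C P (\<Sum>i\<in>S. xs ! i)
        = (\<Sum>fs\<in>L {..<m}. if set fs \<subseteq> S then (-1) ^ (m + card S) * A (map ((!) xs) fs) else 0)"
      using finL by (simp add: sum.inter_filter scaleC_complex_def sum_distrib_left if_distrib[of "\<lambda>x. _ * x"] cong: if_cong)
  qed
  also have "\<dots> = (\<Sum>fs\<in>L {..<m}. \<Sum>S\<in>Pow {..<m}. if set fs \<subseteq> S then (-1) ^ (m + card S) * A (map ((!) xs) fs) else 0)"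
    by (rule sum.swap)
  also have "\<dots> = (\<Sum>fs\<in>L {..<m}. (if set fs = {..<m} then 1 else 0) * A (map ((!) xs) fs))"
  proof (rule sum.cong[OF refl])
    fix fs assume "fs \<in> L {..<m}"
    then have "set fs \<subseteq> {..<m}" by (simp add: L_def)
    from sum_alternating_supersets[OF _ this, unfolded card_lessThan]
    have "(if set fs = {..<m} then 1 else 0) = (\<Sum>S\<in>Pow {..<m}. if set fs \<subseteq> S then (-1) ^ (m + card S) else 0 :: complex)"
      by simp
    then show "(\<Sum>S\<in>Pow {..<m}. if set fs \<subseteq> S then (-1) ^ (m + card S) * A (map ((!) xs) fs) else 0)
        = (if set fs = {..<m} then 1 else 0) * A (map ((!) xs) fs)"
      by (simp only: sum_distrib_right) (auto intro!: sum.cong)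
  qed
  also have "\<dots> = (\<Sum>fs | length fs = m \<and> set fs = {..<m}. A (map ((!) xs) fs))"
    using finL by (intro sum.mono_neutral_cong_right) (auto simp: L_def)
  finally show ?thesis by (simp add: polarization_def scaleC_complex_def)
qed

text \<open>The symmetrization inherits multilinearity because each fs uses the index i exactly
  once, at one position j: updating entry i of xs amounts to updating entry j of the permuted
  list.\<close>

lemma polarization_scalar:
  fixes P :: "'f::complex_vector \<Rightarrow> complex"
  assumes P: "P \<in> hom_poly m X N" and X: "csubspace X"
  shows "multilinear_on m X (polarization m P)" "x \<in> X \<Longrightarrow> polarization m P (replicate m x) = P x"
proof -
  obtain A where A: "multilinear_on m X A" "\<And>x. x \<in> X \<Longrightarrow> P x = A (replicate m x)"
    using P by (auto simp: hom_poly_def)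
  define B where "B = {fs. length fs = m \<and> set fs = {..<m}}"
  have "B \<subseteq> {fs. set fs \<subseteq> {..<m} \<and> length fs = m}" by (auto simp: B_def)
  then have finB: "finite B" using finite_lists_length_eq[of "{..<m}" m] finite_subset by blast
  have "[0..<m] \<in> B" by (auto simp: B_def)
  then have cardB: "card B \<noteq> 0" using finB by auto
  note eq = polarization_eq_symmetrization[OF A X, folded B_def]
  show "polarization m P (replicate m x) = P x" if x: "x \<in> X"
  proof -
    have "map ((!) (replicate m x)) fs = replicate m x" if "fs \<in> B" for fs
    proof (rule nth_equalityI)
      show "length (map ((!) (replicate m x)) fs) = length (replicate m x)" using that by (simp add: B_def)
      fix k assume "k < length (map ((!) (replicate m x)) fs)"
      then have "k < length fs" by simp
      with that nth_mem[of k fs] have "fs ! k < m" "k < m" by (auto simp: B_def)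
      with \<open>k < length fs\<close> show "map ((!) (replicate m x)) fs ! k = replicate m x ! k" by simp
    qed
    then have "polarization m P (replicate m x) = 1 / of_nat (card B) * (\<Sum>fs\<in>B. A (replicate m x))"
      using x by (subst eq) (auto intro!: sum.cong)
    then show ?thesis using cardB A(2)[OF x] by simp
  qed
  show "multilinear_on m X (polarization m P)"
    unfolding multilinear_on_def
  proof (intro allI impI, elim conjE)
    fix xs :: "'f list" and i assume xs: "length xs = m" "set xs \<subseteq> X" and i: "i < m"
    have lin: "clinear_on X (\<lambda>u. A (map ((!) (xs[i := u])) fs))" if fs: "fs \<in> B" for fs
    proof -
      have dist: "distinct fs" using fs by (simp add: B_def card_distinct)
      from fs i have "i \<in> set fs" "length fs = m" by (simp_all add: B_def)
      then obtain j where j: "j < m" "fs ! j = i" by (metis in_set_conv_nth)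
      have fs_less: "fs ! k < m" if "k < m" for k
        using fs that nth_mem[of k fs] by (simp add: B_def)
      have "map ((!) (xs[i := u])) fs = (map ((!) xs) fs)[j := u]" for u
      proof (rule nth_equalityI)
        fix k assume "k < length (map ((!) (xs[i := u])) fs)"
        then have k: "k < length fs" by simp
        have "fs ! k = i \<longleftrightarrow> k = j"
          using nth_eq_iff_index_eq[OF dist k, of j] j \<open>length fs = m\<close> by metis
        then show "map ((!) (xs[i := u])) fs ! k = (map ((!) xs) fs)[j := u] ! k"
          using k fs_less[of k] \<open>length fs = m\<close> i xs by (auto simp: nth_list_update)
      qed simp
      moreover have "set (map ((!) xs) fs) \<subseteq> X" using fs xs by (auto simp: B_def)
      ultimately show ?thesis
        using A(1)[unfolded multilinear_on_def, rule_format, of "map ((!) xs) fs" j] j fs by (simp add: B_def)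
    qed
    have "set (xs[i := u]) \<subseteq> X" if "u \<in> X" for u using that xs set_update_subset_insert[of xs i u] by blast
    then have "polarization m P (xs[i := u]) = 1 / of_nat (card B) * (\<Sum>fs\<in>B. A (map ((!) (xs[i := u])) fs))"
      if "u \<in> X" for u using that xs by (intro eq) auto
    then show "clinear_on X (\<lambda>u. polarization m P (xs[i := u]))"
      using lin X by (auto simp: clinear_on_def csubspaceD sum.distrib scaleC_complex_def distrib_left
          sum_distrib_left mult.left_commute add_divide_distrib)
  qed
qed

text \<open>\<open>polarization m P\<close> is built from values of P, so it commutes with
  functionals and its multilinearity can be tested after each functional in \<open>dual\<close>. The
  multilinear maps provided by the hypothesis depend on the functional and could not be glued
  directly.\<close>

lemma weakly_polynomial_polarization:
  fixes P :: "'f::complex_vector \<Rightarrow> 'e::complex_banach"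
  assumes X: "csubspace X" and P: "\<And>\<phi>. \<phi> \<in> dual \<Longrightarrow> (\<lambda>x. \<phi> (P x)) \<in> hom_poly m X N"
  shows "multilinear_on m X (polarization m P)" "x \<in> X \<Longrightarrow> polarization m P (replicate m x) = P x"
proof -
  have \<phi>: "\<phi> (polarization m P xs) = polarization m (\<lambda>x. \<phi> (P x)) xs" if "\<phi> \<in> dual" for \<phi> xs
    by (simp add: polarization_def dualD[OF that] scaleC_complex_def)
  show "polarization m P (replicate m x) = P x" if "x \<in> X"
    by (rule dual_separates) (simp add: \<phi> polarization_scalar(2)[OF P X that])
  show "multilinear_on m X (polarization m P)"
    unfolding multilinear_on_def
  proof (intro allI impI)
    fix xs i assume a: "length xs = m \<and> set xs \<subseteq> X \<and> i < m"
    have lin: "clinear_on X (\<lambda>u. \<phi> (polarization m P (xs[i := u])))" if "\<phi> \<in> dual" for \<phi>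
      using polarization_scalar(1)[OF P[OF that] X, unfolded multilinear_on_def, rule_format, OF a]
      by (simp add: \<phi>[OF that])
    show "clinear_on X (\<lambda>u. polarization m P (xs[i := u]))"
      unfolding clinear_on_def
    proof (intro conjI ballI allI)
      show "polarization m P (xs[i := x + y]) = polarization m P (xs[i := x]) + polarization m P (xs[i := y])"
        if "x \<in> X" "y \<in> X" for x y
        by (rule dual_separates) (simp add: dualD(3) clinear_on_add[OF lin that])
      show "polarization m P (xs[i := a *\<^sub>C x]) = a *\<^sub>C polarization m P (xs[i := x])" if "x \<in> X" for a x
        by (rule dual_separates) (simp add: dualD(4) clinear_on_scaleC[OF lin that] scaleC_complex_def)
    qed
  qed
qed

text \<open>Continuity holds because the weak and norm topologies agree on the compact closure of the range.\<close>

lemma weakly_polynomial_p_compact: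
  fixes P :: "'f::complex_vector \<Rightarrow> 'e::complex_banach"
  assumes p: "1 \<le> p" and B: "complex_banach_on X N"
    and P: "\<And>\<phi>. \<phi> \<in> dual \<Longrightarrow> (\<lambda>x. \<phi> (P x)) \<in> hom_poly m X N"
    and zero: "\<And>x. x \<notin> X \<Longrightarrow> P x = 0"
    and K: "relatively_p_compact p (P ` unit_ball_on X N)"
  shows "P \<in> p_compact_poly p m X N"
proof -
  note X = complex_banach_onD(1)[OF B]
  note M = complex_banach_on_Metric_space[OF B]
  have compact: "compact (closure (P ` unit_ball_on X N))"
    by (rule p_compact_imp_compact[OF p p_compact_closure[OF K]])
  have scale: "P (a *\<^sub>C x) = a ^ m *\<^sub>C P x" if "x \<in> X" for a x
    by (rule dual_separates) (simp add: hom_poly_scale[OF X P that] dualD(4) scaleC_complex_def)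
  have "continuous_map (norm_topology X N) euclidean P"
    unfolding continuous_map_norm_topology_euclidean[OF M]
  proof (intro ballI allI impI, rule ccontr)
    fix x and e :: real
    assume x: "x \<in> X" and e: "0 < e" and neg: "\<not> (\<exists>d>0. \<forall>y\<in>X. N (x - y) < d \<longrightarrow> dist (P x) (P y) < e)"
    have "\<exists>y\<in>X. N (x - y) < inverse (real (Suc n)) \<and> e \<le> dist (P x) (P y)" for n
    proof -
      have "0 < inverse (real (Suc n))" by simp
      with neg show ?thesis by (meson not_le)
    qed
    then obtain y where y: "\<And>n. y n \<in> X" "\<And>n. N (x - y n) < inverse (real (Suc n))" "\<And>n. e \<le> dist (P x) (P (y n))"
      by metis
    \<comment> \<open>All y n lie in the ball of radius N x + 1, being within distance 1 of x; by
      homogeneity their values lie in one compact multiple of the closure of the range on the unit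
      ball.\<close>
    define r where "r = N x + 1"
    have r: "0 < r" using complex_banach_onD(2)[OF B x] by (simp add: r_def)
    have Ny: "N (y n) \<le> r" for n
    proof -
      have D: "x - y n \<in> X" using X x y by (simp add: csubspaceD)
      have "N (y n) \<le> N x + N ((-1) *\<^sub>C (x - y n))"
        using complex_banach_onD(5)[OF B x csubspaceD(3)[OF X D, of "-1"]] by (simp add: scaleC_one)
      also have "N ((-1) *\<^sub>C (x - y n)) = N (x - y n)"
        using complex_banach_onD(4)[OF B D, of "-1"] by simp
      also have "N (x - y n) \<le> 1"
        using y(2)[of n] inverse_le_1_iff[of "real (Suc n)"] by simp
      finally show ?thesis by (simp add: r_def)
    qed
    have "compact ((\<lambda>v. complex_of_real r ^ m *\<^sub>C v) ` closure (P ` unit_ball_on X N))"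
      by (intro compact_continuous_image linear_continuous_on bounded_linear_scaleC_right compact)
    moreover have "P (y n) \<in> (\<lambda>v. complex_of_real r ^ m *\<^sub>C v) ` closure (P ` unit_ball_on X N)" for n
    proof -
      note u = unit_ball_on_rescale[OF B y(1) Ny r, of n]
      have "P (y n) = complex_of_real r ^ m *\<^sub>C P (complex_of_real (1 / r) *\<^sub>C y n)"
        by (subst u(2), rule scale) (use u(1) in \<open>simp add: unit_ball_on_def\<close>)
      moreover have "P (complex_of_real (1 / r) *\<^sub>C y n) \<in> closure (P ` unit_ball_on X N)"
        by (rule subsetD[OF closure_subset imageI[OF u(1)]])
      ultimately show ?thesis
        by (rule image_eqI[where f = "\<lambda>v. complex_of_real r ^ m *\<^sub>C v"])
    qed
    ultimately obtain l h where h: "strict_mono (h :: nat \<Rightarrow> nat)" "((\<lambda>n. P (y n)) \<circ> h) \<longlonglongrightarrow> l"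
      unfolding compact_def by metis
    \<comment> \<open>The limit of the subsequence is identified by functionals, whose compositions
      with P are continuous by hypothesis.\<close>
    have "l = P x"
    proof (rule dual_separates)
      fix \<phi> :: "'e \<Rightarrow> complex" assume \<phi>: "\<phi> \<in> dual"
      have "(\<lambda>n. \<phi> (P (y (h n)))) \<longlonglongrightarrow> \<phi> l"
        using bounded_linear.tendsto[OF dualD(2)[OF \<phi>] h(2)] by (simp add: comp_def)
      moreover have "(\<lambda>n. \<phi> (P (y n))) \<longlonglongrightarrow> \<phi> (P x)"
        unfolding LIMSEQ_def
      proof (intro allI impI)
        fix \<epsilon> :: real assume "0 < \<epsilon>"
        then obtain d where d: "0 < d" "\<And>z. z \<in> X \<Longrightarrow> N (x - z) < d \<Longrightarrow> dist (\<phi> (P x)) (\<phi> (P z)) < \<epsilon>"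
          using P[OF \<phi>] x continuous_map_norm_topology_euclidean[OF M, of "\<lambda>x. \<phi> (P x)"]
          unfolding hom_poly_def by blast
        obtain n0 where n0: "inverse (real (Suc n0)) < d" using reals_Archimedean[OF d(1)] by blast
        have "dist (\<phi> (P (y n))) (\<phi> (P x)) < \<epsilon>" if "n \<ge> n0" for n
        proof -
          have "inverse (real (Suc n)) \<le> inverse (real (Suc n0))" using that by (simp add: le_imp_inverse_le)
          then have "N (x - y n) < d" using y(2)[of n] n0 by linarith
          then show ?thesis using d(2)[OF y(1)[of n]] by (simp add: dist_commute)
        qed
        then show "\<exists>n0. \<forall>n\<ge>n0. dist (\<phi> (P (y n))) (\<phi> (P x)) < \<epsilon>" by blast
      qed
      then have "(\<lambda>n. \<phi> (P (y (h n)))) \<longlonglongrightarrow> \<phi> (P x)"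
        using LIMSEQ_subseq_LIMSEQ[OF _ h(1)] by (force simp: comp_def)
      ultimately show "\<phi> l = \<phi> (P x)" using LIMSEQ_unique by blast
    qed
    then obtain n where "dist (P (y (h n))) (P x) < e"
      using h(2) e unfolding LIMSEQ_def comp_def by blast
    with y(3)[of "h n"] show False by (simp add: dist_commute)
  qed
  then have "P \<in> hom_poly m X N"
    unfolding hom_poly_def mem_Collect_eq
    using weakly_polynomial_polarization[of X P m N, OF X P] zero
    by (intro conjI exI[of _ "polarization m P"]) auto
  with K show ?thesis by (simp add: p_compact_poly_def)
qed

section \<open>The isometry\<close>

text \<open>The value 0 off \<open>dual\<close> is the normalization demanded by
  \<open>L_cp\<close>.\<close>

definition composition_operator :: "('f \<Rightarrow> 'e::complex_banach) \<Rightarrow> ('e \<Rightarrow> complex) \<Rightarrow> 'f \<Rightarrow> complex" where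
  "composition_operator P \<phi> = (if \<phi> \<in> dual then (\<lambda>x. \<phi> (P x)) else 0)"

lemma dual_compose_hom_poly:
  "\<phi> \<in> dual \<Longrightarrow> P \<in> hom_poly m X N \<Longrightarrow> (\<lambda>x. \<phi> (P x)) \<in> hom_poly m X N"
  by (rule hom_poly_compose) (simp_all add: dual_def)

lemma p_compact_polyD:
  assumes "P \<in> p_compact_poly p m X N"
  shows "P \<in> hom_poly m X N" "relatively_p_compact p (P ` unit_ball_on X N)"
  using assms by (auto simp: p_compact_poly_def)

text \<open>For continuity, K is the closure of the range of P on the unit ball: functionals
  uniformly close on K have compositions with P that are close in the polynomial norm.\<close>

lemma composition_operator_in_L_cp:
  fixes P :: "'f::complex_vector \<Rightarrow> 'e::complex_banach"
  assumes p: "1 \<le> p" and B: "complex_banach_on X N" and P: "P \<in> p_compact_poly p m X N"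
  shows "composition_operator P \<in> L_cp p (hom_poly m X N) (poly_norm X N)"
proof -
  define H where "H = (hom_poly m X N :: ('f \<Rightarrow> complex) set)"
  note P = p_compact_polyD[OF P]
  have M: "Metric_space H (norm_dist H (poly_norm X N))"
    unfolding H_def by (rule Metric_space_poly_norm[OF B order_refl])
  have T: "composition_operator P \<phi> = (\<lambda>x. \<phi> (P x))" if "\<phi> \<in> dual" for \<phi>
    using that by (simp add: composition_operator_def)
  have TH: "composition_operator P \<phi> \<in> H" if "\<phi> \<in> dual" for \<phi>
    unfolding T[OF that] H_def by (rule dual_compose_hom_poly[OF that P(1)])
  have "clinear_on dual (composition_operator P)"
    unfolding clinear_on_def
  proof (intro conjI ballI allI)
    show "composition_operator P (\<phi> + \<psi>) = composition_operator P \<phi> + composition_operator P \<psi>"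
      if "\<phi> \<in> dual" "\<psi> \<in> dual" for \<phi> \<psi>
      using T[OF csubspaceD(2)[OF csubspace_dual that]] that by (simp add: T fun_eq_iff)
    show "composition_operator P (a *\<^sub>C \<phi>) = a *\<^sub>C composition_operator P \<phi>" if "\<phi> \<in> dual" for a \<phi>
      using T[OF csubspaceD(3)[OF csubspace_dual that]] that by (simp add: T fun_eq_iff scaleC_fun_def)
  qed
  moreover have "continuous_map (dual_cp p) (norm_topology H (poly_norm X N)) (composition_operator P)"
    unfolding continuous_map_def topspace_norm_topology[OF M] topspace_dual_cp[OF p]
  proof (intro conjI allI impI)
    show "composition_operator P \<in> dual \<rightarrow> H" using TH by blast
    fix U assume U: "openin (norm_topology H (poly_norm X N)) U"
    show "openin (dual_cp p) {\<phi> \<in> dual. composition_operator P \<phi> \<in> U}"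
    proof (rule openin_dual_cpI, intro conjI)
      fix \<phi> :: "'e \<Rightarrow> complex" assume \<phi>: "\<phi> \<in> {\<phi> \<in> dual. composition_operator P \<phi> \<in> U}"
      then show "\<phi> \<in> dual" by simp
      obtain r where r: "r > 0" "\<And>Q. Q \<in> H \<Longrightarrow> poly_norm X N (composition_operator P \<phi> - Q) < r \<Longrightarrow> Q \<in> U"
        using U \<phi> unfolding openin_norm_topology[OF M] by blast
      have "composition_operator P \<psi> \<in> U"
        if \<psi>: "\<psi> \<in> dual" "\<forall>x\<in>closure (P ` unit_ball_on X N). cmod (\<psi> x - \<phi> x) < r / 2" for \<psi>
      proof (rule r(2)[OF TH[OF \<psi>(1)]])
        have "poly_norm X N (composition_operator P \<phi> - composition_operator P \<psi>) \<le> r / 2"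
        proof (rule poly_norm_least[OF B])
          fix x assume "x \<in> unit_ball_on X N"
          then have "P x \<in> closure (P ` unit_ball_on X N)" by (meson closure_subset imageI subsetD)
          with \<psi> \<phi> show "norm ((composition_operator P \<phi> - composition_operator P \<psi>) x) \<le> r / 2"
            by (simp add: T norm_minus_commute less_imp_le)
        qed
        with r(1) show "poly_norm X N (composition_operator P \<phi> - composition_operator P \<psi>) < r" by simp
      qed
      then show "\<exists>K e. p_compact p K \<and> 0 < e \<and>
          {\<psi> \<in> dual. \<forall>x\<in>K. cmod (\<psi> x - \<phi> x) < e} \<subseteq> {\<phi> \<in> dual. composition_operator P \<phi> \<in> U}"
        using p_compact_closure[OF P(2)] r(1)
        by (intro exI[of _ "closure (P ` unit_ball_on X N)"] exI[of _ "r / 2"]) auto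
    qed
  qed
  ultimately show ?thesis by (simp add: L_cp_def H_def composition_operator_def)
qed

text \<open>Two suprema are exchanged; a norming functional at each value of P gives the lower
  bound.\<close>

lemma eps_norm_composition_operator:
  fixes P :: "'f::complex_vector \<Rightarrow> 'e::complex_banach"
  assumes B: "complex_banach_on X N" and P: "P \<in> hom_poly m X N"
  shows "eps_norm (poly_norm X N) (composition_operator P) = poly_norm X N P"
proof (rule antisym)
  have le: "poly_norm X N (composition_operator P \<phi>) \<le> poly_norm X N P" if "\<phi> \<in> unit_ball_on dual onorm" for \<phi>
  proof (rule poly_norm_least[OF B])
    fix x assume x: "x \<in> unit_ball_on X N"
    have \<phi>: "\<phi> \<in> dual" "onorm \<phi> \<le> 1" using that by (auto simp: unit_ball_on_def)
    have "norm (\<phi> (P x)) \<le> 1 * norm (P x)"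
      using dualD(7)[OF \<phi>(1), of "P x"] \<phi>(2) mult_right_mono[of "onorm \<phi>" 1 "norm (P x)"] by simp
    also have "\<dots> \<le> poly_norm X N P" using poly_norm_upper[OF B P x] by simp
    finally show "norm (composition_operator P \<phi> x) \<le> poly_norm X N P"
      using \<phi> by (simp add: composition_operator_def)
  qed
  have "(0 :: 'e \<Rightarrow> complex) \<in> dual" by (rule csubspaceD(1)[OF csubspace_dual])
  then have "(0 :: 'e \<Rightarrow> complex) \<in> unit_ball_on dual onorm"
    by (simp add: unit_ball_on_def zero_fun_def onorm_zero)
  then show "eps_norm (poly_norm X N) (composition_operator P) \<le> poly_norm X N P"
    unfolding eps_norm_def by (intro cSUP_least le) auto
  show "poly_norm X N P \<le> eps_norm (poly_norm X N) (composition_operator P)"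
  proof (rule poly_norm_least[OF B])
    fix x assume x: "x \<in> unit_ball_on X N"
    obtain \<phi> where \<phi>: "\<phi> \<in> dual" "onorm \<phi> \<le> 1" "\<phi> (P x) = complex_of_real (norm (P x))"
      using norming_functional by blast
    have "norm (P x) = norm (composition_operator P \<phi> x)"
      using \<phi> by (simp add: composition_operator_def)
    also have "\<dots> \<le> poly_norm X N (composition_operator P \<phi>)"
      using dual_compose_hom_poly[OF \<phi>(1) P] \<phi>(1)
      by (intro poly_norm_upper[OF B _ x]) (simp add: composition_operator_def)
    also have "\<dots> \<le> eps_norm (poly_norm X N) (composition_operator P)"
      unfolding eps_norm_def
      by (rule cSUP_upper) (use \<phi> le in \<open>auto simp: unit_ball_on_def bdd_above_def\<close>)
    finally show "norm (P x) \<le> eps_norm (poly_norm X N) (composition_operator P)" .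
  qed
qed

text \<open>Continuity at 0 turned into the domination that \<open>ell_q_ball_representation\<close>
  asks for, with one sequence z serving all points u of the unit ball.\<close>

lemma L_cp_bound:
  fixes T :: "('e::complex_banach \<Rightarrow> complex) \<Rightarrow> 'f::complex_vector \<Rightarrow> complex"
  assumes q: "conjugate_exponents p q" and B: "complex_banach_on X N"
    and T: "T \<in> L_cp p (hom_poly m X N) (poly_norm X N)"
  shows "\<exists>z\<in>ell_p p. \<forall>\<psi>\<in>dual. \<forall>K. (\<forall>\<alpha>\<in>ell_q_ball q. cmod (\<Sum>n. \<alpha> n * \<psi> (z n)) \<le> K) \<longrightarrow>
           (\<forall>u\<in>unit_ball_on X N. cmod (T \<psi> u) \<le> K)"
proof -
  have p: "1 \<le> p" using q by (simp add: conjugate_exponents_def)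
  define H where "H = (hom_poly m X N :: ('f \<Rightarrow> complex) set)"
  have lin: "clinear_on dual T" and cont: "continuous_map (dual_cp p) (norm_topology H (poly_norm X N)) T"
    using T by (auto simp: L_cp_def H_def)
  interpret M: Metric_space H "norm_dist H (poly_norm X N)"
    unfolding H_def by (rule Metric_space_poly_norm[OF B order_refl])
  have "T ` dual \<subseteq> H"
    using continuous_map_image_subset_topspace[OF cont]
    unfolding topspace_dual_cp[OF p] topspace_norm_topology[OF M.Metric_space_axioms] .
  then have TH: "T \<psi> \<in> H" if "\<psi> \<in> dual" for \<psi>
    using that by (rule subsetD[OF _ imageI])
  have H0: "0 \<in> H" unfolding H_def by (rule csubspaceD(1)[OF csubspace_hom_poly])
  have dual0: "0 \<in> (dual :: ('e \<Rightarrow> complex) set)" by (rule csubspaceD(1)[OF csubspace_dual])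
  have T0: "T 0 = 0" by (rule clinear_on_zero[OF lin csubspace_dual])
  have "openin (dual_cp p) {\<psi> \<in> dual. T \<psi> \<in> M.mball 0 1}"
    using openin_continuous_map_preimage[OF cont, of "M.mball 0 1"]
    unfolding topspace_dual_cp[OF p] norm_topology_def by simp
  moreover have "0 \<in> {\<psi> \<in> dual. T \<psi> \<in> M.mball 0 1}" using dual0 T0 H0 by simp
  ultimately obtain K e where K: "relatively_p_compact p K" and e: "0 < e"
    and sub: "{\<psi> \<in> dual. \<forall>x\<in>K. cmod (\<psi> x - 0 x) < e} \<subseteq> {\<psi> \<in> dual. T \<psi> \<in> M.mball 0 1}"
    using dual_cp_neighbourhood[OF p] by blast
  obtain x where x: "x \<in> ell_p p" "K \<subseteq> closure (ell_q_hull q x)"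
    using K unfolding relatively_p_compact_iff[OF q] by blast
  \<comment> \<open>The nonstrict bound e / 2 on the hull of x passes to the closure and stays below
    the strict bound e required on K. The factor 2 / e in z will turn it into the bound 1.\<close>
  have small: "cmod (T \<psi> u) \<le> 1"
    if \<psi>: "\<psi> \<in> dual" "\<And>v. v \<in> ell_q_hull q x \<Longrightarrow> cmod (\<psi> v) \<le> e / 2" and u: "u \<in> unit_ball_on X N" for \<psi> u
  proof -
    have "closed {v. cmod (\<psi> v) \<le> e / 2}"
      by (intro closed_Collect_le continuous_intros linear_continuous_on dualD \<psi>)
    then have "closure (ell_q_hull q x) \<subseteq> {v. cmod (\<psi> v) \<le> e / 2}"
      using \<psi>(2) by (intro closure_minimal) auto
    then have "cmod (\<psi> v) \<le> e / 2" if "v \<in> K" for v using that x(2) by blast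
    then have "T \<psi> \<in> M.mball 0 1" using sub \<psi>(1) e by force
    then have "poly_norm X N (0 - T \<psi>) < 1" by (simp add: M.mball_def norm_dist_def split: if_splits)
    moreover have "0 - T \<psi> \<in> hom_poly m X N"
      using csubspaceD(4)[OF csubspace_hom_poly] H0 TH[OF \<psi>(1)] unfolding H_def by blast
    from poly_norm_upper[OF B this u]
    have "norm ((0 - T \<psi>) u) \<le> poly_norm X N (0 - T \<psi>)" .
    ultimately show ?thesis by simp
  qed
  define z where "z n = complex_of_real (2 / e) *\<^sub>C x n" for n
  have z: "z \<in> ell_p p" unfolding z_def by (rule ell_p_scaleC[OF p x(1)])
  have "cmod (T \<psi> u) \<le> K"
    if \<psi>: "\<psi> \<in> dual" and K: "\<forall>\<alpha>\<in>ell_q_ball q. cmod (\<Sum>n. \<alpha> n * \<psi> (z n)) \<le> K" and u: "u \<in> unit_ball_on X N" for \<psi> K u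
  proof (rule field_le_epsilon)
    fix d :: real assume d: "0 < d"
    have "0 \<le> K" using K ell_q_ball_zero[OF q] norm_ge_zero order_trans by blast
    then have Kd: "0 < K + d" using d by simp
    have c: "cmod (complex_of_real (1 / (K + d))) = 1 / (K + d)"
      unfolding norm_of_real using Kd by simp
    \<comment> \<open>K may be 0, so \<psi> is divided by K + d; the arbitrary d > 0 is removed by
      \<open>field_le_epsilon\<close>.\<close>
    define \<omega> where "\<omega> = complex_of_real (1 / (K + d)) *\<^sub>C \<psi>"
    have \<omega>: "\<omega> \<in> dual" unfolding \<omega>_def by (rule csubspaceD(3)[OF csubspace_dual \<psi>])
    have "cmod (T \<omega> u) \<le> 1"
    proof (rule small[OF \<omega> _ u])
      fix v assume "v \<in> ell_q_hull q x"
      then obtain \<alpha> where \<alpha>: "\<alpha> \<in> ell_q_ball q" "v = (\<Sum>n. \<alpha> n *\<^sub>C x n)" by (auto simp: ell_q_hull_def)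
      have "summable (\<lambda>n. \<alpha> n * \<psi> (x n))"
        using ell_q_ball_summable[OF q dual_ell_p[OF p x(1) \<psi>] \<alpha>(1)] by (simp add: scaleC_complex_def)
      then have "(\<Sum>n. \<alpha> n * \<psi> (z n)) = complex_of_real (2 / e) * \<psi> v"
        using suminf_mult[of "\<lambda>n. \<alpha> n * \<psi> (x n)" "complex_of_real (2 / e)"]
        by (simp add: dual_suminf[OF q x(1) \<alpha>(1) \<psi>] \<alpha>(2) z_def dualD(4)[OF \<psi>] mult.left_commute)
      then have "2 / e * cmod (\<psi> v) \<le> K" using K \<alpha>(1) e by (force simp: norm_mult norm_divide)
      then have "cmod (\<psi> v) \<le> K * (e / 2)" using e by (simp add: field_simps)
      also have "\<dots> \<le> (K + d) * (e / 2)" using d e by simp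
      finally show "cmod (\<omega> v) \<le> e / 2"
        using Kd unfolding \<omega>_def scaleC_fun_def scaleC_complex_def norm_mult c by (simp add: field_simps)
    qed
    moreover have "T \<omega> u = complex_of_real (1 / (K + d)) * T \<psi> u"
      unfolding \<omega>_def clinear_on_scaleC[OF lin \<psi>] by (simp add: scaleC_fun_def scaleC_complex_def)
    ultimately show "cmod (T \<psi> u) \<le> K + d"
      using Kd by (simp add: norm_mult c field_simps del: of_real_divide of_real_add)
  qed
  with z show ?thesis by blast
qed

lemma composition_operator_surj:
  fixes T :: "('e::complex_banach \<Rightarrow> complex) \<Rightarrow> 'f::complex_vector \<Rightarrow> complex"
  assumes p: "1 \<le> p" and B: "complex_banach_on X N"
    and T: "T \<in> L_cp p (hom_poly m X N) (poly_norm X N)"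
  shows "\<exists>P\<in>p_compact_poly p m X N. composition_operator P = T"
proof -
  obtain q where q: "conjugate_exponents p q" using conjugate_exponents_exists[OF p] by blast
  note X = complex_banach_onD(1)[OF B]
  define H where "H = (hom_poly m X N :: ('f \<Rightarrow> complex) set)"
  have M: "Metric_space H (norm_dist H (poly_norm X N))"
    unfolding H_def by (rule Metric_space_poly_norm[OF B order_refl])
  have lin: "clinear_on dual T" and cont: "continuous_map (dual_cp p) (norm_topology H (poly_norm X N)) T"
    and T_zero: "\<And>\<phi>. \<phi> \<notin> dual \<Longrightarrow> T \<phi> = 0"
    using T by (auto simp: L_cp_def H_def)
  have "T ` dual \<subseteq> H"
    using continuous_map_image_subset_topspace[OF cont]
    unfolding topspace_dual_cp[OF p] topspace_norm_topology[OF M] .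
  then have TH: "T \<psi> \<in> hom_poly m X N" if "\<psi> \<in> dual" for \<psi>
    using that unfolding H_def by (rule subsetD[OF _ imageI])
  obtain z where z: "z \<in> ell_p p" "\<And>\<psi> K u. \<psi> \<in> dual \<Longrightarrow> u \<in> unit_ball_on X N \<Longrightarrow>
      (\<And>\<alpha>. \<alpha> \<in> ell_q_ball q \<Longrightarrow> cmod (\<Sum>n. \<alpha> n * \<psi> (z n)) \<le> K) \<Longrightarrow> cmod (T \<psi> u) \<le> K"
    using L_cp_bound[OF q B T] by blast
  \<comment> \<open>The representing point lies in the hull of z, and z does not depend on u; this
    will make the range of P on the unit ball relatively p-compact.\<close>
  have ball: "\<exists>v\<in>ell_q_hull q z. \<forall>\<psi>\<in>dual. T \<psi> u = \<psi> v" if u: "u \<in> unit_ball_on X N" for u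
  proof -
    have "\<exists>\<alpha>\<in>ell_q_ball q. \<forall>\<psi>\<in>dual. T \<psi> u = (\<Sum>n. \<alpha> n * (\<lambda>n. \<psi> (z n)) n)"
    proof (rule ell_q_ball_representation[OF q csubspace_dual])
      show "clinear_on dual (\<lambda>\<psi> n. \<psi> (z n))"
        by (auto simp: clinear_on_def scaleC_fun_def plus_fun_def)
      show "(\<lambda>n. \<psi> (z n)) \<in> ell_p p" if "\<psi> \<in> dual" for \<psi> by (rule dual_ell_p[OF p z(1) that])
      show "clinear_on dual (\<lambda>\<psi>. T \<psi> u)"
        using lin by (auto simp: clinear_on_def scaleC_fun_def)
    qed (rule z(2)[OF _ u])
    then show ?thesis using dual_suminf[OF q z(1)] by (force simp: ell_q_hull_def)
  qed
  have ex: "\<exists>v. \<forall>\<psi>\<in>dual. T \<psi> u = \<psi> v" if u: "u \<in> X" for u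
  proof -
    \<comment> \<open>N u + 1 instead of N u keeps the scaling factor nonzero at u = 0.\<close>
    have r: "N u \<le> N u + 1" "0 < N u + 1" using complex_banach_onD(2)[OF B u] by auto
    note w = unit_ball_on_rescale[OF B u r]
    obtain v where v: "\<And>\<psi>. \<psi> \<in> dual \<Longrightarrow> T \<psi> (complex_of_real (1 / (N u + 1)) *\<^sub>C u) = \<psi> v"
      using ball[OF w(1)] by blast
    have "T \<psi> u = \<psi> (complex_of_real (N u + 1) ^ m *\<^sub>C v)" if \<psi>: "\<psi> \<in> dual" for \<psi>
    proof -
      have "T \<psi> u = complex_of_real (N u + 1) ^ m *\<^sub>C T \<psi> (complex_of_real (1 / (N u + 1)) *\<^sub>C u)"
        by (subst w(2), rule hom_poly_scale[OF X TH[OF \<psi>]]) (use w(1) in \<open>simp add: unit_ball_on_def\<close>)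
      then show ?thesis using v[OF \<psi>] dualD(4)[OF \<psi>] by (simp add: scaleC_complex_def)
    qed
    then show ?thesis by blast
  qed
  define P where "P u = (if u \<in> X then SOME v. \<forall>\<psi>\<in>dual. T \<psi> u = \<psi> v else 0)" for u
  have P: "\<psi> (P u) = T \<psi> u" if "\<psi> \<in> dual" for \<psi> u
  proof (cases "u \<in> X")
    case True
    then show ?thesis using someI_ex[OF ex[OF True]] that by (simp add: P_def)
  next
    case False
    then show ?thesis using hom_poly_zero[OF TH[OF that] False] dualD(5)[OF that] by (simp add: P_def)
  qed
  have "P ` unit_ball_on X N \<subseteq> ell_q_hull q z"
  proof
    fix w assume "w \<in> P ` unit_ball_on X N"
    then obtain u where u: "u \<in> unit_ball_on X N" "w = P u" by blast
    obtain v where v: "v \<in> ell_q_hull q z" "\<forall>\<psi>\<in>dual. T \<psi> u = \<psi> v" using ball[OF u(1)] by blast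
    have "P u = v" by (rule dual_separates) (simp add: P v)
    with u v show "w \<in> ell_q_hull q z" by simp
  qed
  then have "relatively_p_compact p (P ` unit_ball_on X N)"
    unfolding relatively_p_compact_iff[OF q] using z(1) closure_subset by blast
  then have "P \<in> p_compact_poly p m X N"
  proof (intro weakly_polynomial_p_compact[OF p B])
    show "(\<lambda>x. \<phi> (P x)) \<in> hom_poly m X N" if "\<phi> \<in> dual" for \<phi>
      using TH[OF that] by (simp add: P[OF that])
    show "P x = 0" if "x \<notin> X" for x using that by (simp add: P_def)
  qed
  moreover have "composition_operator P = T"
    by (rule ext) (simp add: composition_operator_def P T_zero)
  ultimately show ?thesis by blast
qed

theorem p_compact_poly_isometric_L_cp:
  assumes p: "1 \<le> p" and B: "complex_banach_on X N"
  shows "isometrically_isomorphic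
    (p_compact_poly p m X N :: ('f::complex_vector \<Rightarrow> 'e::complex_banach) set) (poly_norm X N)
    (L_cp p (hom_poly m X N) (poly_norm X N) :: (('e \<Rightarrow> complex) \<Rightarrow> 'f \<Rightarrow> complex) set)
    (eps_norm (poly_norm X N))"
  unfolding isometrically_isomorphic_def
proof (intro exI conjI ballI)
  show "bij_betw composition_operator
      (p_compact_poly p m X N :: ('f \<Rightarrow> 'e) set) (L_cp p (hom_poly m X N) (poly_norm X N))"
    unfolding bij_betw_def
  proof
    show "inj_on composition_operator (p_compact_poly p m X N :: ('f \<Rightarrow> 'e) set)"
    proof (rule inj_onI, rule ext)
      fix P Q :: "'f \<Rightarrow> 'e" and x assume eq: "composition_operator P = composition_operator Q"
      show "P x = Q x"
      proof (rule dual_separates)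
        fix \<phi> :: "'e \<Rightarrow> complex" assume "\<phi> \<in> dual"
        then show "\<phi> (P x) = \<phi> (Q x)"
          using fun_cong[OF fun_cong[OF eq, of \<phi>], of x] by (simp add: composition_operator_def)
      qed
    qed
    show "composition_operator ` (p_compact_poly p m X N :: ('f \<Rightarrow> 'e) set) = L_cp p (hom_poly m X N) (poly_norm X N)"
      using composition_operator_in_L_cp[OF p B] composition_operator_surj[OF p B] by blast
  qed
  show "clinear_on (p_compact_poly p m X N :: ('f \<Rightarrow> 'e) set) composition_operator"
    by (auto simp: clinear_on_def composition_operator_def fun_eq_iff scaleC_fun_def scaleC_complex_def dualD(3,4))
  show "eps_norm (poly_norm X N) (composition_operator P) = poly_norm X N P"
    if "P \<in> p_compact_poly p m X N" for P :: "'f \<Rightarrow> 'e"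
    by (rule eps_norm_composition_operator[OF B p_compact_polyD(1)[OF that]])
qed

section \<open>The approximation property implies density\<close>

text \<open>A finite-rank operator is needed in coordinates given by bounded functionals on all of
  E, so that composing it with a polynomial gives a sum of scalar polynomials times vectors.\<close>

lemma finite_dim_dual_basis:
  fixes B :: "'e::complex_banach set"
  assumes "finite B"
  shows "\<exists>n \<phi> e. (\<forall>j<n. \<phi> j \<in> dual) \<and> (\<forall>j<n. e j \<in> cspan B) \<and>
    (\<forall>v\<in>cspan B. v = (\<Sum>j<n::nat. \<phi> j v *\<^sub>C e j))"
  using assms
proof (induction B)
  case empty
  show ?case by (intro exI[of _ "0::nat"]) simp
next
  case (insert b B)
  then obtain n \<phi> and e :: "nat \<Rightarrow> 'e" where \<phi>: "\<And>j. j < n \<Longrightarrow> \<phi> j \<in> dual" and e: "\<And>j. j < n \<Longrightarrow> e j \<in> cspan B"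
    and v: "\<And>v. v \<in> cspan B \<Longrightarrow> (\<Sum>j<n. \<phi> j v *\<^sub>C e j) = v" by metis
  define \<pi> where "\<pi> v = (\<Sum>j<n. \<phi> j v *\<^sub>C e j)" for v
  have \<pi>_add: "\<pi> (v + w) = \<pi> v + \<pi> w" for v w
    using \<phi> by (simp add: \<pi>_def dualD(3) scaleC_add_left sum.distrib)
  have \<pi>_scale: "\<pi> (a *\<^sub>C v) = a *\<^sub>C \<pi> v" for a v
    using \<phi> by (simp add: \<pi>_def dualD(4) scaleC_scaleC complex_vector.scale_sum_right)
  have \<pi>B: "\<pi> v \<in> cspan B" for v
    unfolding \<pi>_def using e by (intro complex_vector.span_sum complex_vector.span_scale) auto
  \<comment> \<open>The part of b outside the span of B; \<pi> is a projection onto that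
    span.\<close>
  define w where "w = b - \<pi> b"
  show ?case
  proof (cases "w = 0")
    case True
    then have "b \<in> cspan B" using \<pi>B[of b] by (simp add: w_def)
    then have "cspan (insert b B) = cspan B" by (rule complex_vector.span_redundant)
    with \<phi> e v show ?thesis by (intro exI[of _ n] exI[of _ \<phi>] exI[of _ e]) auto
  next
    case False
    obtain \<psi> where \<psi>: "\<psi> \<in> dual" "\<psi> w = complex_of_real (norm w)" using norming_functional by blast
    \<comment> \<open>This is \<psi> after the complementary projection, normalized: it vanishes on
      the span of B and takes the value 1 at b.\<close>
    define \<omega> where "\<omega> = (1 / complex_of_real (norm w)) *\<^sub>C (\<psi> - (\<Sum>j<n. \<psi> (e j) *\<^sub>C \<phi> j))"
    have \<omega>_dual: "\<omega> \<in> dual"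
      unfolding \<omega>_def
      by (intro csubspaceD(3)[OF csubspace_dual] csubspaceD(4)[OF csubspace_dual] csubspace_sum[OF csubspace_dual])
         (use \<phi> \<psi> in auto)
    have \<omega>: "\<omega> v = \<psi> (v - \<pi> v) / complex_of_real (norm w)" for v
      by (simp add: \<omega>_def scaleC_fun_def scaleC_complex_def sum_fun_apply \<pi>_def dualD[OF \<psi>(1)] mult.commute)
    have \<omega>B: "\<omega> s = 0" if "s \<in> cspan B" for s
      using v[OF that] dualD(5)[OF \<psi>(1)] by (simp add: \<omega> \<pi>_def)
    have \<omega>b: "\<omega> b = 1" using \<psi>(2) False by (simp add: \<omega> flip: w_def)
    define \<phi>' where "\<phi>' = \<phi>(n := \<omega>)"
    define e' where "e' = e(n := w)"
    have sum: "(\<Sum>j<Suc n. \<phi>' j v *\<^sub>C e' j) = \<pi> v + \<omega> v *\<^sub>C w" for v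
      by (simp add: \<phi>'_def e'_def \<pi>_def)
    have "v = (\<Sum>j<Suc n. \<phi>' j v *\<^sub>C e' j)" if vB: "v \<in> cspan (insert b B)" for v
    proof -
      obtain k where k: "v - k *\<^sub>C b \<in> cspan B" using vB unfolding complex_vector.span_insert by blast
      define s where "s = v - k *\<^sub>C b"
      have s: "s \<in> cspan B" using k by (simp add: s_def)
      have vs: "v = s + k *\<^sub>C b" by (simp add: s_def)
      have "\<pi> v = s + k *\<^sub>C \<pi> b" unfolding vs \<pi>_add \<pi>_scale using v[OF s] by (simp add: \<pi>_def)
      moreover have "\<omega> v = k" unfolding vs using \<omega>B[OF s] \<omega>b dualD(3,4)[OF \<omega>_dual] by simp
      ultimately have "\<pi> v + \<omega> v *\<^sub>C w = s + k *\<^sub>C (\<pi> b + w)" by (simp add: scaleC_add_right)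
      also have "\<pi> b + w = b" by (simp add: w_def)
      finally show ?thesis using sum[of v] vs by simp
    qed
    moreover have "\<phi>' j \<in> dual" if "j < Suc n" for j using that \<phi> \<omega>_dual by (auto simp: \<phi>'_def less_Suc_eq)
    moreover have "e' j \<in> cspan (insert b B)" if "j < Suc n" for j
    proof -
      have mono: "cspan B \<subseteq> cspan (insert b B)" by (rule complex_vector.span_mono) auto
      then have "w \<in> cspan (insert b B)"
        using \<pi>B[of b] unfolding w_def
        by (intro complex_vector.span_diff complex_vector.span_base[OF insertI1]) auto
      with mono show ?thesis using that e by (auto simp: e'_def less_Suc_eq)
    qed
    ultimately show ?thesis by blast
  qed
qed

lemma ell_q_ballI_ell_1:
  assumes q: "conjugate_exponents p q" and le: "\<And>N. (\<Sum>n<N. cmod (\<alpha> n)) \<le> 1"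
  shows "\<alpha> \<in> ell_q_ball q"
proof -
  have le1: "cmod (\<alpha> n) \<le> 1" for n
  proof -
    have "cmod (\<alpha> n) \<le> (\<Sum>k<Suc n. cmod (\<alpha> k))" by (simp add: sum_nonneg)
    with le[of "Suc n"] show ?thesis by linarith
  qed
  show ?thesis
    using q
  proof (cases rule: conjugate_exponents_cases)
    case 1
    with le1 show ?thesis by (simp add: ell_q_ball_infinity_iff)
  next
    case (2 r)
    have "cmod (\<alpha> n) powr r \<le> cmod (\<alpha> n)" for n
      using powr_mono'[of 1 r "cmod (\<alpha> n)"] le1[of n] \<open>1 < r\<close> by simp
    then have "(\<Sum>n<N. cmod (\<alpha> n) powr r) \<le> 1" for N
      by (intro order_trans[OF sum_mono le]) auto
    with \<open>1 < r\<close> show ?thesis unfolding \<open>q = ereal r\<close> by (simp add: ell_q_ball_real_iff)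
  qed
qed

lemma poly_tensor_subset:
  fixes X :: "'f::complex_vector set"
  assumes p: "1 \<le> p" and B: "complex_banach_on X N"
  shows "(poly_tensor m X N :: ('f \<Rightarrow> 'e::complex_banach) set) \<subseteq> p_compact_poly p m X N"
proof
  fix R :: "'f \<Rightarrow> 'e" assume "R \<in> poly_tensor m X N"
  then obtain n Q and e :: "nat \<Rightarrow> 'e" where R: "R = (\<lambda>x. \<Sum>j<n. Q j x *\<^sub>C e j)" and Q: "\<And>j. j < n \<Longrightarrow> Q j \<in> hom_poly m X N"
    by (auto simp: poly_tensor_def)
  have "(\<lambda>x. Q j x *\<^sub>C e j) \<in> hom_poly m X N" if "j < n" for j
  proof (rule hom_poly_compose[OF _ Q[OF that]])
    show "bounded_clinear (\<lambda>c. c *\<^sub>C e j)"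
      using bounded_linear_scaleC_left
      by (auto simp: bounded_clinear_def clinear_on_def scaleC_add_left scaleC_scaleC scaleC_complex_def)
  qed
  then have "(\<Sum>j<n. (\<lambda>x. Q j x *\<^sub>C e j)) \<in> hom_poly m X N"
    by (intro csubspace_sum[OF csubspace_hom_poly]) auto
  moreover have "R = (\<Sum>j<n. (\<lambda>x. Q j x *\<^sub>C e j))" by (simp add: R fun_eq_iff sum_fun_apply)
  ultimately have Rhom: "R \<in> hom_poly m X N" by simp
  have "\<exists>C. \<forall>x\<in>unit_ball_on X N. cmod (Q j x) \<le> C" if "j < n" for j
    using hom_poly_bounded[OF B Q[OF that]] by simp
  then obtain C where C: "\<And>j x. j < n \<Longrightarrow> x \<in> unit_ball_on X N \<Longrightarrow> cmod (Q j x) \<le> C j" by metis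
  \<comment> \<open>c dominates the sum of all bounds, so the multipliers \<open>Q k x / c\<close>
    have l_1 norm at most 1 and lie in the ball whatever q is; the summand 1 keeps c
    positive.\<close>
  define c where "c = 1 + (\<Sum>j<n. C j)"
  have "0 \<le> C j" if "j < n" for j
    by (rule order_trans[OF norm_ge_zero C[OF that unit_ball_on_zero[OF B]]])
  then have c: "1 \<le> c" by (auto simp: c_def intro!: sum_nonneg)
  obtain q where q: "conjugate_exponents p q" using conjugate_exponents_exists[OF p] by blast
  define z where "z k = (if k < n then complex_of_real c *\<^sub>C e k else 0)" for k
  have z: "z \<in> ell_p p"
    unfolding ell_p_def mem_Collect_eq by (rule summable_finite[of "{..<n}"]) (auto simp: z_def)
  have "R ` unit_ball_on X N \<subseteq> ell_q_hull q z"
  proof (rule image_subsetI)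
    fix x assume x: "x \<in> unit_ball_on X N"
    define \<alpha> where "\<alpha> k = (if k < n then Q k x / complex_of_real c else 0)" for k
    have "(\<Sum>k<M. cmod (\<alpha> k)) \<le> 1" for M
    proof -
      have "(\<Sum>k<M. cmod (\<alpha> k)) = (\<Sum>k\<in>{..<M}\<inter>{..<n}. cmod (\<alpha> k))"
        by (intro sum.mono_neutral_right) (auto simp: \<alpha>_def)
      also have "\<dots> \<le> (\<Sum>k<n. cmod (\<alpha> k))" by (intro sum_mono2) auto
      also have "\<dots> \<le> (\<Sum>k<n. C k / c)"
        using C[OF _ x] c by (intro sum_mono) (simp add: \<alpha>_def norm_divide divide_right_mono)
      also have "\<dots> \<le> 1" using c by (simp add: c_def flip: sum_divide_distrib)
      finally show ?thesis .
    qed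
    then have "\<alpha> \<in> ell_q_ball q" by (rule ell_q_ballI_ell_1[OF q])
    moreover have "(\<Sum>k. \<alpha> k *\<^sub>C z k) = R x"
      using c by (subst suminf_finite[of "{..<n}"]) (auto simp: \<alpha>_def z_def R scaleC_scaleC)
    ultimately show "R x \<in> ell_q_hull q z" unfolding ell_q_hull_def by force
  qed
  then have "relatively_p_compact p (R ` unit_ball_on X N)"
    unfolding relatively_p_compact_iff[OF q] using z closure_subset by blast
  with Rhom show "R \<in> p_compact_poly p m X N" by (simp add: p_compact_poly_def)
qed

lemma approximation_property_imp_dense:
  fixes X :: "'f::complex_vector set"
  assumes p: "1 \<le> p" and B: "complex_banach_on X N" and ap: "p_approximation_property p TYPE('e::complex_banach)"
  shows "norm_dense_in (poly_tensor m X N) (p_compact_poly p m X N :: ('f \<Rightarrow> 'e) set) (poly_norm X N)"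
proof -
  define Y where "Y = (p_compact_poly p m X N :: ('f \<Rightarrow> 'e) set)"
  have M: "Metric_space Y (norm_dist Y (poly_norm X N))"
    unfolding Y_def by (rule Metric_space_poly_norm[OF B]) (auto simp: p_compact_poly_def)
  have sub: "poly_tensor m X N \<subseteq> Y" unfolding Y_def by (rule poly_tensor_subset[OF p B])
  have "\<exists>R\<in>poly_tensor m X N \<inter> Y. poly_norm X N (P - R) < r" if P: "P \<in> Y" and r: "0 < r" for P r
  proof -
    note P = p_compact_polyD[OF P[unfolded Y_def]]
    have "p_compact p (closure (P ` unit_ball_on X N))" by (rule p_compact_closure[OF P(2)])
    moreover have "0 < r / 2" using r by simp
    ultimately obtain T S where T: "bounded_clinear T" "finite S" "range T \<subseteq> cspan S"
      "\<forall>x\<in>closure (P ` unit_ball_on X N). norm (T x - x) < r / 2"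
      using ap unfolding p_approximation_property_def by meson
    obtain n \<phi> and e :: "nat \<Rightarrow> 'e" where \<phi>: "\<And>j. j < n \<Longrightarrow> \<phi> j \<in> dual"
      "\<And>v. v \<in> cspan S \<Longrightarrow> v = (\<Sum>j<n. \<phi> j v *\<^sub>C e j)"
      using finite_dim_dual_basis[OF T(2)] by blast
    define R where "R x = T (P x)" for x
    have "R = (\<lambda>x. \<Sum>j<n. \<phi> j (T (P x)) *\<^sub>C e j)"
      using \<phi>(2) T(3) unfolding R_def by blast
    moreover have "(\<lambda>x. \<phi> j (T (P x))) \<in> hom_poly m X N" if "j < n" for j
      by (rule dual_compose_hom_poly[OF \<phi>(1)[OF that] hom_poly_compose[OF T(1) P(1)]])
    ultimately have "R \<in> poly_tensor m X N"
      unfolding poly_tensor_def mem_Collect_eq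
      by (intro exI[of _ n] exI[of _ "\<lambda>j x. \<phi> j (T (P x))"] exI[of _ e]) auto
    moreover have "poly_norm X N (P - R) \<le> r / 2"
    proof (rule poly_norm_least[OF B])
      fix x assume "x \<in> unit_ball_on X N"
      then have "P x \<in> closure (P ` unit_ball_on X N)" by (rule subsetD[OF closure_subset imageI])
      then have "norm (T (P x) - P x) < r / 2" using T(4) by blast
      then show "norm ((P - R) x) \<le> r / 2" by (simp add: R_def norm_minus_commute)
    qed
    ultimately show ?thesis using sub r by (intro bexI[of _ R]) auto
  qed
  then have "norm_topology Y (poly_norm X N) closure_of poly_tensor m X N = Y"
    unfolding closure_of_norm_topology[OF M] by blast
  with sub show ?thesis by (simp add: norm_dense_in_def Y_def)
qed

section \<open>Gauge spaces\<close>

lemma complex_banach_onI: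
  assumes "csubspace X" "\<And>x. x \<in> X \<Longrightarrow> 0 \<le> N x" "\<And>x. x \<in> X \<Longrightarrow> N x = 0 \<longleftrightarrow> x = 0"
    "\<And>x a. x \<in> X \<Longrightarrow> N (a *\<^sub>C x) = cmod a * N x" "\<And>x y. x \<in> X \<Longrightarrow> y \<in> X \<Longrightarrow> N (x + y) \<le> N x + N y"
    and complete: "\<And>\<sigma> :: nat \<Rightarrow> 'a. (\<And>n. \<sigma> n \<in> X) \<Longrightarrow> (\<And>e. 0 < e \<Longrightarrow> \<exists>k. \<forall>m\<ge>k. \<forall>n\<ge>k. N (\<sigma> m - \<sigma> n) < e) \<Longrightarrow>
      \<exists>x\<in>X. \<forall>e>0. \<exists>k. \<forall>n\<ge>k. N (\<sigma> n - x) < e"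
  shows "complex_banach_on (X :: 'a::complex_vector set) N"
proof -
  have M: "Metric_space X (norm_dist X N)" by (rule Metric_space_of_norm) (use assms in auto)
  interpret Metric_space X "norm_dist X N" by (rule M)
  have mcomplete
    unfolding mcomplete_def
  proof (intro allI impI)
    fix \<sigma> :: "nat \<Rightarrow> 'a" assume "MCauchy \<sigma>"
    then have \<sigma>: "\<And>n. \<sigma> n \<in> X" "\<And>e. 0 < e \<Longrightarrow> \<exists>k. \<forall>m\<ge>k. \<forall>n\<ge>k. N (\<sigma> m - \<sigma> n) < e"
      unfolding MCauchy_def norm_dist_def by (auto simp: image_subset_iff)
    then obtain x where x: "x \<in> X" "\<forall>e>0. \<exists>k. \<forall>n\<ge>k. N (\<sigma> n - x) < e"
      using complete by blast
    then have "limitin mtopology \<sigma> x sequentially"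
      unfolding limit_metric_sequentially using \<sigma>(1) by (auto simp: norm_dist_def)
    then show "\<exists>x. limitin mtopology \<sigma> x sequentially" by blast
  qed
  with assms show ?thesis by (auto simp: complex_banach_on_def)
qed

text \<open>For an absolutely convex D this is the linear span of D; membership is written with the
  positive r over which the gauge takes its infimum.\<close>

definition gauge_span :: "'e::complex_banach set \<Rightarrow> 'e set" where
  "gauge_span D = {x. \<exists>r>0. complex_of_real (1 / r) *\<^sub>C x \<in> D}"

lemma gauge_span_memI: "0 < r \<Longrightarrow> complex_of_real (1 / r) *\<^sub>C x \<in> D \<Longrightarrow> x \<in> gauge_span D"
  by (auto simp: gauge_span_def)

definition gauge_norm :: "'e::complex_banach set \<Rightarrow> 'e \<Rightarrow> real" where
  "gauge_norm D x = Inf {r. 0 < r \<and> complex_of_real (1 / r) *\<^sub>C x \<in> D}"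

text \<open>Closedness makes D the closed unit ball of its gauge, boundedness makes the gauge a norm
  that dominates a multiple of the norm of E, and together they yield completeness.\<close>

definition banach_disc :: "'e::complex_banach set \<Rightarrow> bool" where
  "banach_disc D \<longleftrightarrow> closed D \<and> bounded D \<and> D \<noteq> {} \<and>
     (\<forall>u\<in>D. \<forall>v\<in>D. \<forall>a b. cmod a + cmod b \<le> 1 \<longrightarrow> a *\<^sub>C u + b *\<^sub>C v \<in> D)"

context
  fixes D :: "'e::complex_banach set"
  assumes D: "banach_disc D"
begin

lemma disc_comb: "u \<in> D \<Longrightarrow> v \<in> D \<Longrightarrow> cmod a + cmod b \<le> 1 \<Longrightarrow> a *\<^sub>C u + b *\<^sub>C v \<in> D"
  using D by (auto simp: banach_disc_def)

lemma disc_scale: "u \<in> D \<Longrightarrow> cmod a \<le> 1 \<Longrightarrow> a *\<^sub>C u \<in> D"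
  using disc_comb[of u u a 0] by simp

lemma disc_zero: "0 \<in> D"
proof -
  obtain u where "u \<in> D" using D by (auto simp: banach_disc_def)
  then show ?thesis using disc_scale[of u 0] by simp
qed

lemma disc_rescale:
  assumes "complex_of_real (1 / r) *\<^sub>C x \<in> D" "0 < r" "r \<le> s"
  shows "complex_of_real (1 / s) *\<^sub>C x \<in> D"
proof -
  have "complex_of_real (r / s) *\<^sub>C complex_of_real (1 / r) *\<^sub>C x \<in> D"
  proof (rule disc_scale[OF assms(1)])
    show "cmod (complex_of_real (r / s)) \<le> 1" unfolding norm_of_real using assms by simp
  qed
  moreover have "complex_of_real (r / s) * complex_of_real (1 / r) = complex_of_real (1 / s)"
    using assms by simp
  ultimately show ?thesis by (simp only: scaleC_scaleC)
qed

text \<open>For every s > r the point x / s lies in D, and closedness of D gives the same for r: the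
  infimum defining the gauge is attained whenever it is positive.\<close>

lemma gauge_norm_le_iff:
  assumes x: "x \<in> gauge_span D" and r: "0 < r"
  shows "gauge_norm D x \<le> r \<longleftrightarrow> complex_of_real (1 / r) *\<^sub>C x \<in> D"
proof
  assume "complex_of_real (1 / r) *\<^sub>C x \<in> D"
  then show "gauge_norm D x \<le> r"
    unfolding gauge_norm_def using r by (intro cInf_lower bdd_belowI[of _ 0]) auto
next
  assume le: "gauge_norm D x \<le> r"
  have in_D: "complex_of_real (1 / s) *\<^sub>C x \<in> D" if "r < s" for s
  proof -
    have "{r. 0 < r \<and> complex_of_real (1 / r) *\<^sub>C x \<in> D} \<noteq> {}" using x by (auto simp: gauge_span_def)
    moreover have "Inf {r. 0 < r \<and> complex_of_real (1 / r) *\<^sub>C x \<in> D} < s"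
      using le that by (simp add: gauge_norm_def)
    ultimately have "\<exists>t\<in>{r. 0 < r \<and> complex_of_real (1 / r) *\<^sub>C x \<in> D}. t < s"
      by (rule cInf_lessD)
    then obtain t where "0 < t" "complex_of_real (1 / t) *\<^sub>C x \<in> D" "t < s"
      by (elim bexE CollectE conjE)
    then show ?thesis using disc_rescale[of t x s] by simp
  qed
  have lim: "(\<lambda>n. complex_of_real (1 / (r + 1 / real (Suc n))) *\<^sub>C x) \<longlonglongrightarrow> complex_of_real (1 / (r + 0)) *\<^sub>C x"
    using r by (intro bounded_linear.tendsto[OF bounded_linear_scaleC_left] tendsto_intros LIMSEQ_Suc[OF lim_1_over_n]) auto
  have closed: "closed D" using D by (simp add: banach_disc_def)
  have "complex_of_real (1 / (r + 0)) *\<^sub>C x \<in> D"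
    by (rule closed_sequentially[OF closed _ lim]) (rule in_D, simp)
  then show "complex_of_real (1 / r) *\<^sub>C x \<in> D" by simp
qed

lemma gauge_norm_nonneg: "x \<in> gauge_span D \<Longrightarrow> 0 \<le> gauge_norm D x"
  unfolding gauge_norm_def by (rule cInf_greatest) (auto simp: gauge_span_def)

lemma gauge_norm_less: "x \<in> gauge_span D \<Longrightarrow> gauge_norm D x < r \<Longrightarrow> complex_of_real (1 / r) *\<^sub>C x \<in> D"
  using gauge_norm_nonneg gauge_norm_le_iff[of x r] by fastforce

lemma gauge_add:
  assumes "0 < r" "complex_of_real (1 / r) *\<^sub>C x \<in> D" "0 < s" "complex_of_real (1 / s) *\<^sub>C y \<in> D"
  shows "complex_of_real (1 / (r + s)) *\<^sub>C (x + y) \<in> D"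
proof -
  have "complex_of_real (r / (r + s)) *\<^sub>C complex_of_real (1 / r) *\<^sub>C x
      + complex_of_real (s / (r + s)) *\<^sub>C complex_of_real (1 / s) *\<^sub>C y \<in> D"
  proof (rule disc_comb[OF assms(2,4)])
    have c: "cmod (complex_of_real (r / (r + s))) = r / (r + s)" "cmod (complex_of_real (s / (r + s))) = s / (r + s)"
      unfolding norm_of_real using assms by auto
    show "cmod (complex_of_real (r / (r + s))) + cmod (complex_of_real (s / (r + s))) \<le> 1"
      unfolding c using assms by (simp add: field_simps)
  qed
  moreover have "complex_of_real (r / (r + s)) * complex_of_real (1 / r) = complex_of_real (1 / (r + s))"
    "complex_of_real (s / (r + s)) * complex_of_real (1 / s) = complex_of_real (1 / (r + s))"
    unfolding of_real_mult[symmetric] using assms by simp_all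
  ultimately show ?thesis by (simp only: scaleC_scaleC scaleC_add_right)
qed

lemma gauge_scale:
  assumes "0 < r" "complex_of_real (1 / r) *\<^sub>C x \<in> D" "a \<noteq> 0"
  shows "complex_of_real (1 / (cmod a * r)) *\<^sub>C a *\<^sub>C x \<in> D"
proof -
  have "(a / complex_of_real (cmod a)) *\<^sub>C complex_of_real (1 / r) *\<^sub>C x \<in> D"
    using assms(3) by (intro disc_scale[OF assms(2)]) (simp add: norm_divide)
  then show ?thesis using assms by (simp add: scaleC_scaleC mult.commute)
qed

lemma csubspace_gauge_span: "csubspace (gauge_span D)"
proof (rule complex_vector.subspaceI)
  show "0 \<in> gauge_span D" using disc_zero by (intro gauge_span_memI[of 1]) auto
  show "x + y \<in> gauge_span D" if xy: "x \<in> gauge_span D" "y \<in> gauge_span D" for x y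
  proof -
    obtain r s where "0 < r" "complex_of_real (1 / r) *\<^sub>C x \<in> D" "0 < s" "complex_of_real (1 / s) *\<^sub>C y \<in> D"
      using xy by (auto simp: gauge_span_def)
    then show ?thesis by (intro gauge_span_memI[of "r + s"] gauge_add) auto
  qed
  show "a *\<^sub>C x \<in> gauge_span D" if x: "x \<in> gauge_span D" for a x
  proof (cases "a = 0")
    case True
    then show ?thesis using disc_zero by (intro gauge_span_memI[of 1]) auto
  next
    case False
    obtain r where "0 < r" "complex_of_real (1 / r) *\<^sub>C x \<in> D" using x by (auto simp: gauge_span_def)
    then show ?thesis using False by (intro gauge_span_memI[of "cmod a * r"] gauge_scale) auto
  qed
qed

lemma gauge_norm_triangle:
  assumes x: "x \<in> gauge_span D" and y: "y \<in> gauge_span D"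
  shows "gauge_norm D (x + y) \<le> gauge_norm D x + gauge_norm D y"
proof (rule field_le_epsilon)
  fix e :: real assume e: "0 < e"
  define r where "r = gauge_norm D x + e / 2"
  define s where "s = gauge_norm D y + e / 2"
  have pos: "0 < r" "0 < s"
    using e gauge_norm_nonneg[OF x] gauge_norm_nonneg[OF y] by (auto simp: r_def s_def)
  have "complex_of_real (1 / (r + s)) *\<^sub>C (x + y) \<in> D"
    using e by (intro gauge_add pos gauge_norm_less x y) (auto simp: r_def s_def)
  then have "gauge_norm D (x + y) \<le> r + s"
    using pos gauge_norm_le_iff[OF csubspaceD(2)[OF csubspace_gauge_span x y], of "r + s"] by simp
  then show "gauge_norm D (x + y) \<le> gauge_norm D x + gauge_norm D y + e" by (simp add: r_def s_def)
qed

lemma gauge_norm_scale_le: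
  assumes x: "x \<in> gauge_span D" and a: "a \<noteq> 0"
  shows "gauge_norm D (a *\<^sub>C x) \<le> cmod a * gauge_norm D x"
proof (rule field_le_epsilon)
  fix e :: real assume e: "0 < e"
  define r where "r = gauge_norm D x + e / cmod a"
  have r: "0 < r" using e a gauge_norm_nonneg[OF x] by (simp add: r_def add_nonneg_pos)
  have "complex_of_real (1 / (cmod a * r)) *\<^sub>C a *\<^sub>C x \<in> D"
    using e a r x by (intro gauge_scale gauge_norm_less) (auto simp: r_def)
  then have "gauge_norm D (a *\<^sub>C x) \<le> cmod a * r"
    using gauge_norm_le_iff[OF csubspaceD(3)[OF csubspace_gauge_span x], of "cmod a * r" a] a r by simp
  also have "\<dots> = cmod a * gauge_norm D x + e" using a by (simp add: r_def distrib_left)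
  finally show "gauge_norm D (a *\<^sub>C x) \<le> cmod a * gauge_norm D x + e" .
qed

lemma gauge_norm_zero: "gauge_norm D 0 = 0"
proof (rule antisym)
  show "gauge_norm D 0 \<le> 0"
  proof (rule field_le_epsilon)
    show "gauge_norm D 0 \<le> 0 + e" if "0 < e" for e
      using gauge_norm_le_iff[OF csubspaceD(1)[OF csubspace_gauge_span] that] disc_zero by simp
  qed
qed (rule gauge_norm_nonneg[OF csubspaceD(1)[OF csubspace_gauge_span]])

lemma gauge_norm_scale:
  assumes x: "x \<in> gauge_span D"
  shows "gauge_norm D (a *\<^sub>C x) = cmod a * gauge_norm D x"
proof (cases "a = 0")
  case False
  have "gauge_norm D ((1 / a) *\<^sub>C a *\<^sub>C x) \<le> cmod (1 / a) * gauge_norm D (a *\<^sub>C x)"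
    using False by (intro gauge_norm_scale_le csubspaceD(3)[OF csubspace_gauge_span x]) auto
  moreover have "(1 / a) *\<^sub>C a *\<^sub>C x = x" using False by (simp add: scaleC_scaleC scaleC_one)
  ultimately have "cmod a * gauge_norm D x \<le> gauge_norm D (a *\<^sub>C x)"
    using False by (simp add: norm_divide field_simps)
  with gauge_norm_scale_le[OF x False] show ?thesis by simp
qed (simp add: gauge_norm_zero)

lemma norm_le_gauge_norm: "\<exists>C>0. \<forall>x\<in>gauge_span D. norm x \<le> C * gauge_norm D x"
proof -
  obtain C where C: "0 < C" "\<And>x. x \<in> D \<Longrightarrow> norm x \<le> C"
    using D unfolding banach_disc_def bounded_pos by blast
  have "norm x \<le> C * gauge_norm D x" if x: "x \<in> gauge_span D" for x
  proof (rule field_le_epsilon)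
    fix e :: real assume e: "0 < e"
    define r where "r = gauge_norm D x + e / C"
    have r: "0 < r" using e C gauge_norm_nonneg[OF x] by (simp add: r_def add_nonneg_pos)
    have "complex_of_real (1 / r) *\<^sub>C x \<in> D" using e C by (intro gauge_norm_less x) (simp add: r_def)
    then have "norm (complex_of_real (1 / r) *\<^sub>C x) \<le> C" by (rule C(2))
    then have "norm x \<le> C * r" unfolding norm_scaleC norm_of_real using r by (simp add: field_simps)
    also have "\<dots> = C * gauge_norm D x + e" using C by (simp add: r_def distrib_left)
    finally show "norm x \<le> C * gauge_norm D x + e" .
  qed
  with C(1) show ?thesis by blast
qed

lemma gauge_norm_eq_0_iff:
  assumes "x \<in> gauge_span D"
  shows "gauge_norm D x = 0 \<longleftrightarrow> x = 0"
proof
  obtain C where C: "0 < C" "\<forall>x\<in>gauge_span D. norm x \<le> C * gauge_norm D x"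
    using norm_le_gauge_norm by blast
  assume "gauge_norm D x = 0"
  with C(2) assms show "x = 0" by fastforce
qed (simp add: gauge_norm_zero)

text \<open>A gauge-Cauchy sequence is Cauchy in E, which supplies the limit. For fixed m the gauge
  estimate for \<open>\<sigma> m - \<sigma> n\<close> is membership in a multiple of the closed set
  D and so passes to the limit in n.\<close>

lemma gauge_norm_complete:
  fixes \<sigma> :: "nat \<Rightarrow> 'e"
  assumes \<sigma>: "\<And>n. \<sigma> n \<in> gauge_span D"
    and cauchy: "\<And>e. 0 < e \<Longrightarrow> \<exists>k. \<forall>m\<ge>k. \<forall>n\<ge>k. gauge_norm D (\<sigma> m - \<sigma> n) < e"
  shows "\<exists>x\<in>gauge_span D. \<forall>e>0. \<exists>k. \<forall>n\<ge>k. gauge_norm D (\<sigma> n - x) < e"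
proof -
  obtain C where C: "0 < C" "\<And>x. x \<in> gauge_span D \<Longrightarrow> norm x \<le> C * gauge_norm D x"
    using norm_le_gauge_norm by blast
  have diff: "\<sigma> m - \<sigma> n \<in> gauge_span D" for m n using \<sigma> csubspace_gauge_span by (simp add: csubspaceD)
  have "Cauchy \<sigma>"
    unfolding Cauchy_def dist_norm
  proof (intro allI impI)
    fix e :: real assume "0 < e"
    then obtain k where k: "\<And>m n. m \<ge> k \<Longrightarrow> n \<ge> k \<Longrightarrow> gauge_norm D (\<sigma> m - \<sigma> n) < e / C"
      using cauchy[of "e / C"] C(1) by auto
    have "norm (\<sigma> m - \<sigma> n) < e" if "m \<ge> k" "n \<ge> k" for m n
      using C(2)[OF diff] k[OF that] C(1) by (smt (verit) mult.commute pos_less_divide_eq)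
    then show "\<exists>k. \<forall>m\<ge>k. \<forall>n\<ge>k. norm (\<sigma> m - \<sigma> n) < e" by blast
  qed
  then obtain x where x: "\<sigma> \<longlonglongrightarrow> x" using Cauchy_convergent_iff convergent_def by blast
  have closed: "closed D" using D by (simp add: banach_disc_def)
  have main: "\<exists>k. \<forall>m\<ge>k. complex_of_real (1 / e) *\<^sub>C (\<sigma> m - x) \<in> D" if e: "0 < e" for e
  proof -
    obtain k where k: "\<And>m n. m \<ge> k \<Longrightarrow> n \<ge> k \<Longrightarrow> gauge_norm D (\<sigma> m - \<sigma> n) < e"
      using cauchy[OF e] by blast
    have "complex_of_real (1 / e) *\<^sub>C (\<sigma> m - x) \<in> D" if m: "m \<ge> k" for m
    proof -
      have lim: "(\<lambda>n. complex_of_real (1 / e) *\<^sub>C (\<sigma> m - \<sigma> (n + k))) \<longlonglongrightarrow> complex_of_real (1 / e) *\<^sub>C (\<sigma> m - x)"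
        by (intro bounded_linear.tendsto[OF bounded_linear_scaleC_right] tendsto_intros LIMSEQ_ignore_initial_segment x)
      show ?thesis
      proof (rule closed_sequentially[OF closed _ lim])
        show "complex_of_real (1 / e) *\<^sub>C (\<sigma> m - \<sigma> (n + k)) \<in> D" for n
          by (rule gauge_norm_less[OF diff k]) (use m in auto)
      qed
    qed
    then show ?thesis by blast
  qed
  have xin: "x \<in> gauge_span D"
  proof -
    obtain k where "complex_of_real (1 / 1) *\<^sub>C (\<sigma> k - x) \<in> D" using main[of 1] by auto
    then have "\<sigma> k - x \<in> gauge_span D" by (intro gauge_span_memI[of 1]) auto
    then have "\<sigma> k - (\<sigma> k - x) \<in> gauge_span D" by (rule csubspaceD(4)[OF csubspace_gauge_span \<sigma>])
    then show ?thesis by simp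
  qed
  moreover have "\<exists>k. \<forall>n\<ge>k. gauge_norm D (\<sigma> n - x) < e" if e: "0 < e" for e
  proof -
    obtain k where k: "\<And>m. m \<ge> k \<Longrightarrow> complex_of_real (1 / (e / 2)) *\<^sub>C (\<sigma> m - x) \<in> D"
      using main[of "e / 2"] e by auto
    have "gauge_norm D (\<sigma> m - x) \<le> e / 2" if "m \<ge> k" for m
      using gauge_norm_le_iff[OF csubspaceD(4)[OF csubspace_gauge_span \<sigma> xin], of "e / 2" m] k[OF that] e by simp
    then have "gauge_norm D (\<sigma> m - x) < e" if "m \<ge> k" for m using that e by (fastforce intro: le_less_trans)
    then show ?thesis by blast
  qed
  ultimately show ?thesis by blast
qed

text \<open>The factor {0} moves the gauge space into the type \<open>'e \<times> 'f\<close>, over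
  whose subspaces the density criterion quantifies.\<close>

lemma complex_banach_on_gauge:
  "complex_banach_on (gauge_span D \<times> {0 :: 'f::complex_vector}) (\<lambda>x. gauge_norm D (fst x))"
proof (rule complex_banach_onI)
  show "csubspace (gauge_span D \<times> {0 :: 'f})"
    by (rule complex_vector.subspaceI)
       (use csubspaceD[OF csubspace_gauge_span] in \<open>auto simp: scaleC_prod_def zero_prod_def\<close>)
next
  fix \<sigma> :: "nat \<Rightarrow> 'e \<times> 'f"
  assume \<sigma>: "\<And>n. \<sigma> n \<in> gauge_span D \<times> {0}"
    and cauchy: "\<And>e. 0 < e \<Longrightarrow> \<exists>k. \<forall>m\<ge>k. \<forall>n\<ge>k. gauge_norm D (fst (\<sigma> m - \<sigma> n)) < e"
  have "\<exists>x\<in>gauge_span D. \<forall>e>0. \<exists>k. \<forall>n\<ge>k. gauge_norm D (fst (\<sigma> n) - x) < e"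
    using cauchy \<sigma> by (intro gauge_norm_complete) (auto simp: mem_Times_iff)
  then obtain x where "x \<in> gauge_span D" "\<forall>e>0. \<exists>k. \<forall>n\<ge>k. gauge_norm D (fst (\<sigma> n) - x) < e"
    by blast
  then show "\<exists>x\<in>gauge_span D \<times> {0}. \<forall>e>0. \<exists>k. \<forall>n\<ge>k. gauge_norm D (fst (\<sigma> n - x)) < e"
    by (intro bexI[of _ "(x, 0)"]) auto
qed (auto simp: gauge_norm_nonneg gauge_norm_eq_0_iff gauge_norm_scale gauge_norm_triangle scaleC_prod_def prod_eq_iff)

lemma unit_ball_on_gauge:
  "unit_ball_on (gauge_span D \<times> {0 :: 'f::complex_vector}) (\<lambda>x. gauge_norm D (fst x)) = D \<times> {0}"
proof -
  have "gauge_norm D x \<le> 1 \<longleftrightarrow> x \<in> D" if "x \<in> gauge_span D" for x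
    using gauge_norm_le_iff[OF that, of 1] by (simp add: scaleC_one)
  moreover have "x \<in> gauge_span D" if "x \<in> D" for x
    using gauge_span_memI[of 1 x] that by (simp add: scaleC_one)
  ultimately show ?thesis unfolding unit_ball_on_def by auto
qed

end

lemma banach_disc_closure_ell_q_hull:
  fixes x :: "nat \<Rightarrow> 'e::complex_banach"
  assumes q: "conjugate_exponents p q" and x: "x \<in> ell_p p"
  shows "banach_disc (closure (ell_q_hull q x))"
proof -
  have "(\<Sum>n. 0 *\<^sub>C x n) \<in> ell_q_hull q x"
    unfolding ell_q_hull_def using ell_q_ball_zero[OF q] by (intro CollectI exI[of _ "\<lambda>n. 0"]) simp
  then have "closure (ell_q_hull q x) \<noteq> {}" using closure_subset by blast
  then show ?thesis
    unfolding banach_disc_def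
    using compact_imp_bounded[OF compact_closure_ell_q_hull[OF q x]] closure_ell_q_hull_abs_convex[OF q x]
    by simp
qed

section \<open>Density implies the approximation property\<close>

text \<open>
  With \<open>r n\<close> the tails of \<open>\<Sum>k. a k\<close>, the bound \<open>a n / sqrt (r n) \<le> 2 * (sqrt (r n) - sqrt (r (n + 1)))\<close>
  telescopes.
\<close>

lemma summable_div_sqrt_tail:
  fixes a :: "nat \<Rightarrow> real"
  assumes pos: "\<And>n. 0 < a n" and s: "summable a"
  defines "r \<equiv> \<lambda>n. \<Sum>k. a (k + n)"
  shows "\<And>n. 0 < r n" "decseq r" "r \<longlonglongrightarrow> 0" "summable (\<lambda>n. a n / sqrt (r n))"
proof -
  have sn: "summable (\<lambda>k. a (k + n))" for n using s by (simp add: summable_iff_shift)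
  show rpos: "0 < r n" for n unfolding r_def using pos by (intro suminf_pos sn) auto
  have step: "r n = a n + r (Suc n)" for n
    using suminf_split_head[OF sn[of n]] by (simp add: r_def)
  have dec: "r (Suc n) \<le> r n" for n using step[of n] pos[of n] by linarith
  then show "decseq r" by (simp add: decseq_Suc_iff)
  show "r \<longlonglongrightarrow> 0" unfolding r_def by (rule suminf_exist_split2[OF s])
  show "summable (\<lambda>n. a n / sqrt (r n))"
  proof (rule summableI_nonneg_bounded)
    show "0 \<le> a n / sqrt (r n)" for n using pos[of n] rpos[of n] by simp
    have le: "a n / sqrt (r n) \<le> 2 * (sqrt (r n) - sqrt (r (Suc n)))" for n
    proof -
      have "a n = (sqrt (r n) + sqrt (r (Suc n))) * (sqrt (r n) - sqrt (r (Suc n)))"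
        using rpos[of n] rpos[of "Suc n"] step[of n] by (simp add: algebra_simps)
      also have "\<dots> \<le> (sqrt (r n) + sqrt (r n)) * (sqrt (r n) - sqrt (r (Suc n)))"
        using dec[of n] by (intro mult_right_mono) auto
      finally show ?thesis using rpos[of n] by (simp add: field_simps)
    qed
    show "(\<Sum>k<n. a k / sqrt (r k)) \<le> 2 * sqrt (r 0)" for n
    proof -
      have "(\<Sum>k<n. a k / sqrt (r k)) \<le> (\<Sum>k<n. 2 * (sqrt (r k) - sqrt (r (Suc k))))"
        by (intro sum_mono le)
      also have "\<dots> = 2 * (sqrt (r 0) - sqrt (r n))"
        using sum_lessThan_telescope'[of "\<lambda>k. 2 * sqrt (r k)" n] by (simp add: right_diff_distrib)
      also have "\<dots> \<le> 2 * sqrt (r 0)" using real_sqrt_ge_zero[OF less_imp_le[OF rpos[of n]]] by simp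
      finally show ?thesis .
    qed
  qed
qed

lemma ell_p_factor:
  fixes x :: "nat \<Rightarrow> 'e::complex_banach"
  assumes p: "1 \<le> p" and x: "x \<in> ell_p p"
  shows "\<exists>d z. z \<in> ell_p p \<and> (\<forall>n. x n = complex_of_real (d n) *\<^sub>C z n) \<and> (\<forall>n. 0 < d n \<and> d n \<le> 1) \<and>
    decseq d \<and> d \<longlonglongrightarrow> 0"
proof -
  \<comment> \<open>The summand \<open>(1 / 2) ^ n\<close> makes all tails r n positive, even if x
    is eventually zero, so that d n > 0.\<close>
  define a where "a n = norm (x n) powr p + (1 / 2) ^ n" for n
  have apos: "0 < a n" for n by (simp add: a_def add_nonneg_pos)
  have asum: "summable a" unfolding a_def using x by (intro summable_add summable_geometric) (auto simp: ell_p_def)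
  define r where "r n = (\<Sum>k. a (k + n))" for n
  note r = summable_div_sqrt_tail[OF apos asum, folded r_def]
  \<comment> \<open>This exponent gives \<open>d n powr p = sqrt (r n / r 0)\<close>, the divisor
    for which the series still converges.\<close>
  define s where "s = 1 / (2 * p)"
  have s: "0 < s" using p by (simp add: s_def)
  define d where "d n = (r n / r 0) powr s" for n
  define z where "z n = complex_of_real (1 / d n) *\<^sub>C x n" for n
  have r_le: "r n \<le> r 0" for n using r(2) by (simp add: decseqD)
  have dpos: "0 < d n" for n using r(1)[of n] r(1)[of 0] by (simp add: d_def)
  have "summable (\<lambda>n. sqrt (r 0) * (a n / sqrt (r n)))" by (rule summable_mult[OF r(4)])
  then have "summable (\<lambda>n. norm (z n) powr p)"
  proof (rule summable_comparison_test')
    fix n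
    have "d n powr p = sqrt (r n / r 0)"
      using p r(1)[of n] r(1)[of 0] by (simp add: d_def s_def powr_powr powr_half_sqrt)
    then have "norm (z n) powr p = norm (x n) powr p / sqrt (r n / r 0)"
      using dpos[of n] unfolding z_def norm_scaleC norm_of_real by (simp add: powr_divide powr_mult)
    also have "\<dots> \<le> a n / sqrt (r n / r 0)"
      using r(1)[of n] r(1)[of 0] by (intro divide_right_mono) (auto simp: a_def)
    also have "\<dots> = sqrt (r 0) * (a n / sqrt (r n))"
      using r(1)[of n] r(1)[of 0] by (simp add: real_sqrt_divide)
    finally show "norm (norm (z n) powr p) \<le> sqrt (r 0) * (a n / sqrt (r n))" by simp
  qed
  then have "z \<in> ell_p p" by (simp add: ell_p_def)
  moreover have "x n = complex_of_real (d n) *\<^sub>C z n" for n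
    using dpos[of n] by (simp add: z_def scaleC_scaleC scaleC_one)
  moreover have "d n \<le> 1" for n
    using r_le[of n] r(1)[of n] r(1)[of 0] s by (simp add: d_def powr_le1)
  moreover have "decseq d"
    using r(1,2) s unfolding decseq_def d_def by (auto intro!: powr_mono2 divide_right_mono simp: less_imp_le)
  moreover have "d \<longlonglongrightarrow> 0"
  proof -
    have "(\<lambda>n. r n / r 0) \<longlonglongrightarrow> 0 / r 0" using r(1)[of 0] by (intro tendsto_intros r(3)) simp
    then have "(\<lambda>n. (r n / r 0) powr s) \<longlonglongrightarrow> 0 powr s"
      using s r(1) by (intro tendsto_powr2) (auto simp: less_imp_le intro!: always_eventually)
    then show ?thesis using s by (simp add: d_def[abs_def])
  qed
  ultimately show ?thesis using dpos by blast
qed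

text \<open>
  If no \<open>\<phi>\<close> were close to \<open>Q\<close>, the functional \<open>(\<phi>, c) \<mapsto> c\<close> would be bounded by the supremum of
  \<open>\<phi> + c Q\<close> over the hull, hence be evaluation at a point \<open>v\<close> with \<open>\<phi> v = 0\<close> for all \<open>\<phi>\<close>
  and \<open>Q v = 1\<close>.
\<close>

lemma gauge_functional_approx:
  fixes z :: "nat \<Rightarrow> 'e::complex_banach" and Q :: "'e \<Rightarrow> complex"
  assumes q: "conjugate_exponents p q" and z: "z \<in> ell_p p"
    and d: "\<And>n. 0 < d n" "\<And>n. d n \<le> 1" "decseq d" "d \<longlonglongrightarrow> 0"
    and Q: "clinear_on (gauge_span (closure (ell_q_hull q z))) Q"
    and M: "\<And>v. v \<in> closure (ell_q_hull q z) \<Longrightarrow> cmod (Q v) \<le> M"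
    and \<eta>: "0 < \<eta>"
  shows "\<exists>\<phi>\<in>dual. \<forall>v\<in>ell_q_hull q (\<lambda>n. complex_of_real (d n) *\<^sub>C z n). cmod (Q v - \<phi> v) \<le> \<eta>"
proof (rule ccontr)
  assume neg: "\<not> ?thesis"
  have p: "1 \<le> p" using q by (simp add: conjugate_exponents_def)
  define D where "D = closure (ell_q_hull q z)"
  have disc: "banach_disc D" unfolding D_def by (rule banach_disc_closure_ell_q_hull[OF q z])
  note G = csubspace_gauge_span[OF disc]
  note Q = Q[folded D_def]
  note M = M[folded D_def]
  have hullD: "(\<Sum>n. \<alpha> n *\<^sub>C z n) \<in> D" if "\<alpha> \<in> ell_q_ball q" for \<alpha>
  proof -
    have "(\<Sum>n. \<alpha> n *\<^sub>C z n) \<in> ell_q_hull q z" using that by (auto simp: ell_q_hull_def)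
    then show ?thesis unfolding D_def by (rule subsetD[OF closure_subset])
  qed
  have DG: "v \<in> gauge_span D" if "v \<in> D" for v
    using that gauge_span_memI[of 1 v D] by (simp add: scaleC_one)
  define x where "x n = complex_of_real (d n) *\<^sub>C z n" for n
  have x: "x \<in> ell_p p"
    using d by (intro ell_p_mono[OF p z, of _ 1]) (auto simp: x_def norm_scaleC mult_left_le_one_le less_imp_le)
  have zD: "z n \<in> D" for n
  proof -
    have "(\<Sum>k. (if k = n then 1 else 0) *\<^sub>C z k) = z n"
      by (subst suminf_finite[of "{n}"]) (auto simp: scaleC_one)
    then show ?thesis using hullD[OF ell_q_ball_unit[OF q, of 1 n]] by simp
  qed
  define \<beta> where "\<beta> n = Q (z n)" for n
  define y where "y n = Q (x n)" for n
  have y: "y n = complex_of_real (d n) * \<beta> n" for n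
    by (simp add: y_def \<beta>_def x_def clinear_on_scaleC[OF Q DG[OF zD]] scaleC_complex_def)
  \<comment> \<open>Finite pairings of \<beta> with the ball are values of Q at truncated sums,
    which lie in D; hence they are bounded by M.\<close>
  have "\<beta> \<in> ell_p p"
  proof (rule ell_p_dual[OF q])
    fix N \<alpha> assume \<alpha>: "\<alpha> \<in> ell_q_ball q"
    define \<alpha>' where "\<alpha>' n = (if n < N then \<alpha> n else 0)" for n
    have "\<alpha>' \<in> ell_q_ball q" by (rule ell_q_ball_solid[OF q \<alpha>]) (simp add: \<alpha>'_def)
    then have "cmod (Q (\<Sum>n. \<alpha>' n *\<^sub>C z n)) \<le> M" by (intro M hullD)
    also have "(\<Sum>n. \<alpha>' n *\<^sub>C z n) = (\<Sum>n<N. \<alpha> n *\<^sub>C z n)"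
      by (subst suminf_finite[of "{..<N}"]) (auto simp: \<alpha>'_def)
    also have "Q (\<Sum>n<N. \<alpha> n *\<^sub>C z n) = (\<Sum>n<N. \<alpha> n * \<beta> n)"
      using csubspaceD(3)[OF G DG[OF zD]]
      by (simp add: clinear_on_sum[OF Q G] clinear_on_scaleC[OF Q DG[OF zD]] \<beta>_def scaleC_complex_def)
    finally show "cmod (\<Sum>n<N. \<alpha> n * \<beta> n) \<le> M" .
  qed
  then have yp: "y \<in> ell_p p"
    by (rule ell_p_mono[OF p, of _ _ 1])
       (use d in \<open>auto simp: y norm_mult mult_left_le_one_le less_imp_le\<close>)
  \<comment> \<open>The multipliers \<open>\<alpha> n * d n / d N\<close> for n \<ge> N stay in the
    ball since d decreases; so the tail from N on lies in d N times D.\<close>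
  have tail: "\<exists>w\<in>D. (\<Sum>n. \<alpha> n *\<^sub>C x n) = (\<Sum>n<N. \<alpha> n *\<^sub>C x n) + complex_of_real (d N) *\<^sub>C w"
    if \<alpha>: "\<alpha> \<in> ell_q_ball q" for \<alpha> N
  proof -
    define \<gamma> where "\<gamma> n = (if n < N then 0 else \<alpha> n * complex_of_real (d n / d N))" for n
    have \<gamma>: "\<gamma> \<in> ell_q_ball q"
    proof (rule ell_q_ball_solid[OF q \<alpha>])
      fix n
      show "cmod (\<gamma> n) \<le> cmod (\<alpha> n)"
      proof (cases "n < N")
        case False
        then have "d n / d N \<le> 1" using d(1)[of N] d(3) by (simp add: decseqD)
        moreover have "cmod (\<gamma> n) = cmod (\<alpha> n) * (d n / d N)"
          using False d(1)[of n] d(1)[of N] by (simp add: \<gamma>_def norm_mult norm_divide)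
        ultimately show ?thesis by (simp only: mult_left_le norm_ge_zero)
      qed (simp add: \<gamma>_def)
    qed
    have "complex_of_real (d N) *\<^sub>C \<gamma> n *\<^sub>C z n = \<alpha> n *\<^sub>C x n - (if n < N then \<alpha> n *\<^sub>C x n else 0)" for n
      using d(1)[of N] by (simp add: \<gamma>_def x_def scaleC_scaleC)
    then have "complex_of_real (d N) *\<^sub>C (\<Sum>n. \<gamma> n *\<^sub>C z n) = (\<Sum>n. \<alpha> n *\<^sub>C x n - (if n < N then \<alpha> n *\<^sub>C x n else 0))"
      using bounded_linear.suminf[OF bounded_linear_scaleC_right ell_q_ball_summable[OF q z \<gamma>], of "complex_of_real (d N)"]
      by simp
    also have "\<dots> = (\<Sum>n. \<alpha> n *\<^sub>C x n) - (\<Sum>n. if n < N then \<alpha> n *\<^sub>C x n else 0)"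
      by (intro suminf_diff[symmetric] ell_q_ball_summable[OF q x \<alpha>] summable_finite[of "{..<N}"]) auto
    also have "(\<Sum>n. if n < N then \<alpha> n *\<^sub>C x n else 0) = (\<Sum>n<N. \<alpha> n *\<^sub>C x n)"
      by (subst suminf_finite[of "{..<N}"]) auto
    finally show ?thesis using hullD[OF \<gamma>] by (intro bexI[of _ "\<Sum>n. \<gamma> n *\<^sub>C z n"]) auto
  qed
  have xG: "\<alpha> *\<^sub>C x n \<in> gauge_span D" for \<alpha> n
    unfolding x_def by (intro csubspaceD(3)[OF G] DG zD)
  \<comment> \<open>Q is not assumed continuous for the norm of E; its bound on D together with d N
    tending to 0 lets it pass through the series.\<close>
  have Qsum: "Q (\<Sum>n. \<alpha> n *\<^sub>C x n) = (\<Sum>n. \<alpha> n * y n)" if \<alpha>: "\<alpha> \<in> ell_q_ball q" for \<alpha>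
  proof -
    have bound: "cmod (Q (\<Sum>n. \<alpha> n *\<^sub>C x n) - (\<Sum>n<N. \<alpha> n * y n)) \<le> d N * M" for N
    proof -
      obtain w where w: "w \<in> D" "(\<Sum>n. \<alpha> n *\<^sub>C x n) = (\<Sum>n<N. \<alpha> n *\<^sub>C x n) + complex_of_real (d N) *\<^sub>C w"
        using tail[OF \<alpha>] by blast
      have "Q (\<Sum>n<N. \<alpha> n *\<^sub>C x n) = (\<Sum>n<N. \<alpha> n * y n)"
        using xG[of 1] xG by (simp add: clinear_on_sum[OF Q G] clinear_on_scaleC[OF Q] y_def scaleC_complex_def scaleC_one)
      then have "Q (\<Sum>n. \<alpha> n *\<^sub>C x n) = (\<Sum>n<N. \<alpha> n * y n) + complex_of_real (d N) * Q w"
        unfolding w(2)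
        by (subst clinear_on_add[OF Q csubspace_sum[OF G xG] csubspaceD(3)[OF G DG[OF w(1)]]])
           (simp add: clinear_on_scaleC[OF Q DG[OF w(1)]] scaleC_complex_def)
      then show ?thesis using M[OF w(1)] d(1)[of N] by (simp add: norm_mult mult_left_mono less_imp_le)
    qed
    have "(\<lambda>N. d N * M) \<longlonglongrightarrow> 0" using tendsto_mult_left_zero[OF d(4)] .
    with always_eventually[OF allI[OF bound]]
    have "(\<lambda>N. Q (\<Sum>n. \<alpha> n *\<^sub>C x n) - (\<Sum>n<N. \<alpha> n * y n)) \<longlonglongrightarrow> 0"
      by (rule Lim_null_comparison)
    from tendsto_diff[OF tendsto_const this, of "Q (\<Sum>n. \<alpha> n *\<^sub>C x n)"]
    have "(\<lambda>N. \<Sum>n<N. \<alpha> n * y n) \<longlonglongrightarrow> Q (\<Sum>n. \<alpha> n *\<^sub>C x n)" by simp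
    moreover have "summable (\<lambda>n. \<alpha> n * y n)"
      using ell_q_ball_summable[OF q yp \<alpha>] by (simp add: scaleC_complex_def)
    ultimately show ?thesis using LIMSEQ_unique[OF _ summable_LIMSEQ] by blast
  qed
  have Rsum: "(\<Sum>n. \<alpha> n * (complex_of_real (1 / \<eta>) * (\<phi> (x n) + c * y n)))
      = complex_of_real (1 / \<eta>) * (\<phi> (\<Sum>n. \<alpha> n *\<^sub>C x n) + c * Q (\<Sum>n. \<alpha> n *\<^sub>C x n))"
    if \<alpha>: "\<alpha> \<in> ell_q_ball q" and \<phi>: "\<phi> \<in> dual" for \<alpha> \<phi> c
  proof -
    have s1: "summable (\<lambda>n. \<alpha> n * \<phi> (x n))"
      using ell_q_ball_summable[OF q dual_ell_p[OF p x \<phi>] \<alpha>] by (simp add: scaleC_complex_def)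
    have s2: "summable (\<lambda>n. \<alpha> n * y n)"
      using ell_q_ball_summable[OF q yp \<alpha>] by (simp add: scaleC_complex_def)
    have "(\<lambda>n. complex_of_real (1 / \<eta>) * (\<alpha> n * \<phi> (x n) + c * (\<alpha> n * y n))) sums
        (complex_of_real (1 / \<eta>) * ((\<Sum>n. \<alpha> n * \<phi> (x n)) + c * (\<Sum>n. \<alpha> n * y n)))"
      by (intro sums_mult sums_add summable_sums s1 s2)
    moreover have "(\<lambda>n. complex_of_real (1 / \<eta>) * (\<alpha> n * \<phi> (x n) + c * (\<alpha> n * y n)))
        = (\<lambda>n. \<alpha> n * (complex_of_real (1 / \<eta>) * (\<phi> (x n) + c * y n)))"
      by (rule ext) (simp add: algebra_simps)
    ultimately have "(\<lambda>n. \<alpha> n * (complex_of_real (1 / \<eta>) * (\<phi> (x n) + c * y n))) sums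
        (complex_of_real (1 / \<eta>) * ((\<Sum>n. \<alpha> n * \<phi> (x n)) + c * (\<Sum>n. \<alpha> n * y n)))"
      by (simp only:)
    from sums_unique[OF this] show ?thesis
      unfolding dual_suminf[OF q x \<alpha> \<phi>] Qsum[OF \<alpha>] by (rule sym)
  qed
  define W where "W = (dual :: ('e \<Rightarrow> complex) set) \<times> (UNIV :: complex set)"
  \<comment> \<open>The factor 1 / \<eta> normalizes the distance assumed in the negated claim, so
    that c is dominated with constant 1.\<close>
  define R where "R w = (\<lambda>n. complex_of_real (1 / \<eta>) * (fst w (x n) + snd w * y n))" for w :: "('e \<Rightarrow> complex) \<times> complex"
  have "\<exists>\<alpha>\<in>ell_q_ball q. \<forall>w\<in>W. snd w = (\<Sum>n. \<alpha> n * R w n)"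
  proof (rule ell_q_ball_representation[OF q])
    show "csubspace W"
      by (rule complex_vector.subspaceI)
         (use csubspaceD[OF csubspace_dual] in \<open>auto simp: W_def scaleC_prod_def zero_prod_def mem_Times_iff\<close>)
    show "clinear_on W R"
      unfolding clinear_on_def
    proof (intro conjI ballI allI)
      show "R (v + w) = R v + R w" for v w by (simp add: R_def fun_eq_iff distrib_left distrib_right add_ac)
      show "R (a *\<^sub>C w) = a *\<^sub>C R w" for a w
        by (simp add: R_def fun_eq_iff scaleC_prod_def scaleC_fun_def scaleC_complex_def distrib_left mult_ac)
    qed
    show "clinear_on W snd" by (auto simp: clinear_on_def scaleC_prod_def)
    show "R w \<in> ell_p p" if w: "w \<in> W" for w
    proof -
      obtain \<phi> c where \<phi>: "w = (\<phi>, c)" "\<phi> \<in> dual" using w by (auto simp: W_def)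
      have "(\<lambda>n. complex_of_real (1 / \<eta>) *\<^sub>C (\<phi> (x n) + c *\<^sub>C y n)) \<in> ell_p p"
        by (rule ell_p_scaleC[OF p ell_p_add[OF p dual_ell_p[OF p x \<phi>(2)] ell_p_scaleC[OF p yp]]])
      then show ?thesis by (simp add: R_def \<phi> scaleC_complex_def)
    qed
    show "cmod (snd w) \<le> K"
      if w: "w \<in> W" and K: "\<And>\<alpha>. \<alpha> \<in> ell_q_ball q \<Longrightarrow> cmod (\<Sum>n. \<alpha> n * R w n) \<le> K" for w K
    proof -
      obtain \<phi> c where \<phi>: "w = (\<phi>, c)" "\<phi> \<in> dual" using w by (auto simp: W_def)
      show ?thesis
      proof (cases "c = 0")
        case True
        then show ?thesis using K[OF ell_q_ball_zero[OF q]] by (simp add: \<phi>)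
      next
        case False
        \<comment> \<open>The negated claim is applied to - \<phi> / c, because \<phi> + c Q equals
          c times the difference of Q and that functional.\<close>
        have "(- 1 / c) *\<^sub>C \<phi> \<in> dual" by (rule csubspaceD(3)[OF csubspace_dual \<phi>(2)])
        then obtain v where v: "v \<in> ell_q_hull q x" "\<eta> < cmod (Q v - ((- 1 / c) *\<^sub>C \<phi>) v)"
          using neg unfolding x_def[abs_def, symmetric] by force
        obtain \<alpha> where \<alpha>: "\<alpha> \<in> ell_q_ball q" "v = (\<Sum>n. \<alpha> n *\<^sub>C x n)" using v(1) by (auto simp: ell_q_hull_def)
        have "(\<Sum>n. \<alpha> n * R w n) = complex_of_real (1 / \<eta>) * (\<phi> v + c * Q v)"
          using Rsum[OF \<alpha>(1) \<phi>(2)] by (simp add: R_def \<phi>(1) \<alpha>(2))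
        also have "\<phi> v + c * Q v = c * (Q v - ((- 1 / c) *\<^sub>C \<phi>) v)"
          using False by (simp add: scaleC_fun_def scaleC_complex_def field_simps)
        finally have "cmod (\<Sum>n. \<alpha> n * R w n) = 1 / \<eta> * (cmod c * cmod (Q v - ((- 1 / c) *\<^sub>C \<phi>) v))"
          using \<eta> by (simp add: norm_mult norm_divide)
        then have "1 / \<eta> * (cmod c * cmod (Q v - ((- 1 / c) *\<^sub>C \<phi>) v)) \<le> K" using K[OF \<alpha>(1)] by simp
        moreover have "1 / \<eta> * (cmod c * \<eta>) \<le> 1 / \<eta> * (cmod c * cmod (Q v - ((- 1 / c) *\<^sub>C \<phi>) v))"
          using v(2) \<eta> by (intro mult_left_mono) auto
        ultimately show ?thesis using \<eta> by (simp add: \<phi>)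
      qed
    qed
  qed
  then obtain \<alpha> where \<alpha>: "\<alpha> \<in> ell_q_ball q" "\<And>\<phi> c. \<phi> \<in> dual \<Longrightarrow> c = (\<Sum>n. \<alpha> n * R (\<phi>, c) n)"
    by (force simp: W_def)
  define v where "v = (\<Sum>n. \<alpha> n *\<^sub>C x n)"
  have c: "c = complex_of_real (1 / \<eta>) * (\<phi> v + c * Q v)" if "\<phi> \<in> dual" for \<phi> c
    using \<alpha>(2)[OF that, of c] Rsum[OF \<alpha>(1) that, of c] by (simp add: R_def v_def)
  have "v = 0"
  proof (rule dual_separates)
    show "\<phi> v = \<phi> 0" if "\<phi> \<in> dual" for \<phi>
      using c[OF that, of 0] \<eta> dualD(5)[OF that] by simp
  qed
  \<comment> \<open>With \<phi> = 0 and c = 1 the identity reads Q v = \<eta>, whereas v = 0 gives Q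
    v = 0.\<close>
  then show False
    using c[OF csubspaceD(1)[OF csubspace_dual], of 1] clinear_on_zero[OF Q G] by simp
qed

lemma dense_imp_approximation_property:
  assumes p: "1 \<le> p"
    and dense: "\<And>(X :: ('e::complex_banach \<times> 'f::complex_vector) set) N. complex_banach_on X N \<Longrightarrow>
      norm_dense_in (poly_tensor 1 X N) (p_compact_poly p 1 X N :: ('e \<times> 'f \<Rightarrow> 'e) set) (poly_norm X N)"
  shows "p_approximation_property p TYPE('e)"
  unfolding p_approximation_property_def
proof (intro allI impI)
  fix K :: "'e set" and \<epsilon> :: real
  assume K: "p_compact p K" and \<epsilon>: "0 < \<epsilon>"
  obtain q where q: "conjugate_exponents p q" using conjugate_exponents_exists[OF p] by blast
  obtain x where x: "x \<in> ell_p p" "K \<subseteq> closure (ell_q_hull q x)"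
    using K unfolding p_compact_def relatively_p_compact_iff[OF q] by blast
  obtain d z where z: "z \<in> ell_p p" and xz: "\<And>n. x n = complex_of_real (d n) *\<^sub>C z n"
    and d: "\<And>n. 0 < d n" "\<And>n. d n \<le> 1" "decseq d" "d \<longlonglongrightarrow> 0"
    using ell_p_factor[OF p x(1)] by blast
  have x_eq: "x = (\<lambda>n. complex_of_real (d n) *\<^sub>C z n)" using xz by blast
  define D where "D = closure (ell_q_hull q z)"
  have disc: "banach_disc D" unfolding D_def by (rule banach_disc_closure_ell_q_hull[OF q z])
  define G where "G = gauge_span D"
  have G: "csubspace G" unfolding G_def by (rule csubspace_gauge_span[OF disc])
  have DG: "v \<in> G" if "v \<in> D" for v
    using that gauge_span_memI[of 1 v D] by (simp add: scaleC_one G_def)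
  define X where "X = G \<times> {0 :: 'f}"
  define N where "N w = gauge_norm D (fst w)" for w :: "'e \<times> 'f"
  have B: "complex_banach_on X N"
    unfolding X_def N_def[abs_def] G_def by (rule complex_banach_on_gauge[OF disc])
  have ball: "unit_ball_on X N = D \<times> {0}"
    unfolding X_def N_def[abs_def] G_def by (rule unit_ball_on_gauge[OF disc])
  \<comment> \<open>The approximation obtained on all of D is thus available on the smaller hull of
    x, where the Q j can be replaced by functionals continuous on E.\<close>
  have hull_sub: "ell_q_hull q x \<subseteq> D"
  proof
    fix v assume "v \<in> ell_q_hull q x"
    then obtain \<alpha> where \<alpha>: "\<alpha> \<in> ell_q_ball q" "v = (\<Sum>n. \<alpha> n *\<^sub>C x n)" by (auto simp: ell_q_hull_def)
    have "(\<lambda>n. \<alpha> n * complex_of_real (d n)) \<in> ell_q_ball q"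
      by (rule ell_q_ball_solid[OF q \<alpha>(1)]) (use d in \<open>simp add: norm_mult mult_left_le less_imp_le\<close>)
    moreover have "v = (\<Sum>n. (\<alpha> n * complex_of_real (d n)) *\<^sub>C z n)" by (simp add: \<alpha>(2) xz scaleC_scaleC)
    ultimately have "v \<in> ell_q_hull q z" by (auto simp: ell_q_hull_def)
    then show "v \<in> D" unfolding D_def by (rule subsetD[OF closure_subset])
  qed
  \<comment> \<open>The inclusion of the gauge space into E, written on pairs and set to 0 off X as
    \<open>hom_poly\<close> requires.\<close>
  define P where "P w = (if w \<in> X then fst w else 0)" for w
  have P_lin: "clinear_on X P"
    unfolding clinear_on_def
  proof (intro conjI ballI allI)
    note XX = csubspaceD[OF complex_banach_onD(1)[OF B]]
    show "P (v + w) = P v + P w" if "v \<in> X" "w \<in> X" for v w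
      using XX(2)[OF that] that by (simp add: P_def)
    show "P (a *\<^sub>C v) = a *\<^sub>C P v" if "v \<in> X" for a v
    proof -
      have "fst (a *\<^sub>C v) = a *\<^sub>C fst v" by (simp add: scaleC_prod_def)
      then show ?thesis using XX(3)[OF that, of a] that by (simp add: P_def)
    qed
  qed
  have Phom: "P \<in> hom_poly 1 X N"
    unfolding hom_poly_def mem_Collect_eq
  proof (intro conjI exI[of _ "\<lambda>ws. P (hd ws)"])
    show "multilinear_on 1 X (\<lambda>ws. P (hd ws))"
      unfolding multilinear_on_def using P_lin by (auto simp: length_Suc_conv)
    obtain C where C: "0 < C" "\<And>v. v \<in> G \<Longrightarrow> norm v \<le> C * gauge_norm D v"
      using norm_le_gauge_norm[OF disc] unfolding G_def by blast
    show "continuous_map (norm_topology X N) euclidean P"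
      unfolding continuous_map_norm_topology_euclidean[OF complex_banach_on_Metric_space[OF B]]
    proof (intro ballI allI impI)
      fix v and e :: real assume v: "v \<in> X" and e: "0 < e"
      have "dist (P v) (P w) < e" if w: "w \<in> X" "N (v - w) < e / C" for w
      proof -
        have "v - w \<in> X" using complex_banach_onD(1)[OF B] v w by (simp add: csubspaceD)
        then have "fst (v - w) \<in> G" unfolding X_def mem_Times_iff by (rule conjunct1)
        then have "norm (fst (v - w)) \<le> C * N (v - w)" unfolding N_def by (rule C(2))
        also have "\<dots> < e" using w(2) C(1) by (simp add: field_simps)
        finally show ?thesis using v w by (simp add: P_def dist_norm)
      qed
      then show "\<exists>d>0. \<forall>w\<in>X. N (v - w) < d \<longrightarrow> dist (P v) (P w) < e"
        using e C(1) by (intro exI[of _ "e / C"]) auto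
    qed
  qed (auto simp: P_def)
  have "P ` unit_ball_on X N \<subseteq> D" unfolding ball by (auto simp: P_def X_def DG)
  then have "relatively_p_compact p (P ` unit_ball_on X N)"
    unfolding relatively_p_compact_iff[OF q] D_def using z by blast
  with Phom have P: "P \<in> p_compact_poly p 1 X N" by (simp add: p_compact_poly_def)
  define Y where "Y = (p_compact_poly p 1 X N :: ('e \<times> 'f \<Rightarrow> 'e) set)"
  have MS: "Metric_space Y (norm_dist Y (poly_norm X N))"
    unfolding Y_def by (rule Metric_space_poly_norm[OF B]) (auto simp: p_compact_poly_def)
  have "P \<in> norm_topology Y (poly_norm X N) closure_of poly_tensor 1 X N"
    using dense[OF B] P unfolding norm_dense_in_def Y_def by simp
  then have "\<forall>r>0. \<exists>R\<in>poly_tensor 1 X N \<inter> Y. poly_norm X N (P - R) < r"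
    unfolding closure_of_norm_topology[OF MS] by blast
  moreover have "0 < \<epsilon> / 2" using \<epsilon> by simp
  ultimately obtain R where R: "R \<in> poly_tensor 1 X N" "R \<in> Y" "poly_norm X N (P - R) < \<epsilon> / 2"
    by blast
  obtain k Q and e :: "nat \<Rightarrow> 'e" where R_eq: "R = (\<lambda>w. \<Sum>j<k. Q j w *\<^sub>C e j)"
    and Q: "\<And>j. j < k \<Longrightarrow> Q j \<in> hom_poly 1 X N"
    using R(1) by (auto simp: poly_tensor_def)
  have PR: "norm (v - (\<Sum>j<k. Q j (v, 0) *\<^sub>C e j)) \<le> \<epsilon> / 2" if v: "v \<in> D" for v
  proof -
    have "P - R \<in> hom_poly 1 X N"
      using Phom R(2) csubspaceD(4)[OF csubspace_hom_poly] unfolding Y_def p_compact_poly_def by blast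
    moreover have "(v, 0) \<in> unit_ball_on X N" using v by (simp add: ball)
    ultimately have "norm ((P - R) (v, 0)) \<le> poly_norm X N (P - R)" by (rule poly_norm_upper[OF B])
    then show ?thesis using R(3) DG[OF v] by (simp add: P_def X_def R_eq)
  qed
  \<comment> \<open>With \<eta> * S = \<epsilon> / 4, replacing the Q j by functionals in
    \<open>dual\<close> costs at most \<epsilon> / 4 on the hull of x; the summand 1 keeps S
    positive when all e j vanish.\<close>
  define S where "S = 1 + (\<Sum>j<k. norm (e j))"
  have S: "0 < S" by (simp add: S_def add_pos_nonneg sum_nonneg)
  define \<eta> where "\<eta> = \<epsilon> / 4 / S"
  have \<eta>: "0 < \<eta>" using \<epsilon> S by (simp add: \<eta>_def)
  have "\<exists>\<phi>\<in>dual. \<forall>v\<in>ell_q_hull q x. cmod (Q j (v, 0) - \<phi> v) \<le> \<eta>" if j: "j < k" for j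
  proof -
    obtain M where M: "\<And>w. w \<in> unit_ball_on X N \<Longrightarrow> cmod (Q j w) \<le> M"
      using hom_poly_bounded[OF B Q[OF j]] by blast
    obtain A where A: "multilinear_on 1 X A" "\<And>w. w \<in> X \<Longrightarrow> Q j w = A (replicate 1 w)"
      using Q[OF j] unfolding hom_poly_def by blast
    have "clinear_on X (\<lambda>w. A ([] @ w # []))"
      by (rule multilinear_onD[OF A(1)]) (use complex_banach_onD(1)[OF B] in auto)
    then have lin: "clinear_on X (Q j)"
      using A(2) complex_banach_onD(1)[OF B] by (auto simp: clinear_on_def csubspaceD)
    have "clinear_on G (\<lambda>v. Q j (v, 0))"
      unfolding clinear_on_def
    proof (intro conjI ballI allI)
      show "Q j (v + w, 0) = Q j (v, 0) + Q j (w, 0)" if "v \<in> G" "w \<in> G" for v w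
        using clinear_on_add[OF lin, of "(v, 0)" "(w, 0)"] that by (simp add: X_def)
      show "Q j (a *\<^sub>C v, 0) = a *\<^sub>C Q j (v, 0)" if "v \<in> G" for a v
        using clinear_on_scaleC[OF lin, of "(v, 0)" a] that by (simp add: X_def scaleC_prod_def)
    qed
    then show ?thesis
      unfolding x_eq G_def D_def
      by (rule gauge_functional_approx[OF q z d _ _ \<eta>]) (rule M, simp add: ball D_def)
  qed
  then obtain \<phi> where \<phi>: "\<And>j. j < k \<Longrightarrow> \<phi> j \<in> dual"
    "\<And>j v. j < k \<Longrightarrow> v \<in> ell_q_hull q x \<Longrightarrow> cmod (Q j (v, 0) - \<phi> j v) \<le> \<eta>" by metis
  define T where "T v = (\<Sum>j<k. \<phi> j v *\<^sub>C e j)" for v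
  have T: "bounded_clinear T"
    unfolding bounded_clinear_def
  proof
    show "clinear_on UNIV T"
      using \<phi>(1) by (simp add: clinear_on_def T_def dualD(3,4) scaleC_add_left sum.distrib
          complex_vector.scale_sum_right)
    show "bounded_linear T"
      unfolding T_def[abs_def] using \<phi>(1)
      by (intro bounded_linear_sum bounded_linear_compose[OF bounded_linear_scaleC_left] dualD(2)) auto
  qed
  have range: "range T \<subseteq> cspan (e ` {..<k})"
  proof (rule image_subsetI)
    show "T v \<in> cspan (e ` {..<k})" for v
      unfolding T_def
      by (rule complex_vector.span_sum, rule complex_vector.span_scale, rule complex_vector.span_base) blast
  qed
  have hull: "norm (T v - v) \<le> 3 / 4 * \<epsilon>" if v: "v \<in> ell_q_hull q x" for v
  proof -
    have "norm ((\<Sum>j<k. Q j (v, 0) *\<^sub>C e j) - T v) = norm (\<Sum>j<k. (Q j (v, 0) - \<phi> j v) *\<^sub>C e j)"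
      by (simp add: T_def complex_vector.scale_left_diff_distrib sum_subtractf)
    also have "\<dots> \<le> (\<Sum>j<k. \<eta> * norm (e j))"
      using \<phi>(2)[OF _ v] by (intro order_trans[OF norm_sum] sum_mono) (simp add: norm_scaleC mult_right_mono)
    also have "\<dots> \<le> \<eta> * S" using \<eta> by (simp add: S_def distrib_left flip: sum_distrib_left)
    also have "\<dots> = \<epsilon> / 4" using S by (simp add: \<eta>_def)
    finally have "norm ((\<Sum>j<k. Q j (v, 0) *\<^sub>C e j) - T v) \<le> \<epsilon> / 4" .
    moreover have "norm (v - (\<Sum>j<k. Q j (v, 0) *\<^sub>C e j)) \<le> \<epsilon> / 2" using hull_sub v by (intro PR) blast
    ultimately have "norm (v - T v) \<le> \<epsilon> / 2 + \<epsilon> / 4"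
      using norm_triangle_mono[of "v - (\<Sum>j<k. Q j (v, 0) *\<^sub>C e j)" "\<epsilon> / 2" "(\<Sum>j<k. Q j (v, 0) *\<^sub>C e j) - T v" "\<epsilon> / 4"]
      by simp
    then show ?thesis by (simp add: norm_minus_commute)
  qed
  \<comment> \<open>The nonstrict bound 3/4 \<epsilon> on the hull extends to its closure, which
    contains K, and is still below \<epsilon>.\<close>
  have "closed {v. norm (T v - v) \<le> 3 / 4 * \<epsilon>}"
    using T by (intro closed_Collect_le continuous_intros linear_continuous_on) (simp add: bounded_clinear_def)
  then have "closure (ell_q_hull q x) \<subseteq> {v. norm (T v - v) \<le> 3 / 4 * \<epsilon>}"
    using hull by (intro closure_minimal) auto
  then have "norm (T v - v) < \<epsilon>" if "v \<in> K" for v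
    using x(2) that \<epsilon> by fastforce
  with T range show "\<exists>T. bounded_clinear T \<and> (\<exists>B. finite B \<and> range T \<subseteq> cspan B) \<and> (\<forall>x\<in>K. norm (T x - x) < \<epsilon>)"
    by (intro exI[of _ T]) blast
qed

theorem proposition4p2:
  fixes p :: real
    and F :: "'f::complex_vector set" and nF :: "'f \<Rightarrow> real"
  assumes "1 \<le> p"
    and "complex_banach_on F nF"
  shows "(\<forall>m. isometrically_isomorphic
              (p_compact_poly p m F nF :: ('f \<Rightarrow> 'e::complex_banach) set) (poly_norm F nF)
              (L_cp p (hom_poly m F nF :: ('f \<Rightarrow> complex) set) (poly_norm F nF)
                 :: (('e \<Rightarrow> complex) \<Rightarrow> ('f \<Rightarrow> complex)) set)
              (eps_norm (poly_norm F nF))) \<and>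
         (p_approximation_property p TYPE('e) \<longleftrightarrow>
            (\<forall>(X :: ('e \<times> 'f) set) nX m. complex_banach_on X nX \<longrightarrow>
               norm_dense_in (poly_tensor m X nX)
                 (p_compact_poly p m X nX :: ('e \<times> 'f \<Rightarrow> 'e) set) (poly_norm X nX)))"
proof (intro conjI allI iffI impI)
  show "isometrically_isomorphic
      (p_compact_poly p m F nF :: ('f \<Rightarrow> 'e) set) (poly_norm F nF)
      (L_cp p (hom_poly m F nF :: ('f \<Rightarrow> complex) set) (poly_norm F nF)
         :: (('e \<Rightarrow> complex) \<Rightarrow> ('f \<Rightarrow> complex)) set)
      (eps_norm (poly_norm F nF))" for m
    by (rule p_compact_poly_isometric_L_cp[OF assms])
next
  fix X :: "('e \<times> 'f) set" and nX m
  assume "p_approximation_property p TYPE('e)" "complex_banach_on X nX"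
  then show "norm_dense_in (poly_tensor m X nX)
      (p_compact_poly p m X nX :: ('e \<times> 'f \<Rightarrow> 'e) set) (poly_norm X nX)"
    by (intro approximation_property_imp_dense assms)
next
  assume "\<forall>(X :: ('e \<times> 'f) set) nX m. complex_banach_on X nX \<longrightarrow>
      norm_dense_in (poly_tensor m X nX)
        (p_compact_poly p m X nX :: ('e \<times> 'f \<Rightarrow> 'e) set) (poly_norm X nX)"
  then show "p_approximation_property p TYPE('e)"
    by (intro dense_imp_approximation_property[OF assms(1), where 'f = 'f]) blast
qed

end
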